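(* Let $G$ be a group, $M$ a right $\mathbb Z[G]$-module, $\varphi:G\to Z(G)$ a group homomorphism into the center of $G$, $X=\bigsqcup_{m\in M}(\{m\}\times G)=M\times G$ the $G$-Alexander multiple conjugation biquandle of $(M,\varphi)$, $A$ an abelian group and $\lambda:G\to A$ a group homomorphism. (1) Let $f:M^2\to A$ be a $G$-invariant multilinear map. The $2$-cocycle $\Phi_{f,\lambda}=(f\otimes{\rm id}_A)\circ\psi_{2,\lambda}\circ\gamma_2\circ{\rm proj}_2:C_2(X;\mathbb Z)\to A\otimes_{\mathbb Z}A$ of the multiple conjugation biquandle $X$ is given by $$\Phi_{f,\lambda}(\langle(m_1,g_1)\rangle\langle(m_2,g_2)\rangle)=f\bigl(m_1-m_2,\;m_2(1-\varphi(g_2)g_2^{-1})\bigr)\otimes\lambda(g_1)$$ for all $(m_1,g_1),(m_2,g_2)\in X$. (2) Let $f:M^3\to A$ be a $G$-invariant multilinear map. The $3$-cocycle $\Phi_{f,\lambda}=(f\otimes{\rm id}_A)\circ\psi_{3,\lambda}\circ\gamma_3\circ{\rm proj}_3:C_3(X;\mathbb Z)\to A\otimes_{\mathbb Z}A$ of the multiple conjugation biquandle $X$ is given by $$\Phi_{f,\lambda}(\langle(m_1,g_1)\rangle\langle(m_2,g_2)\rangle\langle(m_3,g_3)\rangle)=f\bigl((m_1-m_2)(1-\varphi(g_2)^{-1}g_2),\;m_2-m_3,\;m_3(1-\varphi(g_3)g_3^{-1})\bigr)\otimes\lambda(g_1)$$ for all $(m_1,g_1),(m_2,g_2),(m_3,g_3)\in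 X$.
   Context: **$G$-Alexander multiple conjugation biquandle (MCB).** $X=M\times G$ with $(m,g)\,\underline{*}\,(n,h)=(mh+n(\varphi(h)-h),\,h^{-1}gh)$, $(m,g)\,\overline{*}\,(n,h)=(m\varphi(h),\,g)$, decomposed as the disjoint union of the groups $G_m:=\{m\}\times G$ ($m\in M$) with product $(m,g)(m,h)=(m,gh)$. **$G$-invariant multilinear maps.** Multilinear means additive in each variable. $f:M^n\to A$ is $G$-invariant if $f(m_1g,\dots,m_ng)=f(m_1,\dots,m_n)$ for all $g\in G$. Such an $f$ induces a homomorphism $f:C_n^{\rm gp}(M;\mathbb Z)_G\to A$, where $C_n^{\rm gp}(M;\mathbb Z)_G$ is the free abelian group on $M^n$ modulo all $(m_1g,\dots,m_ng)-(m_1,\dots,m_n)$; it is a group cocycle vanishing on tuples having a zero entry. **MCB complex (trivial $X$-set).** For $n\ge0$, $P_n(X;\mathbb Z)$ is the free abelian group on symbols $\langle\bm x_1\rangle\cdots\langle\bm x_k\rangle$, where $\langle\bm x_i\rangle=\langle x_{i1},\dots,x_{in_i}\rangle$ with $n_i\ge1$, all entries of a given $\bm x_i$ lie in one and the same group $G_m$ ($m$ may depend on $i$), and $n_1+\cdots+n_k=n$. Operations with an element apply entrywise. For $n\ge1$, $$\partial_n(\langle\bm x_1\rangle\cdots\langle\bm x_k\rangle)=\sum_{i=1}^k(-1)^{n_1+\cdots+n_{i-1}}\Bigl\{\langle\bm x_1\underline{*}x_{i1}\rangle\cdots\langle\bm x_{i-1}\underline{*}x_{i1}\rangle\langle\widetilde{\bm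 x}_i\overline{*}x_{i1}\rangle\langle\bm x_{i+1}\overline{*}x_{i1}\rangle\cdots\langle\bm x_k\overline{*}x_{i1}\rangle+\sum_{j=1}^{n_i}(-1)^j\langle\bm x_1\rangle\cdots\langle x_{i1},\dots,x_{i(j-1)},x_{i(j+1)},\dots,x_{in_i}\rangle\cdots\langle\bm x_k\rangle\Bigr\},$$ with $\langle\widetilde{\bm x}_i\overline{*}x_{i1}\rangle=\langle(x_{i1}^{-1}x_{i2})\overline{*}x_{i1},\dots,(x_{i1}^{-1}x_{in_i})\overline{*}x_{i1}\rangle$; factors that become empty are omitted. For $\langle\bm a\rangle=\langle a_1,\dots,a_s\rangle$, $\langle\bm b\rangle=\langle b_1,\dots,b_t\rangle$ with all entries in one group $G_m$, put $$\langle\langle\bm a\rangle\langle\bm b\rangle\rangle=\sum_\mu(-1)^{\sum_{l=1}^s(\mu(l)-l)}\langle c_1,\dots,c_{s+t}\rangle,\qquad c_j=a_{\lfloor j;\mu\rfloor}\,b_{j-\lfloor j;\mu\rfloor},$$ over strictly increasing $\mu:\{1,\dots,s\}\to\{1,\dots,s+t\}$, where $\lfloor j;\mu\rfloor$ is the number of $l$ with $\mu(l)\le j$ and $a_0=b_0$ is the identity of $G_m$. $D_n(X;\mathbb Z)\subset P_n(X;\mathbb Z)$ is generated by all $\langle\bm a_1\rangle\cdots\langle\bm a\rangle\langle\bm b\rangle\cdots\langle\bm a_k\rangle-\langle\bm a_1\rangle\cdots\langle\langle\bm a\rangle\langle\bm b\rangle\rangle\cdots\langle\bm a_k\rangle$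 (with $\bm a,\bm b$ having all entries in one $G_m$) for $n\ge2$, and $D_n=0$ for $n\le1$. It is known that $D_*$ is a subcomplex of the chain complex $P_*$; $C_*(X;\mathbb Z)=P_*/D_*$. An $n$-cocycle with values in an abelian group $B$ is a homomorphism $\Phi:C_n(X;\mathbb Z)\to B$ with $\Phi\circ\partial_{n+1}=0$. **The maps ($n\ge2$).** $C_n^{\rm BR}(X;\mathbb Z)$ is the free abelian group on $X^n$, and $C_n^{\rm BR_U}(X;\mathbb Z)$ is the free abelian group on $G^n\times M^n$. - ${\rm proj}_n:P_n(X;\mathbb Z)\to C_n^{\rm BR}(X;\mathbb Z)$ sends $\langle\bm x_1\rangle\cdots\langle\bm x_k\rangle$ to $(x_{11},x_{21},\dots,x_{k1})$ if $k=n$ and to $0$ otherwise. - $\gamma_n((m_1,g_1),\dots,(m_n,g_n))=(g_1,\dots,g_n;\,m_1-m_2,\dots,m_{n-1}-m_n,\,m_n)$. - $\psi_n(g_1,\dots,g_n;m_1,\dots,m_n)=\sum_k(-1)^{k_1+\cdots+k_n}(m_1\bm g_{k,1},\dots,m_n\bm g_{k,n})\in C_n^{\rm gp}(M;\mathbb Z)_G$, where $k$ runs over $\{0,1\}^n$ with $k_1=0$ and $\bm g_{k,i}=\varphi(g_1^{k_1}\cdots g_i^{k_i})g_{i+1}^{k_{i+1}}\cdots g_n^{k_n}$. - $\psi_{n,\lambda}(g_1,\dots,g_n;\bm m)=\psi_n(g_1,\dots,g_n;\bm m)\otimes\lambda(g_1)\in C_n^{\rm gp}(M;\mathbb Z)_G\otimes_{\mathbb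 Z}A$. The composite $(f\otimes{\rm id}_A)\circ\psi_{n,\lambda}\circ\gamma_n\circ{\rm proj}_n$ is formed on $P_n(X;\mathbb Z)$ and then regarded on the quotient $C_n(X;\mathbb Z)$. *)

theory Defs
  imports "HOL-Algebra.Free_Abelian_Groups" "HOL-Algebra.Ring"
begin

section \<open>Free abelian groups, quotients and tensor products\<close>

definition tuples :: "'a set \<Rightarrow> nat \<Rightarrow> 'a list set" where
  "tuples S n = {xs. length xs = n \<and> set xs \<subseteq> S}"

text \<open>The abelian group presented by generators \<open>S\<close> and relators \<open>R\<close>.\<close>

definition fab_quot :: "'a set \<Rightarrow> ('a \<Rightarrow>\<^sub>0 int) set \<Rightarrow> ('a \<Rightarrow>\<^sub>0 int) set monoid" where
  "fab_quot S R = free_Abelian_group S Mod generate (free_Abelian_group S) R"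

definition fab_class :: "'a set \<Rightarrow> ('a \<Rightarrow>\<^sub>0 int) set \<Rightarrow> ('a \<Rightarrow>\<^sub>0 int) \<Rightarrow> ('a \<Rightarrow>\<^sub>0 int) set" where
  "fab_class S R c = generate (free_Abelian_group S) R #>\<^bsub>free_Abelian_group S\<^esub> c"

text \<open>The homomorphic extension of a map on generators to an arbitrary (multiplicatively written)
  abelian group \<open>H\<close>; \<^const>\<open>frag_extend\<close> only covers free abelian targets.\<close>

definition fab_extend :: "('b, 'v) monoid_scheme \<Rightarrow> ('a \<Rightarrow> 'b) \<Rightarrow> ('a \<Rightarrow>\<^sub>0 int) \<Rightarrow> 'b" where
  "fab_extend H f c =
     finprod H (\<lambda>x. f x [^]\<^bsub>H\<^esub> Poly_Mapping.lookup c x) (Poly_Mapping.keys c)"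

text \<open>The map induced on a quotient group; as in the library's first isomorphism theorem, its
  value at a coset \<open>U\<close> is the unique element of \<open>h ` U\<close>.\<close>

definition induced :: "('a \<Rightarrow> 'b) \<Rightarrow> 'a set \<Rightarrow> 'b" where
  "induced h U = the_elem (h ` U)"

definition tensor_relators ::
  "('b, 'u) monoid_scheme \<Rightarrow> ('c, 'v) monoid_scheme \<Rightarrow> ('b \<times> 'c \<Rightarrow>\<^sub>0 int) set" where
  "tensor_relators B C =
     {frag_of (x \<otimes>\<^bsub>B\<^esub> x', y) - frag_of (x, y) - frag_of (x', y) | x x' y.
        x \<in> carrier B \<and> x' \<in> carrier B \<and> y \<in> carrier C} \<union>
     {frag_of (x, y \<otimes>\<^bsub>C\<^esub> y') - frag_of (x, y) - frag_of (x, y') | x y y'.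
        x \<in> carrier B \<and> y \<in> carrier C \<and> y' \<in> carrier C}"

definition tensor ::
  "('b, 'u) monoid_scheme \<Rightarrow> ('c, 'v) monoid_scheme \<Rightarrow> ('b \<times> 'c \<Rightarrow>\<^sub>0 int) set monoid" where
  "tensor B C = fab_quot (carrier B \<times> carrier C) (tensor_relators B C)"

definition tensor_class ::
  "('b, 'u) monoid_scheme \<Rightarrow> ('c, 'v) monoid_scheme \<Rightarrow>
   ('b \<times> 'c \<Rightarrow>\<^sub>0 int) \<Rightarrow> ('b \<times> 'c \<Rightarrow>\<^sub>0 int) set" where
  "tensor_class B C = fab_class (carrier B \<times> carrier C) (tensor_relators B C)"

definition pure_tensor ::
  "('b, 'u) monoid_scheme \<Rightarrow> ('c, 'v) monoid_scheme \<Rightarrow> 'b \<Rightarrow> 'c \<Rightarrow> ('b \<times> 'c \<Rightarrow>\<^sub>0 int) set" where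
  "pure_tensor B C x y = tensor_class B C (frag_of (x, y))"

text \<open>The homomorphism \<open>F \<otimes> H\<close> with codomain \<open>tensor B' C'\<close>.\<close>

definition tensor_map ::
  "('b, 'u) monoid_scheme \<Rightarrow> ('c, 'v) monoid_scheme \<Rightarrow> ('x \<Rightarrow> 'b) \<Rightarrow> ('y \<Rightarrow> 'c) \<Rightarrow>
   ('x \<times> 'y \<Rightarrow>\<^sub>0 int) set \<Rightarrow> ('b \<times> 'c \<Rightarrow>\<^sub>0 int) set" where
  "tensor_map B' C' F H =
     induced (\<lambda>c. tensor_class B' C' (frag_extend (\<lambda>(x, y). frag_of (F x, H y)) c))"


section \<open>Group rings, right modules, centers\<close>

definition group_ring :: "('g, 'u) monoid_scheme \<Rightarrow> ('g \<Rightarrow>\<^sub>0 int) ring" where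
  "group_ring G =
     \<lparr>carrier = carrier (free_Abelian_group (carrier G)),
      monoid.mult = (\<lambda>r s. frag_extend (\<lambda>g. frag_extend (\<lambda>h. frag_of (g \<otimes>\<^bsub>G\<^esub> h)) s) r),
      one = frag_of \<one>\<^bsub>G\<^esub>, ring.zero = 0, ring.add = (+)\<rparr>"

lemma group_ring_ring:
  assumes "group G"
  shows "ring (group_ring G)"
proof -
  interpret G: group G by fact
  let ?K = "\<lambda>c. Poly_Mapping.keys c \<subseteq> carrier G"
  let ?m = "\<lambda>r s. frag_extend (\<lambda>g. frag_extend (\<lambda>h. frag_of (g \<otimes>\<^bsub>G\<^esub> h)) s) r"
  have closed: "?K (?m r s)" if "?K r" "?K s" for r s
    using that keys_frag_extend by (smt (verit, ccfv_threshold) G.m_closed UN_E keys_frag_of singletonD subset_iff)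
  have addl: "?m (r + r') s = ?m r s + ?m r' s" for r r' s
    by (rule frag_extend_add)
  have addr: "?m r (s + s') = ?m r s + ?m r s'" for r s s'
    by (simp add: frag_extend_def[of _ r] frag_extend_add frag_cmul_distrib2 sum.distrib)
  have assoc: "?m (?m r s) t = ?m r (?m s t)" if "?K r" "?K s" "?K t" for r s t
    using that(1)
  proof (induction r rule: free_Abelian_group_induct[consumes 1])
    case (3 g)
    show ?case using that(2)
    proof (induction s rule: free_Abelian_group_induct[consumes 1])
      case (3 h)
      show ?case using that(3)
        by (induction t rule: free_Abelian_group_induct[consumes 1])
          (use \<open>g \<in> carrier G\<close> \<open>h \<in> carrier G\<close> in \<open>auto simp: frag_extend_diff G.m_assoc\<close>)
    qed (auto simp: frag_extend_diff)
  qed (auto simp: frag_extend_diff)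
  have one: "?m (frag_of \<one>\<^bsub>G\<^esub>) r = r" "?m r (frag_of \<one>\<^bsub>G\<^esub>) = r" if "?K r" for r
  proof -
    have "frag_extend h r = r" if "\<And>x. x \<in> carrier G \<Longrightarrow> h x = frag_of x" for h
      using that \<open>?K r\<close> by (metis frag_expansion frag_extend_eq subsetD)
    then show "?m (frag_of \<one>\<^bsub>G\<^esub>) r = r" "?m r (frag_of \<one>\<^bsub>G\<^esub>) = r"
      by simp_all
  qed
  show ?thesis
  proof (rule ringI)
    show "abelian_group (group_ring G)"
    proof (rule abelian_groupI)
      fix x assume "x \<in> carrier (group_ring G)"
      then show "\<exists>y\<in>carrier (group_ring G). y \<oplus>\<^bsub>group_ring G\<^esub> x = \<zero>\<^bsub>group_ring G\<^esub>"
        by (intro bexI[of _ "- x"]) (auto simp: group_ring_def)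
    qed (use keys_add in \<open>fastforce simp: group_ring_def add_ac\<close>)+
    show "Group.monoid (group_ring G)"
      by (rule monoidI) (simp_all add: group_ring_def closed assoc one[simplified])
  qed (simp_all add: group_ring_def addl addr)
qed

locale right_module = R?: ring R + M?: abelian_group M
  for R :: "('r, 'u) ring_scheme" (structure) and M :: "('m, 'v) ring_scheme" (structure) +
  fixes act :: "'m \<Rightarrow> 'r \<Rightarrow> 'm"
  assumes act_closed:
      "\<lbrakk>x \<in> carrier M; a \<in> carrier R\<rbrakk> \<Longrightarrow> act x a \<in> carrier M"
    and act_add_left:
      "\<lbrakk>x \<in> carrier M; y \<in> carrier M; a \<in> carrier R\<rbrakk> \<Longrightarrow>
        act (x \<oplus>\<^bsub>M\<^esub> y) a = act x a \<oplus>\<^bsub>M\<^esub> act y a"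
    and act_add_right:
      "\<lbrakk>x \<in> carrier M; a \<in> carrier R; b \<in> carrier R\<rbrakk> \<Longrightarrow>
        act x (a \<oplus>\<^bsub>R\<^esub> b) = act x a \<oplus>\<^bsub>M\<^esub> act x b"
    and act_mult:
      "\<lbrakk>x \<in> carrier M; a \<in> carrier R; b \<in> carrier R\<rbrakk> \<Longrightarrow>
        act x (a \<otimes>\<^bsub>R\<^esub> b) = act (act x a) b"
    and act_one:
      "x \<in> carrier M \<Longrightarrow> act x \<one>\<^bsub>R\<^esub> = x"

definition group_center :: "('g, 'u) monoid_scheme \<Rightarrow> 'g set" where
  "group_center G = {z \<in> carrier G. \<forall>g \<in> carrier G. z \<otimes>\<^bsub>G\<^esub> g = g \<otimes>\<^bsub>G\<^esub> z}"

text \<open>\<open>f : M\<^sup>n \<rightarrow> A\<close>, with \<open>M\<^sup>n\<close> the lists of length \<open>n\<close>; \<open>A\<close> is written multiplicatively.\<close>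

definition multilinear ::
  "('m, 'v) ring_scheme \<Rightarrow> ('a, 'w) monoid_scheme \<Rightarrow> nat \<Rightarrow> ('m list \<Rightarrow> 'a) \<Rightarrow> bool" where
  "multilinear M A n f \<longleftrightarrow>
     f \<in> tuples (carrier M) n \<rightarrow> carrier A \<and>
     (\<forall>ms \<in> tuples (carrier M) n. \<forall>i < n. \<forall>x \<in> carrier M. \<forall>y \<in> carrier M.
        f (ms[i := x \<oplus>\<^bsub>M\<^esub> y]) = f (ms[i := x]) \<otimes>\<^bsub>A\<^esub> f (ms[i := y]))"

definition G_invariant ::
  "('g, 'u) monoid_scheme \<Rightarrow> ('m, 'v) ring_scheme \<Rightarrow> ('m \<Rightarrow> ('g \<Rightarrow>\<^sub>0 int) \<Rightarrow> 'm) \<Rightarrow>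
   nat \<Rightarrow> ('m list \<Rightarrow> 'a) \<Rightarrow> bool" where
  "G_invariant G M act n f \<longleftrightarrow>
     (\<forall>ms \<in> tuples (carrier M) n. \<forall>g \<in> carrier G.
        f (map (\<lambda>m. act m (frag_of g)) ms) = f ms)"


section \<open>The chain complex of a multiple conjugation biquandle\<close>

text \<open>The data of a multiple conjugation biquandle: a disjoint union of groups \<open>mcb_fiber i\<close>
  (\<open>i \<in> mcb_index\<close>) with the two biquandle operations.\<close>

record ('i, 'x) mcb =
  mcb_index :: "'i set"
  mcb_fiber :: "'i \<Rightarrow> 'x monoid"
  mcb_under :: "'x \<Rightarrow> 'x \<Rightarrow> 'x"
  mcb_over :: "'x \<Rightarrow> 'x \<Rightarrow> 'x"

text \<open>The fiber group that contains a given element.\<close>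

definition mcb_group_of :: "('i, 'x) mcb \<Rightarrow> 'x \<Rightarrow> 'x monoid" where
  "mcb_group_of X x =
     mcb_fiber X (THE i. i \<in> mcb_index X \<and> x \<in> carrier (mcb_fiber X i))"

text \<open>The symbol \<open>\<langle>x\<^sub>1\<rangle>\<cdots>\<langle>x\<^sub>k\<rangle>\<close> is the list of the lists \<open>x\<^sub>i\<close>.\<close>

definition mcb_symbols :: "('i, 'x) mcb \<Rightarrow> nat \<Rightarrow> 'x list list set" where
  "mcb_symbols X n =
     {xss. (\<forall>xs \<in> set xss. xs \<noteq> [] \<and> (\<exists>i \<in> mcb_index X. set xs \<subseteq> carrier (mcb_fiber X i))) \<and>
           sum_list (map length xss) = n}"

definition mcb_P :: "('i, 'x) mcb \<Rightarrow> nat \<Rightarrow> ('x list list \<Rightarrow>\<^sub>0 int) monoid" where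
  "mcb_P X n = free_Abelian_group (mcb_symbols X n)"

definition omit_empty :: "'x list list \<Rightarrow> 'x list list" where
  "omit_empty xss = filter (\<lambda>xs. xs \<noteq> []) xss"

text \<open>Positions are counted from \<open>0\<close>, so the deletion of the entry at position \<open>j\<close> carries the
  sign \<open>(-1)\<^bsup>j+1\<^esup>\<close>.\<close>

definition mcb_face_act :: "('i, 'x) mcb \<Rightarrow> 'x list list \<Rightarrow> nat \<Rightarrow> 'x list list" where
  "mcb_face_act X xss i =
     (let a = hd (xss ! i); H = mcb_group_of X a in
      map (map (\<lambda>y. mcb_under X y a)) (take i xss) @
      [map (\<lambda>y. mcb_over X (inv\<^bsub>H\<^esub> a \<otimes>\<^bsub>H\<^esub> y) a) (tl (xss ! i))] @
      map (map (\<lambda>y. mcb_over X y a)) (drop (Suc i) xss))"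

definition mcb_face_del :: "'x list list \<Rightarrow> nat \<Rightarrow> nat \<Rightarrow> 'x list list" where
  "mcb_face_del xss i j = xss[i := take j (xss ! i) @ drop (Suc j) (xss ! i)]"

definition mcb_boundary :: "('i, 'x) mcb \<Rightarrow> ('x list list \<Rightarrow>\<^sub>0 int) \<Rightarrow> ('x list list \<Rightarrow>\<^sub>0 int)" where
  "mcb_boundary X = frag_extend (\<lambda>xss. \<Sum>i < length xss.
     frag_cmul ((-1) ^ sum_list (map length (take i xss)))
       (frag_of (omit_empty (mcb_face_act X xss i)) +
        (\<Sum>j < length (xss ! i).
           frag_cmul ((-1) ^ Suc j) (frag_of (omit_empty (mcb_face_del xss i j))))))"

text \<open>The sum \<open>\<langle>\<langle>a\<rangle>\<langle>b\<rangle>\<rangle>\<close> over all shuffles, for \<open>a\<close> and \<open>b\<close> in the group \<open>H\<close>. Since \<open>\<mu>\<close> is strictly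
  increasing, \<open>\<mu> l \<ge> l\<close>, so the natural number subtraction does not truncate. The convention
  \<open>a\<^sub>0 = b\<^sub>0 = 1\<close> is realised by putting \<open>1\<close> in front of \<open>a\<close> and \<open>b\<close>.\<close>

definition shuffle_maps :: "nat \<Rightarrow> nat \<Rightarrow> (nat \<Rightarrow> nat) set" where
  "shuffle_maps s t = {\<mu> \<in> {1..s} \<rightarrow>\<^sub>E {1..s + t}. strict_mono_on {1..s} \<mu>}"

definition shuffle_count :: "nat \<Rightarrow> (nat \<Rightarrow> nat) \<Rightarrow> nat \<Rightarrow> nat" where
  "shuffle_count s \<mu> j = card {l \<in> {1..s}. \<mu> l \<le> j}"

definition mcb_shuffle :: "('x, 'u) monoid_scheme \<Rightarrow> 'x list \<Rightarrow> 'x list \<Rightarrow> ('x list \<Rightarrow>\<^sub>0 int)" where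
  "mcb_shuffle H a b =
     (let s = length a; t = length b in
      \<Sum>\<mu> \<in> shuffle_maps s t.
        frag_cmul ((-1) ^ (\<Sum>l = 1..s. \<mu> l - l))
          (frag_of (map (\<lambda>j. (\<one>\<^bsub>H\<^esub> # a) ! shuffle_count s \<mu> j \<otimes>\<^bsub>H\<^esub>
                             (\<one>\<^bsub>H\<^esub> # b) ! (j - shuffle_count s \<mu> j)) [1..<Suc (s + t)])))"

text \<open>Generators of \<open>D\<^sub>n\<close>. There are none for \<open>n \<le> 1\<close>, in accordance with \<open>D\<^sub>n = 0\<close> there,
  because \<open>a\<close> and \<open>b\<close> are nonempty.\<close>

definition mcb_D_gens :: "('i, 'x) mcb \<Rightarrow> nat \<Rightarrow> ('x list list \<Rightarrow>\<^sub>0 int) set" where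
  "mcb_D_gens X n =
     {frag_of (us @ [a, b] @ vs) -
      frag_extend (\<lambda>c. frag_of (us @ [c] @ vs)) (mcb_shuffle (mcb_fiber X i) a b) | us a b vs i.
        us @ [a, b] @ vs \<in> mcb_symbols X n \<and> i \<in> mcb_index X \<and>
        set a \<union> set b \<subseteq> carrier (mcb_fiber X i)}"

definition mcb_C :: "('i, 'x) mcb \<Rightarrow> nat \<Rightarrow> ('x list list \<Rightarrow>\<^sub>0 int) set monoid" where
  "mcb_C X n = fab_quot (mcb_symbols X n) (mcb_D_gens X n)"

definition mcb_class ::
  "('i, 'x) mcb \<Rightarrow> nat \<Rightarrow> ('x list list \<Rightarrow>\<^sub>0 int) \<Rightarrow> ('x list list \<Rightarrow>\<^sub>0 int) set" where
  "mcb_class X n = fab_class (mcb_symbols X n) (mcb_D_gens X n)"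

text \<open>\<open>\<Phi> \<circ> \<partial>\<^sub>n\<^sub>+\<^sub>1 = 0\<close>, where the boundary of the quotient complex \<open>C\<^sub>* = P\<^sub>*/D\<^sub>*\<close> sends the class
  of a chain \<open>c\<close> to the class of its boundary; the abelian group \<open>B\<close> is written multiplicatively.\<close>

definition mcb_cocycle ::
  "('i, 'x) mcb \<Rightarrow> nat \<Rightarrow> ('b, 'v) monoid_scheme \<Rightarrow> (('x list list \<Rightarrow>\<^sub>0 int) set \<Rightarrow> 'b) \<Rightarrow> bool" where
  "mcb_cocycle X n B \<Phi> \<longleftrightarrow>
     \<Phi> \<in> hom (mcb_C X n) B \<and>
     (\<forall>c \<in> carrier (mcb_P X (Suc n)). \<Phi> (mcb_class X n (mcb_boundary X c)) = \<one>\<^bsub>B\<^esub>)"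


section \<open>The \<open>G\<close>-Alexander multiple conjugation biquandle and the maps\<close>

definition alexander_mcb ::
  "('g, 'u) monoid_scheme \<Rightarrow> ('m, 'v) ring_scheme \<Rightarrow> ('m \<Rightarrow> ('g \<Rightarrow>\<^sub>0 int) \<Rightarrow> 'm) \<Rightarrow> ('g \<Rightarrow> 'g) \<Rightarrow>
   ('m, 'm \<times> 'g) mcb" where
  "alexander_mcb G M act \<phi> =
     \<lparr>mcb_index = carrier M,
      mcb_fiber = (\<lambda>m. \<lparr>carrier = {m} \<times> carrier G,
                        monoid.mult = (\<lambda>(_, g) (_, h). (m, g \<otimes>\<^bsub>G\<^esub> h)),
                        one = (m, \<one>\<^bsub>G\<^esub>)\<rparr>),
      mcb_under = (\<lambda>(m, g) (n, h).
        (act m (frag_of h) \<oplus>\<^bsub>M\<^esub> act n (frag_of (\<phi> h) - frag_of h),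
         inv\<^bsub>G\<^esub> h \<otimes>\<^bsub>G\<^esub> g \<otimes>\<^bsub>G\<^esub> h)),
      mcb_over = (\<lambda>(m, g) (n, h). (act m (frag_of (\<phi> h)), g))\<rparr>"

text \<open>\<open>C\<^bsup>gp\<^esup>\<^sub>n(M;\<int>)\<^sub>G\<close>.\<close>

definition gp_relators ::
  "('g, 'u) monoid_scheme \<Rightarrow> ('m, 'v) ring_scheme \<Rightarrow> ('m \<Rightarrow> ('g \<Rightarrow>\<^sub>0 int) \<Rightarrow> 'm) \<Rightarrow> nat \<Rightarrow>
   ('m list \<Rightarrow>\<^sub>0 int) set" where
  "gp_relators G M act n =
     {frag_of (map (\<lambda>m. act m (frag_of g)) ms) - frag_of ms | g ms.
        g \<in> carrier G \<and> ms \<in> tuples (carrier M) n}"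

definition gp_coinv ::
  "('g, 'u) monoid_scheme \<Rightarrow> ('m, 'v) ring_scheme \<Rightarrow> ('m \<Rightarrow> ('g \<Rightarrow>\<^sub>0 int) \<Rightarrow> 'm) \<Rightarrow> nat \<Rightarrow>
   ('m list \<Rightarrow>\<^sub>0 int) set monoid" where
  "gp_coinv G M act n = fab_quot (tuples (carrier M) n) (gp_relators G M act n)"

definition gp_class ::
  "('g, 'u) monoid_scheme \<Rightarrow> ('m, 'v) ring_scheme \<Rightarrow> ('m \<Rightarrow> ('g \<Rightarrow>\<^sub>0 int) \<Rightarrow> 'm) \<Rightarrow> nat \<Rightarrow>
   ('m list \<Rightarrow>\<^sub>0 int) \<Rightarrow> ('m list \<Rightarrow>\<^sub>0 int) set" where
  "gp_class G M act n = fab_class (tuples (carrier M) n) (gp_relators G M act n)"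

text \<open>Elements of \<open>X\<^sup>n\<close> are lists of length \<open>n\<close>, elements of \<open>G\<^sup>n \<times> M\<^sup>n\<close> are pairs of such lists.\<close>

definition proj :: "nat \<Rightarrow> ('x list list \<Rightarrow>\<^sub>0 int) \<Rightarrow> ('x list \<Rightarrow>\<^sub>0 int)" where
  "proj n = frag_extend (\<lambda>xss. if length xss = n then frag_of (map hd xss) else 0)"

definition gamma ::
  "('m, 'v) ring_scheme \<Rightarrow> nat \<Rightarrow> (('m \<times> 'g) list \<Rightarrow>\<^sub>0 int) \<Rightarrow> ('g list \<times> 'm list \<Rightarrow>\<^sub>0 int)" where
  "gamma M n = frag_extend (\<lambda>xs. frag_of
     (map snd xs,
      map (\<lambda>i. if Suc i < n then fst (xs ! i) \<ominus>\<^bsub>M\<^esub> fst (xs ! Suc i) else fst (xs ! i)) [0..<n]))"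

definition group_listprod :: "('g, 'u) monoid_scheme \<Rightarrow> 'g list \<Rightarrow> 'g" where
  "group_listprod G gs = foldr (\<lambda>g h. g \<otimes>\<^bsub>G\<^esub> h) gs \<one>\<^bsub>G\<^esub>"

text \<open>The element \<open>\<phi>(g\<^sub>1\<^bsup>k\<^sub>1\<^esup>\<cdots>g\<^sub>i\<^bsup>k\<^sub>i\<^esup>) g\<^sub>i\<^sub>+\<^sub>1\<^bsup>k\<^sub>i\<^sub>+\<^sub>1\<^esup>\<cdots>g\<^sub>n\<^bsup>k\<^sub>n\<^esup>\<close>, with \<open>i\<close> counted from \<open>0\<close>.\<close>

definition psi_elem ::
  "('g, 'u) monoid_scheme \<Rightarrow> ('g \<Rightarrow> 'g) \<Rightarrow> 'g list \<Rightarrow> nat list \<Rightarrow> nat \<Rightarrow> 'g" where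
  "psi_elem G \<phi> gs ks i =
     \<phi> (group_listprod G (map (\<lambda>j. gs ! j [^]\<^bsub>G\<^esub> (ks ! j)) [0..<Suc i])) \<otimes>\<^bsub>G\<^esub>
     group_listprod G (map (\<lambda>j. gs ! j [^]\<^bsub>G\<^esub> (ks ! j)) [Suc i..<length gs])"

definition psi ::
  "('g, 'u) monoid_scheme \<Rightarrow> ('m, 'v) ring_scheme \<Rightarrow> ('m \<Rightarrow> ('g \<Rightarrow>\<^sub>0 int) \<Rightarrow> 'm) \<Rightarrow> ('g \<Rightarrow> 'g) \<Rightarrow>
   nat \<Rightarrow> 'g list \<Rightarrow> 'm list \<Rightarrow> ('m list \<Rightarrow>\<^sub>0 int) set" where
  "psi G M act \<phi> n gs ms =
     gp_class G M act n
       (\<Sum>ks \<in> {ks \<in> tuples {0, 1} n. ks ! 0 = 0}.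
          frag_cmul ((-1) ^ sum_list ks)
            (frag_of (map (\<lambda>i. act (ms ! i) (frag_of (psi_elem G \<phi> gs ks i))) [0..<n])))"

definition psi_lambda ::
  "('g, 'u) monoid_scheme \<Rightarrow> ('m, 'v) ring_scheme \<Rightarrow> ('m \<Rightarrow> ('g \<Rightarrow>\<^sub>0 int) \<Rightarrow> 'm) \<Rightarrow> ('g \<Rightarrow> 'g) \<Rightarrow>
   ('a, 'w) monoid_scheme \<Rightarrow> ('g \<Rightarrow> 'a) \<Rightarrow> nat \<Rightarrow>
   ('g list \<times> 'm list \<Rightarrow>\<^sub>0 int) \<Rightarrow> (('m list \<Rightarrow>\<^sub>0 int) set \<times> 'a \<Rightarrow>\<^sub>0 int) set" where
  "psi_lambda G M act \<phi> A lam n =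
     fab_extend (tensor (gp_coinv G M act n) A)
       (\<lambda>(gs, ms). pure_tensor (gp_coinv G M act n) A (psi G M act \<phi> n gs ms) (lam (hd gs)))"

text \<open>The composite on \<open>P\<^sub>n\<close>; the map \<open>induced (fab_extend A f)\<close> is the homomorphism
  \<open>C\<^bsup>gp\<^esup>\<^sub>n(M;\<int>)\<^sub>G \<rightarrow> A\<close> induced by \<open>f\<close>.\<close>

definition Phi_P ::
  "('g, 'u) monoid_scheme \<Rightarrow> ('m, 'v) ring_scheme \<Rightarrow> ('m \<Rightarrow> ('g \<Rightarrow>\<^sub>0 int) \<Rightarrow> 'm) \<Rightarrow> ('g \<Rightarrow> 'g) \<Rightarrow>
   ('a, 'w) monoid_scheme \<Rightarrow> ('g \<Rightarrow> 'a) \<Rightarrow> nat \<Rightarrow> ('m list \<Rightarrow> 'a) \<Rightarrow>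
   (('m \<times> 'g) list list \<Rightarrow>\<^sub>0 int) \<Rightarrow> ('a \<times> 'a \<Rightarrow>\<^sub>0 int) set" where
  "Phi_P G M act \<phi> A lam n f =
     tensor_map A A (induced (fab_extend A f)) (\<lambda>a. a) \<circ>
     psi_lambda G M act \<phi> A lam n \<circ> gamma M n \<circ> proj n"

definition Phi ::
  "('g, 'u) monoid_scheme \<Rightarrow> ('m, 'v) ring_scheme \<Rightarrow> ('m \<Rightarrow> ('g \<Rightarrow>\<^sub>0 int) \<Rightarrow> 'm) \<Rightarrow> ('g \<Rightarrow> 'g) \<Rightarrow>
   ('a, 'w) monoid_scheme \<Rightarrow> ('g \<Rightarrow> 'a) \<Rightarrow> nat \<Rightarrow> ('m list \<Rightarrow> 'a) \<Rightarrow>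
   (('m \<times> 'g) list list \<Rightarrow>\<^sub>0 int) set \<Rightarrow> ('a \<times> 'a \<Rightarrow>\<^sub>0 int) set" where
  "Phi G M act \<phi> A lam n f = induced (Phi_P G M act \<phi> A lam n f)"

end

theory Submission
  imports Defs
begin

text \<open>
  The map \<open>\<Phi>\<close> on \<open>P\<^sub>n\<close> is a composite of homomorphisms, so it is known once its values on symbols
  are known. A symbol with fewer than \<open>n\<close> blocks is sent to \<open>0\<close>. On
  \<open>\<langle>(m\<^sub>1,g\<^sub>1)\<rangle>\<cdots>\<langle>(m\<^sub>n,g\<^sub>n)\<rangle>\<close> the value is \<open>w \<otimes> \<lambda>(g\<^sub>1)\<close>, where the weight \<open>w\<close> is the alternating sum
  that defines \<open>\<psi>\<^sub>n\<close>, with \<open>f\<close> applied to each term.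

  Write \<open>c\<^sub>g = \<phi>(g) g\<inverse>\<close> for the twist of \<open>g\<close>. Since \<open>f\<close> does not notice a simultaneous translation of
  its arguments, \<open>f(x g, y \<phi>(g)) = f(x, y c\<^sub>g) = f(x c\<^sub>g\<inverse>, y)\<close>. Hence the weight collapses to
  \<open>f(m\<^sub>1 - m\<^sub>2, m\<^sub>2(1 - c\<^sub>2))\<close> for \<open>n = 2\<close> (\<open>weight_2\<close>) and to
  \<open>f((m\<^sub>1 - m\<^sub>2)(1 - c\<^sub>2\<inverse>), m\<^sub>2 - m\<^sub>3, m\<^sub>3(1 - c\<^sub>3))\<close> for \<open>n = 3\<close> (\<open>weight_3\<close>), where \<open>c\<^sub>i\<close> is the twist of \<open>g\<^sub>i\<close>.

  \<^emph>\<open>Descent to \<open>C\<^sub>n\<close>\<close> (\<open>Phi_P_D_gens\<close>). Every term of a shuffle has fewer than \<open>n\<close> blocks. The other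
  term of the relation, if it has \<open>n\<close> blocks at all, has two neighbours in one fiber, so that some
  \<open>m\<^sub>i - m\<^sub>i\<^sub>+\<^sub>1\<close> is zero and \<open>f\<close> vanishes.

  \<^emph>\<open>The cocycle condition\<close> (\<open>cocycleI\<close>). Only two kinds of symbols of length \<open>n + 1\<close> have a boundary
  with terms of \<open>n\<close> blocks: those with singleton blocks only, and those with one block of two
  elements and singletons otherwise.

  In the first case the boundary pairs, for each position, an acted face with a deleted face. At
  the first position the action multiplies all module components by one and the same central
  element \<open>\<phi>(g\<^sub>1)\<close>, which \<open>f\<close> does not notice, so the two faces cancel. At the other
  positions \<open>\<lambda>(g\<^sub>1)\<close> is common to both, because conjugation disappears in the abelian group \<open>A\<close>, and it remains to compare weights. For \<open>n = 2\<close> the differences of weights at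
  the second and third positions are both \<open>-f(m\<^sub>1 - m\<^sub>2, m\<^sub>3(1 - c\<^sub>3)(1 - c\<^sub>2))\<close>. For \<open>n = 3\<close> put
  \<open>P = f((m\<^sub>1 - m\<^sub>2)(1 - c\<^sub>2\<inverse>), m\<^sub>2 - m\<^sub>3, m\<^sub>4(1 - c\<^sub>4)(1 - c\<^sub>3))\<close> and
  \<open>Q = f((m\<^sub>1 - m\<^sub>2)(1 - c\<^sub>2\<inverse>)(1 - c\<^sub>3\<inverse>), m\<^sub>3 - m\<^sub>4, m\<^sub>4(1 - c\<^sub>4))\<close>; the differences at the second, third and fourth
  positions are \<open>-Q\<close>, \<open>-P - Q\<close> and \<open>-P\<close>. In both degrees the alternating sum is zero.

  In the second case, let the block be \<open>\<langle>(m,g), (m,h)\<rangle>\<close>. In the first position the relation is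
  \<open>\<lambda>(g\<inverse>h) + \<lambda>(g) = \<lambda>(h)\<close>. In a later position it follows from \<open>c\<^sub>k c\<^sub>g = c\<^sub>h\<close> for \<open>k = g\<inverse>h\<close>
  (\<open>twist_left_divide\<close>), which gives \<open>(1 - c\<^sub>k) c\<^sub>g = (1 - c\<^sub>h) - (1 - c\<^sub>g)\<close>.

  The groups \<open>A\<close> and \<open>A \<otimes> A\<close> are written multiplicatively in the code and additively in these
  comments.
\<close>

section \<open>Cancellation in abelian groups and short tuples\<close>

lemma (in comm_group) commutator_trivial:
  assumes "x \<in> carrier G" "y \<in> carrier G"
  shows "x \<otimes> y \<otimes> inv x \<otimes> inv y = \<one>"
  using assms by (simp add: m_comm[of x y] m_assoc)

lemma (in comm_group) cancel_common_left:
  assumes "a \<in> carrier G" "b \<in> carrier G" "c \<in> carrier G"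
  shows "a \<otimes> (b \<otimes> c) \<otimes> inv (a \<otimes> b) = c"
proof -
  have "a \<otimes> (b \<otimes> c) = c \<otimes> (a \<otimes> b)" using assms by (simp add: m_ac)
  then show ?thesis using assms by (simp add: m_assoc)
qed

lemma (in comm_group) cancel_pair:
  assumes "a \<in> carrier G" "b \<in> carrier G" "c \<in> carrier G" "d \<in> carrier G"
  shows "(a \<otimes> b) \<otimes> (c \<otimes> d) \<otimes> inv (a \<otimes> c) = b \<otimes> d"
proof -
  have "(a \<otimes> b) \<otimes> (c \<otimes> d) = (b \<otimes> d) \<otimes> (a \<otimes> c)" using assms by (simp add: m_ac)
  then show ?thesis using assms by (simp add: m_assoc)
qed

lemma (in comm_group) cancel_common:
  assumes "a \<in> carrier G" "b \<in> carrier G" "c \<in> carrier G"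
  shows "a \<otimes> b \<otimes> c \<otimes> inv (a \<otimes> c) = b"
proof -
  have "a \<otimes> b \<otimes> c = b \<otimes> (a \<otimes> c)" using assms by (simp add: m_ac)
  then show ?thesis using assms by (simp add: m_assoc)
qed

lemma (in abelian_group) add_diff_add:
  assumes "p \<in> carrier G" "q \<in> carrier G" "r \<in> carrier G" "s \<in> carrier G"
  shows "(p \<oplus> q) \<ominus> (r \<oplus> s) = (p \<ominus> r) \<oplus> (q \<ominus> s)"
  using assms by (simp add: a_minus_def minus_add a_ac)

lemma (in abelian_group) diff_add_diff:
  assumes "p \<in> carrier G" "q \<in> carrier G" "r \<in> carrier G"
  shows "(p \<ominus> q) \<oplus> (q \<ominus> r) = p \<ominus> r"
  using assms by (simp add: a_minus_def a_assoc r_neg1)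

lemma (in abelian_group) diff_add_cancel:
  assumes "p \<in> carrier G" "q \<in> carrier G"
  shows "(p \<ominus> q) \<oplus> q = p"
  using assms by (simp add: a_minus_def a_assoc l_neg)

lemma (in abelian_group) diff_self: "p \<in> carrier G \<Longrightarrow> p \<ominus> p = \<zero>"
  by (simp add: a_minus_def r_neg)

lemma leading_zero_bits_2: "{ks \<in> tuples {0, 1} 2. ks ! 0 = (0::nat)} = {[0, 0], [0, 1]}"
  by (auto simp: tuples_def numeral_2_eq_2 length_Suc_conv)

lemma leading_zero_bits_3:
  "{ks \<in> tuples {0, 1} 3. ks ! 0 = (0::nat)} = {[0, 0, 0], [0, 0, 1], [0, 1, 0], [0, 1, 1]}"
  by (auto simp: tuples_def numeral_3_eq_3 length_Suc_conv)

lemma upt_2: "[0..<2] = [0, 1]"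
  by (simp add: numeral_2_eq_2)

lemma upt_3: "[0..<3] = [0, 1, 2]"
  by (simp add: numeral_3_eq_3)

lemma tuples_2_iff: "xs \<in> tuples S 2 \<longleftrightarrow> (\<exists>x y. xs = [x, y] \<and> x \<in> S \<and> y \<in> S)"
  by (auto simp: tuples_def numeral_2_eq_2 length_Suc_conv)

lemma tuples_3_iff: "xs \<in> tuples S 3 \<longleftrightarrow> (\<exists>x y z. xs = [x, y, z] \<and> x \<in> S \<and> y \<in> S \<and> z \<in> S)"
  by (auto simp: tuples_def eval_nat_numeral length_Suc_conv)

lemma tuples_4_iff: "xs \<in> tuples S 4 \<longleftrightarrow>
    (\<exists>w x y z. xs = [w, x, y, z] \<and> w \<in> S \<and> x \<in> S \<and> y \<in> S \<and> z \<in> S)"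
  by (auto simp: tuples_def eval_nat_numeral length_Suc_conv)

section \<open>Homomorphisms out of presented abelian groups\<close>

lemma (in comm_group) fab_extend_hom:
  assumes "f \<in> S \<rightarrow> carrier G"
  shows "fab_extend G f \<in> hom (free_Abelian_group S) G"
proof (rule homI)
  fix a assume "a \<in> carrier (free_Abelian_group S)"
  then show "fab_extend G f a \<in> carrier G"
    using assms by (auto simp: fab_extend_def intro!: finprod_closed)
next
  fix a b
  assume ab: "a \<in> carrier (free_Abelian_group S)" "b \<in> carrier (free_Abelian_group S)"
  let ?K = "Poly_Mapping.keys a \<union> Poly_Mapping.keys b"
  \<comment> \<open>The keys of a sum may be fewer than those of the summands, so all three products are
    taken over one common finite set.\<close>
  have wider: "fab_extend G f c = finprod G (\<lambda>x. f x [^] Poly_Mapping.lookup c x) ?K"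
    if "Poly_Mapping.keys c \<subseteq> ?K" for c
    unfolding fab_extend_def
    using that assms ab by (intro finprod_mono_neutral_cong_left) (auto simp: in_keys_iff)
  have "fab_extend G f (a + b) =
      finprod G (\<lambda>x. f x [^] Poly_Mapping.lookup a x \<otimes> f x [^] Poly_Mapping.lookup b x) ?K"
    using assms ab
    by (subst wider[OF keys_add], intro finprod_cong')
       (auto simp: lookup_add int_pow_mult Pi_iff subset_iff)
  also have "\<dots> = fab_extend G f a \<otimes> fab_extend G f b"
    using assms ab by (subst (1 2) wider) (auto intro!: finprod_multf)
  finally show "fab_extend G f (a \<otimes>\<^bsub>free_Abelian_group S\<^esub> b) = fab_extend G f a \<otimes> fab_extend G f b"
    by simp
qed

lemma (in comm_group) fab_extend_frag_of [simp]:
  assumes "f x \<in> carrier G"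
  shows "fab_extend G f (frag_of x) = f x"
  using assms by (simp add: fab_extend_def)

lemma
  assumes "h \<in> hom (free_Abelian_group S) H" "group H"
  shows hom_free_Abelian_group_zero: "h 0 = \<one>\<^bsub>H\<^esub>"
    and hom_free_Abelian_group_closed: "Poly_Mapping.keys a \<subseteq> S \<Longrightarrow> h a \<in> carrier H"
    and hom_free_Abelian_group_add: "Poly_Mapping.keys a \<subseteq> S \<Longrightarrow> Poly_Mapping.keys b \<subseteq> S \<Longrightarrow>
      h (a + b) = h a \<otimes>\<^bsub>H\<^esub> h b"
    and hom_free_Abelian_group_minus: "Poly_Mapping.keys a \<subseteq> S \<Longrightarrow> h (- a) = inv\<^bsub>H\<^esub> (h a)"
    and hom_free_Abelian_group_diff: "Poly_Mapping.keys a \<subseteq> S \<Longrightarrow> Poly_Mapping.keys b \<subseteq> S \<Longrightarrow>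
      h (a - b) = h a \<otimes>\<^bsub>H\<^esub> inv\<^bsub>H\<^esub> (h b)"
proof -
  interpret group_hom "free_Abelian_group S" H h
    using assms by (simp add: group_hom_def group_hom_axioms_def)
  show zero: "h 0 = \<one>\<^bsub>H\<^esub>" using hom_one by simp
  show closed: "Poly_Mapping.keys a \<subseteq> S \<Longrightarrow> h a \<in> carrier H" for a
    using hom_closed by simp
  show add: "Poly_Mapping.keys a \<subseteq> S \<Longrightarrow> Poly_Mapping.keys b \<subseteq> S \<Longrightarrow> h (a + b) = h a \<otimes>\<^bsub>H\<^esub> h b" for a b
    using hom_mult[of a b] by simp
  show minus: "Poly_Mapping.keys a \<subseteq> S \<Longrightarrow> h (- a) = inv\<^bsub>H\<^esub> (h a)" for a
    using hom_inv[of a] by simp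
  show "Poly_Mapping.keys a \<subseteq> S \<Longrightarrow> Poly_Mapping.keys b \<subseteq> S \<Longrightarrow> h (a - b) = h a \<otimes>\<^bsub>H\<^esub> inv\<^bsub>H\<^esub> (h b)"
    using add[of a "- b"] minus[of b] by simp
qed

lemma hom_free_Abelian_group_eqI:
  assumes "h \<in> hom (free_Abelian_group S) H" "h' \<in> hom (free_Abelian_group S) H" "group H"
    and "\<And>x. x \<in> S \<Longrightarrow> h (frag_of x) = h' (frag_of x)"
    and "Poly_Mapping.keys c \<subseteq> S"
  shows "h c = h' c"
  using assms(5)
  by (induction c rule: free_Abelian_group_induct[consumes 1])
     (use assms(1-4) in \<open>simp_all add: hom_free_Abelian_group_zero[OF assms(1,3)]
        hom_free_Abelian_group_zero[OF assms(2,3)] hom_free_Abelian_group_diff[OF assms(1,3)]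
        hom_free_Abelian_group_diff[OF assms(2,3)]\<close>)

lemma frag_extend_hom:
  assumes "\<And>x. x \<in> S \<Longrightarrow> Poly_Mapping.keys (b x) \<subseteq> T"
  shows "frag_extend b \<in> hom (free_Abelian_group S) (free_Abelian_group T)"
proof (rule homI)
  fix x assume "x \<in> carrier (free_Abelian_group S)"
  then show "frag_extend b x \<in> carrier (free_Abelian_group T)"
    using assms keys_frag_extend[of b x] by (simp, blast)
qed (simp add: frag_extend_add)

context
  fixes S :: "'a set" and R :: "('a \<Rightarrow>\<^sub>0 int) set"
  assumes relators: "R \<subseteq> carrier (free_Abelian_group S)"
begin

interpretation F: comm_group "free_Abelian_group S"
  by (rule abelian_free_Abelian_group)

lemma generate_relators_normal: "generate (free_Abelian_group S) R \<lhd> free_Abelian_group S"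
  using F.generate_is_subgroup[OF relators] F.normal_iff_subgroup by blast

lemma comm_group_fab_quot: "comm_group (fab_quot S R)"
  unfolding fab_quot_def by (rule F.abelian_FactGroup[OF F.generate_is_subgroup[OF relators]])

lemma fab_class_hom: "fab_class S R \<in> hom (free_Abelian_group S) (fab_quot S R)"
  using normal.r_coset_hom_Mod[OF generate_relators_normal]
  by (simp add: fab_quot_def fab_class_def[abs_def])

lemma carrier_fab_quot: "carrier (fab_quot S R) = fab_class S R ` carrier (free_Abelian_group S)"
  by (simp add: fab_quot_def fab_class_def[abs_def] carrier_FactGroup)

lemma fab_class_relator:
  assumes "r \<in> R"
  shows "fab_class S R r = \<one>\<^bsub>fab_quot S R\<^esub>"
  unfolding fab_class_def fab_quot_def one_FactGroup
  by (rule F.coset_join2)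
     (use assms relators F.generate_is_subgroup[OF relators] in
      \<open>auto intro: generate.incl simp del: carrier_free_Abelian_group_iff\<close>)

context
  fixes H :: "('b, 'v) monoid_scheme" and h :: "('a \<Rightarrow>\<^sub>0 int) \<Rightarrow> 'b"
  assumes H: "group H" and h: "h \<in> hom (free_Abelian_group S) H"
    and kills: "\<And>r. r \<in> R \<Longrightarrow> h r = \<one>\<^bsub>H\<^esub>"
begin

text \<open>A homomorphism that kills the relators has a kernel containing the subgroup that they generate,
  hence is constant on its cosets. The two lemmas that follow rest on this.\<close>

lemma hom_kills_generate:
  assumes "r \<in> generate (free_Abelian_group S) R"
  shows "h r = \<one>\<^bsub>H\<^esub>"
proof -
  interpret group_hom "free_Abelian_group S" H h
    using H h by (simp add: group_hom_def group_hom_axioms_def)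
  have "generate (free_Abelian_group S) R \<subseteq> kernel (free_Abelian_group S) H h"
    by (rule F.generate_subgroup_incl[OF _ subgroup_kernel])
       (use relators kills in \<open>auto simp: kernel_def simp del: carrier_free_Abelian_group_iff\<close>)
  with assms show ?thesis by (auto simp: kernel_def)
qed

lemma induced_fab_class:
  assumes "Poly_Mapping.keys c \<subseteq> S"
  shows "induced h (fab_class S R c) = h c"
proof -
  interpret H: group H by (rule H)
  let ?N = "generate (free_Abelian_group S) R"
  have N: "Poly_Mapping.keys r \<subseteq> S" if "r \<in> ?N" for r
    using F.generate_in_carrier[OF relators that] by simp
  have "h ` (?N #>\<^bsub>free_Abelian_group S\<^esub> c) = {h c}"
  proof
    show "h ` (?N #>\<^bsub>free_Abelian_group S\<^esub> c) \<subseteq> {h c}"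
      using assms N H h
      by (auto simp: r_coset_def hom_free_Abelian_group_add hom_kills_generate
            hom_free_Abelian_group_closed)
    have "c \<in> ?N #>\<^bsub>free_Abelian_group S\<^esub> c"
      using assms F.rcos_self[OF _ F.generate_is_subgroup[OF relators]] by simp
    then show "{h c} \<subseteq> h ` (?N #>\<^bsub>free_Abelian_group S\<^esub> c)" by blast
  qed
  then show ?thesis by (simp add: induced_def fab_class_def)
qed

lemma induced_hom: "induced h \<in> hom (fab_quot S R) H"
proof (rule homI)
  fix U assume "U \<in> carrier (fab_quot S R)"
  then show "induced h U \<in> carrier H"
    using H h by (auto simp: carrier_fab_quot induced_fab_class hom_free_Abelian_group_closed)
next
  fix U V assume "U \<in> carrier (fab_quot S R)" "V \<in> carrier (fab_quot S R)"
  then obtain a b where ab: "U = fab_class S R a" "V = fab_class S R b"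
    "Poly_Mapping.keys a \<subseteq> S" "Poly_Mapping.keys b \<subseteq> S"
    by (auto simp: carrier_fab_quot)
  have "U \<otimes>\<^bsub>fab_quot S R\<^esub> V = fab_class S R (a + b)"
    using ab hom_mult[OF fab_class_hom, of a b] by simp
  moreover have "Poly_Mapping.keys (a + b) \<subseteq> S"
    using ab keys_add[of a b] by blast
  ultimately show "induced h (U \<otimes>\<^bsub>fab_quot S R\<^esub> V) = induced h U \<otimes>\<^bsub>H\<^esub> induced h V"
    using ab H h by (simp add: induced_fab_class hom_free_Abelian_group_add)
qed

end

end

section \<open>Tensor products\<close>

lemma keys_diff_diff_frag_of:
  "x \<in> S \<Longrightarrow> y \<in> S \<Longrightarrow> z \<in> S \<Longrightarrow> Poly_Mapping.keys (frag_of x - frag_of y - frag_of z) \<subseteq> S"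
  using keys_diff[of "frag_of x - frag_of y" "frag_of z"] keys_diff[of "frag_of x" "frag_of y"]
  by auto

locale tensor_product = B: comm_group B + C: comm_group C
  for B :: "('b, 'u) monoid_scheme" and C :: "('c, 'v) monoid_scheme"
begin

lemma tensor_relators_carrier:
  "tensor_relators B C \<subseteq> carrier (free_Abelian_group (carrier B \<times> carrier C))"
proof
  fix r assume "r \<in> tensor_relators B C"
  then show "r \<in> carrier (free_Abelian_group (carrier B \<times> carrier C))"
    unfolding tensor_relators_def carrier_free_Abelian_group_iff
    by (elim UnE CollectE exE conjE) (simp_all add: keys_diff_diff_frag_of)
qed

lemma comm_group_tensor: "comm_group (tensor B C)"
  unfolding tensor_def by (rule comm_group_fab_quot[OF tensor_relators_carrier])

lemma tensor_class_hom:
  "tensor_class B C \<in> hom (free_Abelian_group (carrier B \<times> carrier C)) (tensor B C)"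
  unfolding tensor_def tensor_class_def by (rule fab_class_hom[OF tensor_relators_carrier])

sublocale tensor: comm_group "tensor B C"
  by (rule comm_group_tensor)

lemma pure_tensor_closed [simp]:
  "x \<in> carrier B \<Longrightarrow> y \<in> carrier C \<Longrightarrow> pure_tensor B C x y \<in> carrier (tensor B C)"
  unfolding pure_tensor_def
  by (rule hom_free_Abelian_group_closed[OF tensor_class_hom]) auto

text \<open>Both families of relators have this shape, so additivity in either factor is an instance.\<close>

lemma tensor_class_relator:
  assumes "frag_of p - frag_of q - frag_of r \<in> tensor_relators B C"
    and "p \<in> carrier B \<times> carrier C" "q \<in> carrier B \<times> carrier C" "r \<in> carrier B \<times> carrier C"
  shows "tensor_class B C (frag_of p) = tensor_class B C (frag_of q) \<otimes>\<^bsub>tensor B C\<^esub> tensor_class B C (frag_of r)"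
proof -
  note hom = hom_free_Abelian_group_diff[OF tensor_class_hom tensor.is_group]
    hom_free_Abelian_group_closed[OF tensor_class_hom tensor.is_group]
  have keys: "Poly_Mapping.keys (frag_of p - frag_of q) \<subseteq> carrier B \<times> carrier C"
    using assms keys_diff[of "frag_of p" "frag_of q"] by auto
  have "tensor_class B C (frag_of p - frag_of q - frag_of r) = \<one>\<^bsub>tensor B C\<^esub>"
    unfolding tensor_def tensor_class_def
    by (rule fab_class_relator[OF tensor_relators_carrier assms(1)])
  then have "tensor_class B C (frag_of p) \<otimes>\<^bsub>tensor B C\<^esub> inv\<^bsub>tensor B C\<^esub> tensor_class B C (frag_of q)
      \<otimes>\<^bsub>tensor B C\<^esub> inv\<^bsub>tensor B C\<^esub> tensor_class B C (frag_of r) = \<one>\<^bsub>tensor B C\<^esub>"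
    using assms(2-4) keys by (simp add: hom)
  then have "tensor_class B C (frag_of p) = inv\<^bsub>tensor B C\<^esub> (inv\<^bsub>tensor B C\<^esub> tensor_class B C (frag_of q)
      \<otimes>\<^bsub>tensor B C\<^esub> inv\<^bsub>tensor B C\<^esub> tensor_class B C (frag_of r))"
    using assms(2-4) by (intro tensor.inv_equality[symmetric]) (simp_all add: hom tensor.m_assoc)
  then show ?thesis
    using assms(2-4) by (simp add: hom tensor.inv_mult)
qed

lemma pure_tensor_mult_left:
  assumes "x \<in> carrier B" "x' \<in> carrier B" "y \<in> carrier C"
  shows "pure_tensor B C (x \<otimes>\<^bsub>B\<^esub> x') y = pure_tensor B C x y \<otimes>\<^bsub>tensor B C\<^esub> pure_tensor B C x' y"
  unfolding pure_tensor_def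
  by (rule tensor_class_relator) (use assms in \<open>auto simp: tensor_relators_def\<close>)

lemma pure_tensor_mult_right:
  assumes "x \<in> carrier B" "y \<in> carrier C" "y' \<in> carrier C"
  shows "pure_tensor B C x (y \<otimes>\<^bsub>C\<^esub> y') = pure_tensor B C x y \<otimes>\<^bsub>tensor B C\<^esub> pure_tensor B C x y'"
  unfolding pure_tensor_def
  by (rule tensor_class_relator) (use assms in \<open>auto simp: tensor_relators_def\<close>)

lemma pure_tensor_left_hom:
  assumes "y \<in> carrier C"
  shows "(\<lambda>x. pure_tensor B C x y) \<in> hom B (tensor B C)"
  using assms by (auto intro!: homI simp: pure_tensor_mult_left)

lemma pure_tensor_right_hom:
  assumes "x \<in> carrier B"
  shows "pure_tensor B C x \<in> hom C (tensor B C)"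
  using assms by (auto intro!: homI simp: pure_tensor_mult_right)

lemma pure_tensor_one_left [simp]:
  "y \<in> carrier C \<Longrightarrow> pure_tensor B C \<one>\<^bsub>B\<^esub> y = \<one>\<^bsub>tensor B C\<^esub>"
  using hom_one[OF pure_tensor_left_hom B.is_group tensor.is_group] by simp

lemma pure_tensor_inv_left:
  assumes "x \<in> carrier B" "y \<in> carrier C"
  shows "pure_tensor B C (inv\<^bsub>B\<^esub> x) y = inv\<^bsub>tensor B C\<^esub> pure_tensor B C x y"
proof -
  interpret group_hom B "tensor B C" "\<lambda>x. pure_tensor B C x y"
    using pure_tensor_left_hom[OF assms(2)] B.is_group tensor.is_group
    by (simp add: group_hom_def group_hom_axioms_def)
  show ?thesis using hom_inv[OF assms(1)] .
qed

lemma pure_tensor_inv_right: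
  assumes "x \<in> carrier B" "y \<in> carrier C"
  shows "pure_tensor B C x (inv\<^bsub>C\<^esub> y) = inv\<^bsub>tensor B C\<^esub> pure_tensor B C x y"
proof -
  interpret group_hom C "tensor B C" "pure_tensor B C x"
    using pure_tensor_right_hom[OF assms(1)] C.is_group tensor.is_group
    by (simp add: group_hom_def group_hom_axioms_def)
  show ?thesis using hom_inv[OF assms(2)] .
qed

end

context
  fixes B :: "('b, 'u) monoid_scheme" and C :: "('c, 'v) monoid_scheme"
    and B' :: "('d, 'w) monoid_scheme" and C' :: "('e, 'x) monoid_scheme" and F H
  assumes grps: "comm_group B" "comm_group C" "comm_group B'" "comm_group C'"
    and homs: "F \<in> hom B B'" "H \<in> hom C C'"
begin

interpretation S: tensor_product B C using grps by (simp add: tensor_product_def)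
interpretation T: tensor_product B' C' using grps by (simp add: tensor_product_def)

private definition lift :: "('b \<times> 'c \<Rightarrow>\<^sub>0 int) \<Rightarrow> ('d \<times> 'e \<Rightarrow>\<^sub>0 int) set" where
  "lift c = tensor_class B' C' (frag_extend (\<lambda>(x, y). frag_of (F x, H y)) c)"

private lemma lift_hom: "lift \<in> hom (free_Abelian_group (carrier B \<times> carrier C)) (tensor B' C')"
proof -
  have "frag_extend (\<lambda>(x, y). frag_of (F x, H y))
      \<in> hom (free_Abelian_group (carrier B \<times> carrier C)) (free_Abelian_group (carrier B' \<times> carrier C'))"
    using homs by (intro frag_extend_hom) (auto dest: hom_in_carrier)
  then show ?thesis
    using hom_compose[OF _ T.tensor_class_hom] by (simp add: lift_def[abs_def] comp_def)
qed

private lemma lift_frag_of: "lift (frag_of (x, y)) = pure_tensor B' C' (F x) (H y)"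
  by (simp add: lift_def pure_tensor_def)

private lemma lift_kills:
  assumes "r \<in> tensor_relators B C"
  shows "lift r = \<one>\<^bsub>tensor B' C'\<^esub>"
proof -
  note F = hom_in_carrier[OF homs(1)] and H = hom_in_carrier[OF homs(2)]
  have lift3: "lift (frag_of p - frag_of q - frag_of r) =
      lift (frag_of p) \<otimes>\<^bsub>tensor B' C'\<^esub> inv\<^bsub>tensor B' C'\<^esub> lift (frag_of q)
        \<otimes>\<^bsub>tensor B' C'\<^esub> inv\<^bsub>tensor B' C'\<^esub> lift (frag_of r)"
    if "p \<in> carrier B \<times> carrier C" "q \<in> carrier B \<times> carrier C" "r \<in> carrier B \<times> carrier C" for p q r
  proof -
    have "Poly_Mapping.keys (frag_of p - frag_of q) \<subseteq> carrier B \<times> carrier C"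
      using that keys_diff[of "frag_of p" "frag_of q"] by auto
    with that show ?thesis
      by (simp add: hom_free_Abelian_group_diff[OF lift_hom T.tensor.is_group])
  qed
  show ?thesis
    using assms unfolding tensor_relators_def
  proof (elim UnE CollectE exE conjE)
    fix x x' y
    assume *: "r = frag_of (x \<otimes>\<^bsub>B\<^esub> x', y) - frag_of (x, y) - frag_of (x', y)"
      "x \<in> carrier B" "x' \<in> carrier B" "y \<in> carrier C"
    have "lift r = pure_tensor B' C' (F x) (H y) \<otimes>\<^bsub>tensor B' C'\<^esub> pure_tensor B' C' (F x') (H y)
       \<otimes>\<^bsub>tensor B' C'\<^esub> inv\<^bsub>tensor B' C'\<^esub> pure_tensor B' C' (F x) (H y)
       \<otimes>\<^bsub>tensor B' C'\<^esub> inv\<^bsub>tensor B' C'\<^esub> pure_tensor B' C' (F x') (H y)"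
      using * by (simp add: lift3 lift_frag_of hom_mult[OF homs(1)] T.pure_tensor_mult_left F H)
    then show ?thesis using * by (simp add: T.tensor.commutator_trivial F H)
  next
    fix x y y'
    assume *: "r = frag_of (x, y \<otimes>\<^bsub>C\<^esub> y') - frag_of (x, y) - frag_of (x, y')"
      "x \<in> carrier B" "y \<in> carrier C" "y' \<in> carrier C"
    have "lift r = pure_tensor B' C' (F x) (H y) \<otimes>\<^bsub>tensor B' C'\<^esub> pure_tensor B' C' (F x) (H y')
       \<otimes>\<^bsub>tensor B' C'\<^esub> inv\<^bsub>tensor B' C'\<^esub> pure_tensor B' C' (F x) (H y)
       \<otimes>\<^bsub>tensor B' C'\<^esub> inv\<^bsub>tensor B' C'\<^esub> pure_tensor B' C' (F x) (H y')"
      using * by (simp add: lift3 lift_frag_of hom_mult[OF homs(2)] T.pure_tensor_mult_right F H)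
    then show ?thesis using * by (simp add: T.tensor.commutator_trivial F H)
  qed
qed

lemma tensor_map_hom: "tensor_map B' C' F H \<in> hom (tensor B C) (tensor B' C')"
  using induced_hom[OF S.tensor_relators_carrier T.tensor.is_group lift_hom lift_kills]
  by (simp add: tensor_map_def tensor_def lift_def[abs_def])

lemma tensor_map_pure_tensor:
  assumes "x \<in> carrier B" "y \<in> carrier C"
  shows "tensor_map B' C' F H (pure_tensor B C x y) = pure_tensor B' C' (F x) (H y)"
proof -
  have "tensor_map B' C' F H (pure_tensor B C x y) = lift (frag_of (x, y))"
    unfolding tensor_map_def pure_tensor_def tensor_class_def[of B C] lift_def[abs_def, symmetric]
    using induced_fab_class[OF S.tensor_relators_carrier T.tensor.is_group lift_hom lift_kills] assms
    by simp
  then show ?thesis by (simp add: lift_frag_of)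
qed

end

section \<open>The chain complex of a partitioned biquandle\<close>

definition mcb_carrier :: "('i, 'x) mcb \<Rightarrow> 'x set" where
  "mcb_carrier X = (\<Union>i \<in> mcb_index X. carrier (mcb_fiber X i))"

text \<open>What the chain groups need: the operations carry a symbol to a symbol because each of them
  maps a fiber into a single fiber.\<close>

locale fibered_mcb =
  fixes X :: "('i, 'x) mcb"
  assumes fiber_group: "i \<in> mcb_index X \<Longrightarrow> group (mcb_fiber X i)"
    and fibers_disjoint: "\<lbrakk>i \<in> mcb_index X; j \<in> mcb_index X; x \<in> carrier (mcb_fiber X i);
      x \<in> carrier (mcb_fiber X j)\<rbrakk> \<Longrightarrow> i = j"
    and under_fiber: "\<lbrakk>i \<in> mcb_index X; a \<in> mcb_carrier X\<rbrakk> \<Longrightarrow>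
      \<exists>j \<in> mcb_index X. (\<lambda>y. mcb_under X y a) ` carrier (mcb_fiber X i) \<subseteq> carrier (mcb_fiber X j)"
    and over_fiber: "\<lbrakk>i \<in> mcb_index X; a \<in> mcb_carrier X\<rbrakk> \<Longrightarrow>
      \<exists>j \<in> mcb_index X. (\<lambda>y. mcb_over X y a) ` carrier (mcb_fiber X i) \<subseteq> carrier (mcb_fiber X j)"
begin

definition fiberwise :: "'x list \<Rightarrow> bool" where
  "fiberwise xs \<longleftrightarrow> (\<exists>i \<in> mcb_index X. set xs \<subseteq> carrier (mcb_fiber X i))"

lemma mcb_symbols_iff:
  "xss \<in> mcb_symbols X n \<longleftrightarrow>
     (\<forall>xs \<in> set xss. xs \<noteq> [] \<and> fiberwise xs) \<and> sum_list (map length xss) = n"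
  by (auto simp: mcb_symbols_def fiberwise_def)

lemma omit_empty_in_symbols:
  assumes "\<And>xs. xs \<in> set xss \<Longrightarrow> fiberwise xs" "sum_list (map length xss) = n"
  shows "omit_empty xss \<in> mcb_symbols X n"
proof -
  have "sum_list (map length (filter (\<lambda>xs. xs \<noteq> []) xss)) = sum_list (map length xss)"
    by (rule sum_list_map_filter) auto
  then show ?thesis using assms by (auto simp: mcb_symbols_iff omit_empty_def)
qed

lemma mcb_group_of_fiber:
  assumes "i \<in> mcb_index X" "a \<in> carrier (mcb_fiber X i)"
  shows "mcb_group_of X a = mcb_fiber X i"
proof -
  have "(THE i. i \<in> mcb_index X \<and> a \<in> carrier (mcb_fiber X i)) = i"
    using assms fibers_disjoint by blast
  then show ?thesis by (simp add: mcb_group_of_def)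
qed

lemma fiberwise_under: "fiberwise xs \<Longrightarrow> a \<in> mcb_carrier X \<Longrightarrow> fiberwise (map (\<lambda>y. mcb_under X y a) xs)"
  unfolding fiberwise_def by (metis (no_types, lifting) image_mono image_set subset_trans under_fiber)

lemma fiberwise_over: "fiberwise xs \<Longrightarrow> a \<in> mcb_carrier X \<Longrightarrow> fiberwise (map (\<lambda>y. mcb_over X y a) xs)"
  unfolding fiberwise_def by (metis (no_types, lifting) image_mono image_set subset_trans over_fiber)

lemma fiberwise_subset: "fiberwise xs \<Longrightarrow> set ys \<subseteq> set xs \<Longrightarrow> fiberwise ys"
  unfolding fiberwise_def by blast

lemma fiberwise_subset_carrier: "fiberwise xs \<Longrightarrow> set xs \<subseteq> mcb_carrier X"
  unfolding fiberwise_def mcb_carrier_def by blast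

lemma fiberwise_singleton [simp]: "fiberwise [x] \<longleftrightarrow> x \<in> mcb_carrier X"
  by (auto simp: fiberwise_def mcb_carrier_def)

text \<open>The quotients \<open>a\<inverse> y\<close> in an acted face are formed in the fiber of \<open>a\<close> and stay there.\<close>

lemma fiberwise_left_divide:
  assumes "fiberwise xs" "a \<in> set xs"
  shows "fiberwise (map (\<lambda>y. inv\<^bsub>mcb_group_of X a\<^esub> a \<otimes>\<^bsub>mcb_group_of X a\<^esub> y) xs)"
proof -
  obtain i where i: "i \<in> mcb_index X" "set xs \<subseteq> carrier (mcb_fiber X i)"
    using assms(1) by (auto simp: fiberwise_def)
  then have "mcb_group_of X a = mcb_fiber X i"
    using assms(2) by (intro mcb_group_of_fiber) auto
  moreover interpret group "mcb_fiber X i" by (rule fiber_group[OF i(1)])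
  have "set (map (\<lambda>y. inv\<^bsub>mcb_fiber X i\<^esub> a \<otimes>\<^bsub>mcb_fiber X i\<^esub> y) xs) \<subseteq> carrier (mcb_fiber X i)"
    using i(2) assms(2) by auto
  ultimately show ?thesis using i(1) by (auto simp: fiberwise_def)
qed

lemma sum_list_length_split:
  assumes "i < length xss"
  shows "sum_list (map length xss) =
    sum_list (map length (take i xss)) + length (xss ! i) + sum_list (map length (drop (Suc i) xss))"
  by (subst id_take_nth_drop[OF assms]) simp

lemma face_act_in_symbols:
  assumes xss: "xss \<in> mcb_symbols X (Suc n)" and i: "i < length xss"
  shows "omit_empty (mcb_face_act X xss i) \<in> mcb_symbols X n"
proof (rule omit_empty_in_symbols)
  define a where "a = hd (xss ! i)"
  let ?H = "mcb_group_of X a"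
  have block: "xs \<noteq> []" "fiberwise xs" if "xs \<in> set xss" for xs
    using xss that by (auto simp: mcb_symbols_iff)
  have i': "xss ! i \<in> set xss" "xss ! i \<noteq> []" "fiberwise (xss ! i)"
    using i block by auto
  have a: "a \<in> set (xss ! i)" "a \<in> mcb_carrier X"
    using i' fiberwise_subset_carrier[of "xss ! i"] by (auto simp: a_def)
  have "fiberwise (map (\<lambda>y. inv\<^bsub>?H\<^esub> a \<otimes>\<^bsub>?H\<^esub> y) (tl (xss ! i)))"
    by (rule fiberwise_subset[OF fiberwise_left_divide[OF i'(3) a(1)]])
       (use i'(2) in \<open>auto dest: list.set_sel(2)\<close>)
  from fiberwise_over[OF this a(2)]
  have middle: "fiberwise (map (\<lambda>y. mcb_over X (inv\<^bsub>?H\<^esub> a \<otimes>\<^bsub>?H\<^esub> y) a) (tl (xss ! i)))"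
    by (simp add: comp_def)
  show "fiberwise xs" if "xs \<in> set (mcb_face_act X xss i)" for xs
    using that middle block a(2)
    by (auto simp: mcb_face_act_def Let_def a_def[symmetric]
        intro!: fiberwise_under fiberwise_over dest: in_set_takeD in_set_dropD)
  have "sum_list (map length xss) = Suc n"
    using xss by (simp add: mcb_symbols_iff)
  then show "sum_list (map length (mcb_face_act X xss i)) = n"
    using sum_list_length_split[OF i] i'(2)
    by (cases "xss ! i") (auto simp: mcb_face_act_def Let_def comp_def)
qed

lemma face_del_in_symbols:
  assumes xss: "xss \<in> mcb_symbols X (Suc n)" and i: "i < length xss" and j: "j < length (xss ! i)"
  shows "omit_empty (mcb_face_del xss i j) \<in> mcb_symbols X n"
proof (rule omit_empty_in_symbols)
  have block: "fiberwise xs" if "xs \<in> set xss" for xs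
    using xss that by (auto simp: mcb_symbols_iff)
  show "fiberwise xs" if xs: "xs \<in> set (mcb_face_del xss i j)" for xs
  proof (cases "xs \<in> set xss")
    case False
    then have "xs = take j (xss ! i) @ drop (Suc j) (xss ! i)"
      using xs set_update_subset_insert[of xss i] by (auto simp: mcb_face_del_def)
    then have "set xs \<subseteq> set (xss ! i)"
      by (auto dest: in_set_takeD in_set_dropD)
    then show ?thesis using fiberwise_subset[OF block[of "xss ! i"]] i by simp
  qed (rule block)
  have "sum_list (map length xss) = Suc n"
    using xss by (simp add: mcb_symbols_iff)
  then show "sum_list (map length (mcb_face_del xss i j)) = n"
    using sum_list_length_split[OF i] i j
    by (simp add: mcb_face_del_def upd_conv_take_nth_drop)
qed

lemma mcb_boundary_hom: "mcb_boundary X \<in> hom (mcb_P X (Suc n)) (mcb_P X n)"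
  unfolding mcb_P_def mcb_boundary_def
proof (rule frag_extend_hom)
  fix xss assume xss: "xss \<in> mcb_symbols X (Suc n)"
  let ?F = "free_Abelian_group (mcb_symbols X n)"
  have cmul: "frag_cmul k c \<in> carrier ?F" if "c \<in> carrier ?F" for k c
    using that keys_cmul[of k c] by auto
  have add: "c + d \<in> carrier ?F" if "c \<in> carrier ?F" "d \<in> carrier ?F" for c d
    using that keys_add[of c d] by auto
  have "(\<Sum>i < length xss. frag_cmul ((-1) ^ sum_list (map length (take i xss)))
       (frag_of (omit_empty (mcb_face_act X xss i)) +
        (\<Sum>j < length (xss ! i). frag_cmul ((-1) ^ Suc j) (frag_of (omit_empty (mcb_face_del xss i j))))))
      \<in> carrier ?F"
    by (intro sum_closed_free_Abelian_group cmul add)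
       (use xss face_act_in_symbols face_del_in_symbols in auto)
  then show "Poly_Mapping.keys (\<Sum>i < length xss. frag_cmul ((-1) ^ sum_list (map length (take i xss)))
       (frag_of (omit_empty (mcb_face_act X xss i)) +
        (\<Sum>j < length (xss ! i). frag_cmul ((-1) ^ Suc j) (frag_of (omit_empty (mcb_face_del xss i j))))))
      \<subseteq> mcb_symbols X n" by simp
qed

end

text \<open>The indices at which a shuffle reads \<open>a\<close> and \<open>b\<close> are in range, so its entries are products of
  genuine entries and not values of \<open>nth\<close> beyond the end of a list.\<close>

lemma shuffle_count_bounds:
  assumes "\<mu> \<in> shuffle_maps s t" "j \<le> s + t"
  shows "shuffle_count s \<mu> j \<le> s" "j - shuffle_count s \<mu> j \<le> t"
proof -
  let ?A = "{l \<in> {1..s}. \<mu> l \<le> j}" and ?B = "{l \<in> {1..s}. j < \<mu> l}"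
  have "card ?A \<le> card {1..s}" by (rule card_mono) auto
  then show "shuffle_count s \<mu> j \<le> s" by (simp add: shuffle_count_def)
  \<comment> \<open>The values of \<open>\<mu>\<close> above \<open>j\<close> are distinct, so there are at most \<open>s + t - j\<close> of them.\<close>
  have "inj_on \<mu> {1..s}"
    using assms(1) by (auto simp: shuffle_maps_def dest: strict_mono_on_imp_inj_on)
  then have "inj_on \<mu> ?B" by (rule inj_on_subset) auto
  then have "card ?B \<le> card {j<..s + t}"
    using assms(1) by (intro card_inj_on_le) (auto simp: shuffle_maps_def PiE_def Pi_def)
  moreover have "card ?A + card ?B = s"
  proof -
    have "?A \<union> ?B = {1..s}" by auto
    moreover have "card (?A \<union> ?B) = card ?A + card ?B"
      by (rule card_Un_disjoint) auto
    ultimately show ?thesis by simp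
  qed
  ultimately show "j - shuffle_count s \<mu> j \<le> t"
    using assms(2) by (simp add: shuffle_count_def)
qed

lemma keys_mcb_shuffle:
  assumes "group H" "set a \<subseteq> carrier H" "set b \<subseteq> carrier H"
  shows "Poly_Mapping.keys (mcb_shuffle H a b) \<subseteq> {c. length c = length a + length b \<and> set c \<subseteq> carrier H}"
proof -
  interpret group H by (rule assms(1))
  let ?S = "{c. length c = length a + length b \<and> set c \<subseteq> carrier H}"
  let ?c = "\<lambda>\<mu>. map (\<lambda>j. (\<one>\<^bsub>H\<^esub> # a) ! shuffle_count (length a) \<mu> j \<otimes>\<^bsub>H\<^esub>
                  (\<one>\<^bsub>H\<^esub> # b) ! (j - shuffle_count (length a) \<mu> j)) [1..<Suc (length a + length b)]"
  have nth: "(\<one>\<^bsub>H\<^esub> # xs) ! k \<in> carrier H" if "set xs \<subseteq> carrier H" "k \<le> length xs" for xs k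
    using that by (cases k) (auto simp: subset_iff)
  have "?c \<mu> \<in> ?S" if "\<mu> \<in> shuffle_maps (length a) (length b)" for \<mu>
  proof -
    have "length (?c \<mu>) = length a + length b" by (simp del: upt_Suc)
    moreover have "set (?c \<mu>) \<subseteq> carrier H"
      using assms(2,3) shuffle_count_bounds[OF that] by (auto intro!: m_closed nth simp del: upt_Suc)
    ultimately show ?thesis by blast
  qed
  moreover have "frag_cmul k (frag_of c) \<in> carrier (free_Abelian_group ?S)" if "c \<in> ?S" for k c
    using that keys_cmul[of k "frag_of c"] by auto
  ultimately have "mcb_shuffle H a b \<in> carrier (free_Abelian_group ?S)"
    unfolding mcb_shuffle_def Let_def by (intro sum_closed_free_Abelian_group) blast
  then show ?thesis by simp
qed

context fibered_mcb
begin

lemma mcb_D_gens_carrier: "mcb_D_gens X n \<subseteq> carrier (free_Abelian_group (mcb_symbols X n))"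
proof
  fix r assume "r \<in> mcb_D_gens X n"
  then obtain us a b vs i where r: "r = frag_of (us @ [a, b] @ vs) -
      frag_extend (\<lambda>c. frag_of (us @ [c] @ vs)) (mcb_shuffle (mcb_fiber X i) a b)"
    and sym: "us @ [a, b] @ vs \<in> mcb_symbols X n"
    and i: "i \<in> mcb_index X" and ab: "set a \<union> set b \<subseteq> carrier (mcb_fiber X i)"
    by (auto simp: mcb_D_gens_def)
  have "Poly_Mapping.keys (mcb_shuffle (mcb_fiber X i) a b)
      \<subseteq> {c. length c = length a + length b \<and> set c \<subseteq> carrier (mcb_fiber X i)}"
    using keys_mcb_shuffle[OF fiber_group[OF i]] ab by simp
  moreover have "us @ [c] @ vs \<in> mcb_symbols X n"
    if "length c = length a + length b" "set c \<subseteq> carrier (mcb_fiber X i)" for c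
    using that sym i by (auto simp: mcb_symbols_iff fiberwise_def)
  ultimately have "Poly_Mapping.keys (frag_extend (\<lambda>c. frag_of (us @ [c] @ vs))
      (mcb_shuffle (mcb_fiber X i) a b)) \<subseteq> mcb_symbols X n"
    by (intro order_trans[OF keys_frag_extend]) auto
  then show "r \<in> carrier (free_Abelian_group (mcb_symbols X n))"
    unfolding r using sym by (auto dest!: subsetD[OF keys_diff])
qed

end

section \<open>Projection to symbols with singleton blocks\<close>

abbreviation singletons :: "'x list \<Rightarrow> 'x list list" where
  "singletons \<equiv> map (\<lambda>x. [x])"

lemma proj_frag_of: "proj n (frag_of xss) = (if length xss = n then frag_of (map hd xss) else 0)"
  by (simp add: proj_def)

lemma proj_frag_of_singletons [simp]: "proj n (frag_of (singletons xs)) = (if length xs = n then frag_of xs else 0)"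
  by (simp add: proj_frag_of comp_def)

text \<open>Every term of a shuffle is a single block. In a relation of \<open>D\<^sub>n\<close> it replaces two blocks of a
  symbol of total length \<open>n\<close>, which leaves fewer than \<open>n\<close> blocks.\<close>

lemma proj_shuffle:
  assumes "length us + length vs + 1 \<noteq> n"
  shows "proj n (frag_extend (\<lambda>c. frag_of (us @ [c] @ vs)) s) = 0"
proof -
  have "proj n (frag_extend (\<lambda>c. frag_of (us @ [c] @ vs)) s)
      = frag_extend (proj n \<circ> (\<lambda>c. frag_of (us @ [c] @ vs))) s"
    unfolding proj_def by (induction s rule: frag_induction[OF subset_UNIV]) (auto simp: frag_extend_diff)
  also have "\<dots> = 0"
    using assms by (intro frag_extend_eq_0) (simp add: proj_frag_of)
  finally show ?thesis .
qed

text \<open>The \<open>i\<close>-th term of the birack boundary is \<open>act_face\<close> minus \<open>del_face\<close>: this is what remains of the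
  boundary of a symbol all of whose blocks are singletons.\<close>

definition act_face :: "('i, 'x) mcb \<Rightarrow> 'x list \<Rightarrow> nat \<Rightarrow> 'x list" where
  "act_face X xs i = map (\<lambda>y. mcb_under X y (xs ! i)) (take i xs) @
     map (\<lambda>y. mcb_over X y (xs ! i)) (drop (Suc i) xs)"

definition del_face :: "'x list \<Rightarrow> nat \<Rightarrow> 'x list" where
  "del_face xs i = take i xs @ drop (Suc i) xs"

lemma proj_boundary_expand:
  "proj n (mcb_boundary X (frag_of xss)) = (\<Sum>i < length xss.
     frag_cmul ((-1) ^ sum_list (map length (take i xss)))
       (proj n (frag_of (omit_empty (mcb_face_act X xss i))) +
        (\<Sum>j < length (xss ! i). frag_cmul ((-1) ^ Suc j) (proj n (frag_of (omit_empty (mcb_face_del xss i j)))))))"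
  unfolding mcb_boundary_def
  by (simp add: proj_def frag_extend_sum frag_extend_cmul frag_extend_add comp_def)

lemma length_omit_empty: "length (omit_empty xss) \<le> length xss"
  by (simp add: omit_empty_def)

lemma length_mcb_face_act: "i < length xss \<Longrightarrow> length (mcb_face_act X xss i) = length xss"
  by (simp add: mcb_face_act_def Let_def)

text \<open>A face never has more blocks than the symbol itself.\<close>

lemma proj_boundary_short:
  assumes "length xss < n"
  shows "proj n (mcb_boundary X (frag_of xss)) = 0"
proof -
  have "proj n (frag_of (omit_empty (mcb_face_act X xss i))) = 0" if "i < length xss" for i
    using assms length_omit_empty[of "mcb_face_act X xss i"] length_mcb_face_act[OF that, of X]
    by (simp add: proj_frag_of)
  moreover have "proj n (frag_of (omit_empty (mcb_face_del xss i j))) = 0" for i j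
    using assms length_omit_empty[of "mcb_face_del xss i j"]
    by (simp add: proj_frag_of mcb_face_del_def)
  ultimately show ?thesis by (simp add: proj_boundary_expand)
qed

lemma omit_empty_append [simp]: "omit_empty (xss @ yss) = omit_empty xss @ omit_empty yss"
  by (simp add: omit_empty_def)

lemma omit_empty_map_singletons [simp]: "omit_empty (map (\<lambda>x. [f x]) xs) = map (\<lambda>x. [f x]) xs"
  by (simp add: omit_empty_def filter_map comp_def)

lemma omit_empty_Cons_Nil [simp]: "omit_empty ([] # xss) = omit_empty xss"
  by (simp add: omit_empty_def)

lemma omit_empty_Cons_Cons [simp]: "omit_empty ((x # xs) # xss) = (x # xs) # omit_empty xss"
  by (simp add: omit_empty_def)

lemma sum_list_length_singletons [simp]: "sum_list (map length (singletons xs)) = length xs"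
  by (simp add: comp_def sum_list_triv)

lemma proj_boundary_singletons:
  assumes "length xs = Suc n"
  shows "proj n (mcb_boundary X (frag_of (singletons xs))) =
    (\<Sum>i \<le> n. frag_cmul ((-1) ^ i) (frag_of (act_face X xs i) - frag_of (del_face xs i)))"
proof -
  have "omit_empty (mcb_face_act X (singletons xs) i) = singletons (act_face X xs i)" if "i \<le> n" for i
    using that assms
    by (simp add: mcb_face_act_def act_face_def Let_def take_map drop_map comp_def)
  moreover have "omit_empty (mcb_face_del (singletons xs) i 0) = singletons (del_face xs i)" if "i \<le> n" for i
    using that assms
    by (simp add: mcb_face_del_def del_face_def upd_conv_take_nth_drop take_map drop_map)
  moreover have "length (act_face X xs i) = n" "length (del_face xs i) = n" if "i \<le> n" for i
    using that assms by (auto simp: act_face_def del_face_def)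
  moreover have "sum_list (map length (take i (singletons xs))) = i" if "i \<le> n" for i
    using that assms by (simp add: take_map del: map_map)
  ultimately show ?thesis
    using assms by (simp add: proj_boundary_expand lessThan_Suc_atMost del: map_map)
qed

text \<open>Faces at the singleton blocks lose a block and are projected to zero. What is left is the
  boundary of the two-element block: its acted face and the deletions of its two entries.\<close>

lemma proj_boundary_pair:
  fixes X :: "('i, 'x) mcb" and x :: 'x
  assumes "length us + length vs + 1 = n"
  defines "H \<equiv> mcb_group_of X x"
  shows "proj n (mcb_boundary X (frag_of (singletons us @ [[x, y]] @ singletons vs))) =
    frag_cmul ((-1) ^ length us)
      (frag_of (map (\<lambda>z. mcb_under X z x) us @ [mcb_over X (inv\<^bsub>H\<^esub> x \<otimes>\<^bsub>H\<^esub> y) x] @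
          map (\<lambda>z. mcb_over X z x) vs)
       - frag_of (us @ [y] @ vs) + frag_of (us @ [x] @ vs))"
proof -
  let ?xss = "singletons us @ [[x, y]] @ singletons vs" and ?k = "length us"
  let ?t = "\<lambda>i. frag_cmul ((-1) ^ sum_list (map length (take i ?xss)))
       (proj n (frag_of (omit_empty (mcb_face_act X ?xss i))) +
        (\<Sum>j < length (?xss ! i). frag_cmul ((-1) ^ Suc j) (proj n (frag_of (omit_empty (mcb_face_del ?xss i j))))))"
  have len: "length ?xss = n" using assms by simp
  \<comment> \<open>A face at a singleton block loses that block, and then has fewer than \<open>n\<close> blocks.\<close>
  have "?t i = 0" if i: "i < n" "i \<noteq> ?k" for i
  proof -
    have "\<exists>z. ?xss ! i = [z]"
    proof (cases "i < ?k")
      case False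
      then obtain m where "i = ?k + Suc m"
        using i(2) by (metis add_Suc_right less_imp_Suc_add linorder_neqE_nat)
      then show ?thesis using i len by (simp add: nth_append)
    qed (simp add: nth_append)
    then obtain z where z: "?xss ! i = [z]" by blast
    have "[] \<in> set (mcb_face_act X ?xss i)" "[] \<in> set (mcb_face_del ?xss i 0)"
      using i len z by (auto simp: mcb_face_act_def mcb_face_del_def Let_def set_update_memI)
    then have "length (omit_empty (mcb_face_act X ?xss i)) < n" "length (omit_empty (mcb_face_del ?xss i 0)) < n"
      using length_filter_less[of "[]" "mcb_face_act X ?xss i" "\<lambda>xs. xs \<noteq> []"]
        length_filter_less[of "[]" "mcb_face_del ?xss i 0" "\<lambda>xs. xs \<noteq> []"]
        length_mcb_face_act[of i ?xss X] i len
      by (simp_all add: omit_empty_def mcb_face_del_def)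
    then show ?thesis unfolding z by (simp add: proj_frag_of)
  qed
  then have "(\<Sum>i < n. ?t i) = (\<Sum>i \<in> {?k}. ?t i)"
    using assms by (intro sum.mono_neutral_right) auto
  then have "proj n (mcb_boundary X (frag_of ?xss)) = ?t ?k"
    by (simp only: proj_boundary_expand len) simp
  also have "\<dots> = frag_cmul ((-1) ^ ?k)
      (frag_of (map (\<lambda>z. mcb_under X z x) us @ [mcb_over X (inv\<^bsub>H\<^esub> x \<otimes>\<^bsub>H\<^esub> y) x] @
          map (\<lambda>z. mcb_over X z x) vs)
       - frag_of (us @ [y] @ vs) + frag_of (us @ [x] @ vs))"
  proof -
    have "omit_empty (mcb_face_act X ?xss ?k) = singletons
        (map (\<lambda>z. mcb_under X z x) us @ [mcb_over X (inv\<^bsub>H\<^esub> x \<otimes>\<^bsub>H\<^esub> y) x] @ map (\<lambda>z. mcb_over X z x) vs)"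
      by (simp add: mcb_face_act_def Let_def H_def comp_def nth_append)
    moreover have "omit_empty (mcb_face_del ?xss ?k 0) = singletons (us @ [y] @ vs)"
      "omit_empty (mcb_face_del ?xss ?k (Suc 0)) = singletons (us @ [x] @ vs)"
      by (simp_all add: mcb_face_del_def nth_append list_update_append)
    moreover have "?xss ! ?k = [x, y]" by (simp add: nth_append)
    moreover have "take ?k ?xss = singletons us" by simp
    ultimately show ?thesis using assms(1)
      by (simp add: lessThan_Suc algebra_simps frag_cmul_distrib2 del: map_append map_map)
  qed
  finally show ?thesis .
qed

context fibered_mcb
begin

text \<open>The blocks of a symbol are nonempty, so its total length exceeds the number of its blocks by
  what the blocks have beyond one element each. With \<open>n\<close> blocks and total length \<open>n + 1\<close> this excess is one,
  with \<open>n + 1\<close> blocks it is zero.\<close>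

lemma mcb_symbols_Suc_cases:
  assumes "xss \<in> mcb_symbols X (Suc n)"
  obtains (short) "length xss < n"
  | (singletons) xs where "xss = singletons xs" "xs \<in> tuples (mcb_carrier X) (Suc n)"
  | (pair) us x y vs where "xss = singletons us @ [[x, y]] @ singletons vs"
      "length us + length vs + 1 = n" "set us \<subseteq> mcb_carrier X" "set vs \<subseteq> mcb_carrier X" "fiberwise [x, y]"
proof -
  have shape: "length xss < sum_list (map length xss) - 1
      \<or> (\<exists>xs. xss = singletons xs \<and> set xs \<subseteq> mcb_carrier X)
      \<or> (\<exists>us x y vs. xss = singletons us @ [[x, y]] @ singletons vs \<and>
           set us \<subseteq> mcb_carrier X \<and> set vs \<subseteq> mcb_carrier X \<and> fiberwise [x, y])"
    if "\<forall>xs \<in> set xss. xs \<noteq> [] \<and> fiberwise xs" for xss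
    using that
  proof (induction xss)
    case (Cons xs xss)
    have total: "length yss \<le> sum_list (map length yss)" if "\<forall>ys \<in> set yss. ys \<noteq> []" for yss :: "'x list list"
      using that by (induction yss) (auto simp: neq_Nil_conv)
    consider x where "xs = [x]" | x y where "xs = [x, y]" | x y z zs where "xs = x # y # z # zs"
      using Cons.prems by (metis list.exhaust list.set_intros(1))
    then show ?case
    proof cases
      case 1
      with Cons.prems have x: "x \<in> mcb_carrier X" by simp
      from Cons consider "length xss < sum_list (map length xss) - 1"
        | ys where "xss = singletons ys" "set ys \<subseteq> mcb_carrier X"
        | us y z vs where "xss = singletons us @ [[y, z]] @ singletons vs"
           "set us \<subseteq> mcb_carrier X" "set vs \<subseteq> mcb_carrier X" "fiberwise [y, z]"
        by auto
      then show ?thesis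
      proof cases
        case 2
        then have "xs # xss = singletons (x # ys)" "set (x # ys) \<subseteq> mcb_carrier X"
          using 1 x by auto
        then show ?thesis by (intro disjI2 disjI1 exI[of _ "x # ys"] conjI)
      next
        case 3
        then have "xs # xss = singletons (x # us) @ [[y, z]] @ singletons vs"
          "set (x # us) \<subseteq> mcb_carrier X"
          using 1 x by auto
        with 3 show ?thesis
          by (intro disjI2 exI[of _ "x # us"] exI[of _ y] exI[of _ z] exI[of _ vs] conjI)
      qed (use 1 in auto)
    next
      case 2
      show ?thesis
      proof (cases "\<forall>ys \<in> set xss. \<exists>z. ys = [z]")
        case True
        define zs where "zs = map hd xss"
        from True have "map (\<lambda>ys. [hd ys]) xss = xss" by (intro map_idI) auto
        then have zs: "xss = singletons zs" by (simp add: zs_def comp_def)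
        then have "xs # xss = singletons [] @ [[x, y]] @ singletons zs" using 2 by simp
        moreover have "set zs \<subseteq> mcb_carrier X" using zs Cons.prems by auto
        moreover have "fiberwise [x, y]" using 2 Cons.prems by simp
        ultimately show ?thesis
          by (intro disjI2 exI[of _ "[]"] exI[of _ x] exI[of _ y] exI[of _ zs] conjI) simp_all
      next
        case False
        then obtain as ys bs where s: "xss = as @ ys # bs" "\<nexists>z. ys = [z]" by (auto dest!: split_list)
        then have "length ys \<ge> 2"
          using Cons.prems by (cases ys; cases "tl ys") auto
        with s 2 total[of as] total[of bs] Cons.prems show ?thesis by auto
      qed
    next
      case 3
      with total[of xss] Cons.prems show ?thesis by auto
    qed
  qed (auto intro: exI[of _ "[]"])
  have total: "sum_list (map length xss) = Suc n" and "\<forall>xs \<in> set xss. xs \<noteq> [] \<and> fiberwise xs"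
    using assms by (auto simp: mcb_symbols_iff)
  from shape[OF this(2)] total show thesis
    by (elim disjE exE conjE) (auto intro: short singletons pair simp: tuples_def simp del: map_map)
qed

end

section \<open>The Alexander biquandle of a module with a central twist\<close>

text \<open>The value of \<open>\<psi>\<^sub>n\<close> before passing to the classes under the action of \<open>G\<close>. Having a representative
  in the free group makes it possible to apply \<open>f\<close> term by term.\<close>

definition psi_chain ::
  "('g, 'u) monoid_scheme \<Rightarrow> ('m \<Rightarrow> ('g \<Rightarrow>\<^sub>0 int) \<Rightarrow> 'm) \<Rightarrow> ('g \<Rightarrow> 'g) \<Rightarrow>
   nat \<Rightarrow> 'g list \<Rightarrow> 'm list \<Rightarrow> ('m list \<Rightarrow>\<^sub>0 int)" where
  "psi_chain G act \<phi> n gs ms =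
     (\<Sum>ks \<in> {ks \<in> tuples {0, 1} n. ks ! 0 = 0}.
        frag_cmul ((-1) ^ sum_list ks)
          (frag_of (map (\<lambda>i. act (ms ! i) (frag_of (psi_elem G \<phi> gs ks i))) [0..<n])))"

definition successive_diffs :: "('m, 'v) ring_scheme \<Rightarrow> nat \<Rightarrow> ('m \<times> 'g) list \<Rightarrow> 'm list" where
  "successive_diffs M n xs =
     map (\<lambda>i. if Suc i < n then fst (xs ! i) \<ominus>\<^bsub>M\<^esub> fst (xs ! Suc i) else fst (xs ! i)) [0..<n]"

locale alexander_data =
  G: group G + A: comm_group A + act: right_module "group_ring G" M act
  for G :: "('g, 'u) monoid_scheme"
    and M :: "('m, 'v) ring_scheme"
    and act :: "'m \<Rightarrow> ('g \<Rightarrow>\<^sub>0 int) \<Rightarrow> 'm"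
    and A :: "('a, 'w) monoid_scheme" +
  fixes \<phi> :: "'g \<Rightarrow> 'g"
    and lam :: "'g \<Rightarrow> 'a"
  assumes phi_hom: "\<phi> \<in> hom G (G\<lparr>carrier := group_center G\<rparr>)"
    and lam_hom: "lam \<in> hom G A"
begin

abbreviation translate :: "'m \<Rightarrow> 'g \<Rightarrow> 'm" (infixl "\<cdot>" 75) where
  "x \<cdot> g \<equiv> act x (frag_of g)"

lemma frag_of_group_ring: "g \<in> carrier G \<Longrightarrow> frag_of g \<in> carrier (group_ring G)"
  by (simp add: group_ring_def)

lemma translate_closed [simp]: "x \<in> carrier M \<Longrightarrow> g \<in> carrier G \<Longrightarrow> x \<cdot> g \<in> carrier M"
  by (simp add: act.act_closed frag_of_group_ring)

lemma translate_add [simp]: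
  "\<lbrakk>x \<in> carrier M; y \<in> carrier M; g \<in> carrier G\<rbrakk> \<Longrightarrow> (x \<oplus>\<^bsub>M\<^esub> y) \<cdot> g = x \<cdot> g \<oplus>\<^bsub>M\<^esub> y \<cdot> g"
  by (simp add: act.act_add_left frag_of_group_ring)

lemma translate_translate [simp]:
  "\<lbrakk>x \<in> carrier M; g \<in> carrier G; h \<in> carrier G\<rbrakk> \<Longrightarrow> x \<cdot> g \<cdot> h = x \<cdot> (g \<otimes>\<^bsub>G\<^esub> h)"
  using act.act_mult[of x "frag_of g" "frag_of h"] frag_of_group_ring[of g] frag_of_group_ring[of h]
  by (simp add: group_ring_def)

lemma translate_one [simp]: "x \<in> carrier M \<Longrightarrow> x \<cdot> \<one>\<^bsub>G\<^esub> = x"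
  using act.act_one[of x] by (simp add: group_ring_def)

lemma translate_zero [simp]: "g \<in> carrier G \<Longrightarrow> \<zero>\<^bsub>M\<^esub> \<cdot> g = \<zero>\<^bsub>M\<^esub>"
  using translate_add[of "\<zero>\<^bsub>M\<^esub>" "\<zero>\<^bsub>M\<^esub>" g] act.M.add.r_cancel_one[of "\<zero>\<^bsub>M\<^esub> \<cdot> g" "\<zero>\<^bsub>M\<^esub> \<cdot> g"]
  by simp

lemma translate_minus [simp]: "x \<in> carrier M \<Longrightarrow> g \<in> carrier G \<Longrightarrow> (\<ominus>\<^bsub>M\<^esub> x) \<cdot> g = \<ominus>\<^bsub>M\<^esub> (x \<cdot> g)"
  using translate_add[of "\<ominus>\<^bsub>M\<^esub> x" x g] by (simp add: act.M.l_neg act.M.minus_equality[symmetric])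

lemma translate_diff:
  "\<lbrakk>x \<in> carrier M; y \<in> carrier M; g \<in> carrier G\<rbrakk> \<Longrightarrow> (x \<ominus>\<^bsub>M\<^esub> y) \<cdot> g = x \<cdot> g \<ominus>\<^bsub>M\<^esub> y \<cdot> g"
  by (simp add: a_minus_def)

lemma act_diff_frag_of:
  assumes "x \<in> carrier M" "g \<in> carrier G" "h \<in> carrier G"
  shows "act x (frag_of g - frag_of h) = x \<cdot> g \<ominus>\<^bsub>M\<^esub> x \<cdot> h"
proof -
  have d: "frag_of g - frag_of h \<in> carrier (group_ring G)"
    using assms keys_diff[of "frag_of g" "frag_of h"] by (auto simp: group_ring_def)
  have "x \<cdot> g = act x (frag_of g - frag_of h) \<oplus>\<^bsub>M\<^esub> x \<cdot> h"
    using act.act_add_right[OF assms(1) d frag_of_group_ring[OF assms(3)]]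
    by (simp add: group_ring_def)
  moreover have "act x (frag_of g - frag_of h) \<in> carrier M"
    by (rule act.act_closed[OF assms(1) d])
  ultimately show ?thesis
    using assms by (simp add: a_minus_def act.M.a_assoc act.M.r_neg)
qed

lemma phi_closed [simp]: "g \<in> carrier G \<Longrightarrow> \<phi> g \<in> carrier G"
  using hom_in_carrier[OF phi_hom] by (simp add: group_center_def)

lemma phi_central: "g \<in> carrier G \<Longrightarrow> h \<in> carrier G \<Longrightarrow> \<phi> g \<otimes>\<^bsub>G\<^esub> h = h \<otimes>\<^bsub>G\<^esub> \<phi> g"
  using hom_in_carrier[OF phi_hom] by (simp add: group_center_def)

lemma phi_mult [simp]: "g \<in> carrier G \<Longrightarrow> h \<in> carrier G \<Longrightarrow> \<phi> (g \<otimes>\<^bsub>G\<^esub> h) = \<phi> g \<otimes>\<^bsub>G\<^esub> \<phi> h"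
  using hom_mult[OF phi_hom] by simp

sublocale phi: group_hom G G \<phi>
  by unfold_locales (simp add: hom_def)

sublocale lam: group_hom G A lam
  by unfold_locales (rule lam_hom)

text \<open>The image of \<open>\<phi>\<close> is central, hence \<open>\<phi>\<close> is constant on conjugacy classes; so is \<open>\<lambda>\<close>, since \<open>A\<close> is
  abelian. The under-operation of the biquandle conjugates group components, so both facts are
  what makes its faces comparable with the deleted faces.\<close>

lemma phi_conj:
  assumes "g \<in> carrier G" "h \<in> carrier G"
  shows "\<phi> (inv\<^bsub>G\<^esub> h \<otimes>\<^bsub>G\<^esub> g \<otimes>\<^bsub>G\<^esub> h) = \<phi> g"
proof -
  have "inv\<^bsub>G\<^esub> \<phi> h \<otimes>\<^bsub>G\<^esub> \<phi> g \<otimes>\<^bsub>G\<^esub> \<phi> h = \<phi> g \<otimes>\<^bsub>G\<^esub> inv\<^bsub>G\<^esub> \<phi> h \<otimes>\<^bsub>G\<^esub> \<phi> h"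
    using assms by (simp add: phi_central[of g "inv\<^bsub>G\<^esub> \<phi> h"])
  then show ?thesis using assms by (simp add: G.m_assoc)
qed

lemma lam_conj: "g \<in> carrier G \<Longrightarrow> h \<in> carrier G \<Longrightarrow> lam (inv\<^bsub>G\<^esub> h \<otimes>\<^bsub>G\<^esub> g \<otimes>\<^bsub>G\<^esub> h) = lam g"
  by (simp add: A.m_comm[of "inv\<^bsub>A\<^esub> lam h" "lam g"] A.m_assoc)

abbreviation X :: "('m, 'm \<times> 'g) mcb" where
  "X \<equiv> alexander_mcb G M act \<phi>"

lemma fiber_carrier [simp]: "carrier (mcb_fiber X m) = {m} \<times> carrier G"
  by (simp add: alexander_mcb_def)

lemma index_eq [simp]: "mcb_index X = carrier M"
  by (simp add: alexander_mcb_def)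

lemma fiber_mult [simp]: "(a, g) \<otimes>\<^bsub>mcb_fiber X m\<^esub> (b, h) = (m, g \<otimes>\<^bsub>G\<^esub> h)"
  by (simp add: alexander_mcb_def)

lemma carrier_eq [simp]: "mcb_carrier X = carrier M \<times> carrier G"
  by (auto simp: mcb_carrier_def)

lemma fiber_is_group: "group (mcb_fiber X m)"
proof (rule groupI)
  fix x assume "x \<in> carrier (mcb_fiber X m)"
  then show "\<exists>y \<in> carrier (mcb_fiber X m). y \<otimes>\<^bsub>mcb_fiber X m\<^esub> x = \<one>\<^bsub>mcb_fiber X m\<^esub>"
    by (auto intro!: bexI[of _ "(m, inv\<^bsub>G\<^esub> snd x)"] simp: alexander_mcb_def)
qed (auto simp: alexander_mcb_def G.m_assoc)

lemma fiber_inv: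
  assumes "g \<in> carrier G"
  shows "inv\<^bsub>mcb_fiber X m\<^esub> (m, g) = (m, inv\<^bsub>G\<^esub> g)"
  by (rule group.inv_equality[OF fiber_is_group]) (use assms in \<open>auto simp: alexander_mcb_def\<close>)

lemma under_eq:
  assumes "n \<in> carrier M" "h \<in> carrier G"
  shows "mcb_under X (m, g) (n, h) =
    (m \<cdot> h \<oplus>\<^bsub>M\<^esub> (n \<cdot> \<phi> h \<ominus>\<^bsub>M\<^esub> n \<cdot> h), inv\<^bsub>G\<^esub> h \<otimes>\<^bsub>G\<^esub> g \<otimes>\<^bsub>G\<^esub> h)"
  using assms by (simp add: alexander_mcb_def act_diff_frag_of)

lemma over_eq: "mcb_over X (m, g) (n, h) = (m \<cdot> \<phi> h, g)"
  by (simp add: alexander_mcb_def)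

text \<open>The module component of \<open>(m,g) * (n,h)\<close> depends on \<open>m\<close>, \<open>n\<close> and \<open>h\<close> but not on \<open>g\<close>, for either
  operation, so a fiber goes into a fiber.\<close>

sublocale X: fibered_mcb X
proof (rule fibered_mcb.intro)
  fix m a assume m: "m \<in> mcb_index X" and "a \<in> mcb_carrier X"
  then obtain n h where a: "a = (n, h)" "n \<in> carrier M" "h \<in> carrier G" by auto
  show "\<exists>j \<in> mcb_index X. (\<lambda>y. mcb_under X y a) ` carrier (mcb_fiber X m) \<subseteq> carrier (mcb_fiber X j)"
    using m a by (intro bexI[of _ "m \<cdot> h \<oplus>\<^bsub>M\<^esub> (n \<cdot> \<phi> h \<ominus>\<^bsub>M\<^esub> n \<cdot> h)"]) (auto simp: under_eq)
  show "\<exists>j \<in> mcb_index X. (\<lambda>y. mcb_over X y a) ` carrier (mcb_fiber X m) \<subseteq> carrier (mcb_fiber X j)"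
    using m a by (intro bexI[of _ "m \<cdot> \<phi> h"]) (auto simp: over_eq)
qed (auto simp: fiber_is_group)

lemma group_of_eq: "m \<in> carrier M \<Longrightarrow> g \<in> carrier G \<Longrightarrow> mcb_group_of X (m, g) = mcb_fiber X m"
  by (rule X.mcb_group_of_fiber) auto

end

section \<open>The cochain of an invariant multilinear map\<close>

locale multilinear_invariant = alexander_data G M act A \<phi> lam
  for G :: "('g, 'u) monoid_scheme"
    and M :: "('m, 'v) ring_scheme"
    and act :: "'m \<Rightarrow> ('g \<Rightarrow>\<^sub>0 int) \<Rightarrow> 'm"
    and A :: "('a, 'w) monoid_scheme"
    and \<phi> :: "'g \<Rightarrow> 'g"
    and lam :: "'g \<Rightarrow> 'a" +
  fixes n :: nat and f :: "'m list \<Rightarrow> 'a"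
  assumes multilinear: "multilinear M A n f"
    and invariant: "G_invariant G M act n f"
    and pos: "0 < n"
begin

lemma f_closed [simp]: "length ms = n \<Longrightarrow> set ms \<subseteq> carrier M \<Longrightarrow> f ms \<in> carrier A"
  using multilinear by (auto simp: multilinear_def tuples_def)

lemma f_funcset: "f \<in> tuples (carrier M) n \<rightarrow> carrier A"
  using multilinear by (simp add: multilinear_def)

lemma f_add:
  assumes "length ms = n" "set ms \<subseteq> carrier M" "i < n" "x \<in> carrier M" "y \<in> carrier M"
  shows "f (ms[i := x \<oplus>\<^bsub>M\<^esub> y]) = f (ms[i := x]) \<otimes>\<^bsub>A\<^esub> f (ms[i := y])"
  using multilinear assms by (auto simp: multilinear_def tuples_def)

lemma f_translate:
  assumes "length ms = n" "set ms \<subseteq> carrier M" "g \<in> carrier G"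
  shows "f (map (\<lambda>m. m \<cdot> g) ms) = f ms"
  using invariant assms by (auto simp: G_invariant_def tuples_def)

text \<open>Additivity in one variable gives \<open>f(\<dots>0\<dots>) = f(\<dots>0\<dots>) + f(\<dots>0\<dots>)\<close>.\<close>

lemma f_zero:
  assumes "length ms = n" "set ms \<subseteq> carrier M" "i < n" "ms ! i = \<zero>\<^bsub>M\<^esub>"
  shows "f ms = \<one>\<^bsub>A\<^esub>"
proof -
  have "ms[i := \<zero>\<^bsub>M\<^esub>] = ms" using assms by (metis list_update_id)
  then have "f ms = f ms \<otimes>\<^bsub>A\<^esub> f ms"
    using f_add[of ms i "\<zero>\<^bsub>M\<^esub>" "\<zero>\<^bsub>M\<^esub>"] assms by simp
  then show ?thesis using A.r_cancel_one'[of "f ms" "f ms"] assms by simp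
qed

lemma gp_relators_carrier: "gp_relators G M act n \<subseteq> carrier (free_Abelian_group (tuples (carrier M) n))"
proof
  fix r assume "r \<in> gp_relators G M act n"
  then obtain g ms where r: "r = frag_of (map (\<lambda>m. m \<cdot> g) ms) - frag_of ms"
    and "g \<in> carrier G" "ms \<in> tuples (carrier M) n"
    by (auto simp: gp_relators_def)
  then have "map (\<lambda>m. m \<cdot> g) ms \<in> tuples (carrier M) n" by (auto simp: tuples_def)
  then show "r \<in> carrier (free_Abelian_group (tuples (carrier M) n))"
    unfolding r using \<open>ms \<in> _\<close> by (auto dest!: subsetD[OF keys_diff])
qed

sublocale coinv: comm_group "gp_coinv G M act n"
  unfolding gp_coinv_def by (rule comm_group_fab_quot[OF gp_relators_carrier])

sublocale coinv_A: tensor_product "gp_coinv G M act n" A ..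

sublocale A_A: tensor_product A A ..

definition f_bar :: "('m list \<Rightarrow>\<^sub>0 int) set \<Rightarrow> 'a" where
  "f_bar = induced (fab_extend A f)"

lemma fab_extend_f_hom: "fab_extend A f \<in> hom (free_Abelian_group (tuples (carrier M) n)) A"
  by (rule A.fab_extend_hom[OF f_funcset])

lemma fab_extend_f_relator:
  assumes "r \<in> gp_relators G M act n"
  shows "fab_extend A f r = \<one>\<^bsub>A\<^esub>"
proof -
  obtain g ms where r: "r = frag_of (map (\<lambda>m. m \<cdot> g) ms) - frag_of ms"
    and g: "g \<in> carrier G" and ms: "length ms = n" "set ms \<subseteq> carrier M"
    using assms by (auto simp: gp_relators_def tuples_def)
  have "set (map (\<lambda>m. m \<cdot> g) ms) \<subseteq> carrier M" using ms g by auto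
  then show ?thesis
    unfolding r using ms g
    by (subst hom_free_Abelian_group_diff[OF fab_extend_f_hom A.is_group])
       (auto simp: tuples_def f_translate)
qed

lemma f_bar_hom: "f_bar \<in> hom (gp_coinv G M act n) A"
  unfolding f_bar_def gp_coinv_def
  by (rule induced_hom[OF gp_relators_carrier A.is_group fab_extend_f_hom fab_extend_f_relator])

lemma f_bar_gp_class:
  "Poly_Mapping.keys c \<subseteq> tuples (carrier M) n \<Longrightarrow> f_bar (gp_class G M act n c) = fab_extend A f c"
  unfolding f_bar_def gp_class_def
  by (rule induced_fab_class[OF gp_relators_carrier A.is_group fab_extend_f_hom fab_extend_f_relator])

lemma group_listprod_closed [simp]: "set gs \<subseteq> carrier G \<Longrightarrow> group_listprod G gs \<in> carrier G"
  by (induction gs) (auto simp: group_listprod_def)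

lemma psi_elem_closed:
  assumes "gs \<in> tuples (carrier G) n" "i < n"
  shows "psi_elem G \<phi> gs ks i \<in> carrier G"
proof -
  have "gs ! j [^]\<^bsub>G\<^esub> (k :: nat) \<in> carrier G" if "j < n" for j k
    using assms that by (auto simp: tuples_def intro!: G.nat_pow_closed subsetD[OF _ nth_mem])
  then show ?thesis
    using assms unfolding psi_elem_def
    by (intro G.m_closed phi_closed group_listprod_closed) (auto simp: tuples_def)
qed

definition psi_terms :: "'g list \<Rightarrow> 'm list \<Rightarrow> nat list \<Rightarrow> 'm list" where
  "psi_terms gs ms ks = map (\<lambda>i. ms ! i \<cdot> psi_elem G \<phi> gs ks i) [0..<n]"

lemma psi_terms_tuples:
  assumes "gs \<in> tuples (carrier G) n" "ms \<in> tuples (carrier M) n"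
  shows "psi_terms gs ms ks \<in> tuples (carrier M) n"
  using assms psi_elem_closed[OF assms(1)]
  by (auto simp: psi_terms_def tuples_def intro!: translate_closed subsetD[OF _ nth_mem])

lemma psi_chain_eq:
  "psi_chain G act \<phi> n gs ms = (\<Sum>ks \<in> {ks \<in> tuples {0, 1} n. ks ! 0 = 0}.
     frag_cmul ((-1) ^ sum_list ks) (frag_of (psi_terms gs ms ks)))"
  by (simp add: psi_chain_def psi_terms_def)

lemma keys_psi_chain:
  assumes "gs \<in> tuples (carrier G) n" "ms \<in> tuples (carrier M) n"
  shows "Poly_Mapping.keys (psi_chain G act \<phi> n gs ms) \<subseteq> tuples (carrier M) n"
proof -
  have "frag_cmul k (frag_of (psi_terms gs ms ks)) \<in> carrier (free_Abelian_group (tuples (carrier M) n))" for k ks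
    using psi_terms_tuples[OF assms] keys_cmul[of k "frag_of (psi_terms gs ms ks)"] by auto
  then have "psi_chain G act \<phi> n gs ms \<in> carrier (free_Abelian_group (tuples (carrier M) n))"
    unfolding psi_chain_eq by (intro sum_closed_free_Abelian_group)
  then show ?thesis by simp
qed

lemma psi_eq_class: "psi G M act \<phi> n gs ms = gp_class G M act n (psi_chain G act \<phi> n gs ms)"
  by (simp add: psi_def psi_chain_def)

lemma psi_closed:
  assumes "gs \<in> tuples (carrier G) n" "ms \<in> tuples (carrier M) n"
  shows "psi G M act \<phi> n gs ms \<in> carrier (gp_coinv G M act n)"
  unfolding psi_eq_class gp_class_def gp_coinv_def
  by (rule hom_free_Abelian_group_closed[OF fab_class_hom[OF gp_relators_carrier] _ keys_psi_chain[OF assms]])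
     (use comm_group_fab_quot[OF gp_relators_carrier] in \<open>simp add: comm_group_def\<close>)

text \<open>The part of the composite that follows the projection. On \<open>X\<^sup>n\<close> its values are the pure tensors
  of the weight and \<open>\<lambda>(g\<^sub>1)\<close> (\<open>cochain_frag_of\<close>).\<close>

definition cochain :: "(('m \<times> 'g) list \<Rightarrow>\<^sub>0 int) \<Rightarrow> ('a \<times> 'a \<Rightarrow>\<^sub>0 int) set" where
  "cochain = tensor_map A A f_bar (\<lambda>a. a) \<circ> psi_lambda G M act \<phi> A lam n \<circ> gamma M n"

definition weight :: "('m \<times> 'g) list \<Rightarrow> 'a" where
  "weight xs = fab_extend A f (psi_chain G act \<phi> n (map snd xs) (successive_diffs M n xs))"

lemma successive_diffs_tuples:
  "xs \<in> tuples (mcb_carrier X) n \<Longrightarrow> successive_diffs M n xs \<in> tuples (carrier M) n"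
  by (fastforce simp: tuples_def successive_diffs_def dest: nth_mem)

lemma map_snd_tuples: "xs \<in> tuples (mcb_carrier X) n \<Longrightarrow> map snd xs \<in> tuples (carrier G) n"
  by (auto simp: tuples_def)

lemma gamma_frag_of: "gamma M n (frag_of xs) = frag_of (map snd xs, successive_diffs M n xs)"
  by (simp add: gamma_def successive_diffs_def)

lemma gamma_hom:
  "gamma M n \<in> hom (free_Abelian_group (tuples (mcb_carrier X) n))
     (free_Abelian_group (tuples (carrier G) n \<times> tuples (carrier M) n))"
  using successive_diffs_tuples map_snd_tuples unfolding gamma_def successive_diffs_def
  by (intro frag_extend_hom) auto

lemma lam_hd_closed: "gs \<in> tuples (carrier G) n \<Longrightarrow> lam (hd gs) \<in> carrier A"
  using pos by (cases gs) (auto simp: tuples_def)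

lemma snd_hd_closed: "xs \<in> tuples (mcb_carrier X) n \<Longrightarrow> snd (hd xs) \<in> carrier G"
  using pos by (cases xs) (auto simp: tuples_def)

lemma psi_lambda_hom:
  "psi_lambda G M act \<phi> A lam n \<in> hom (free_Abelian_group (tuples (carrier G) n \<times> tuples (carrier M) n))
     (tensor (gp_coinv G M act n) A)"
  unfolding psi_lambda_def
  by (rule coinv_A.tensor.fab_extend_hom) (auto simp: psi_closed lam_hd_closed)

lemma tensor_map_f_bar_hom:
  "tensor_map A A f_bar (\<lambda>a. a) \<in> hom (tensor (gp_coinv G M act n) A) (tensor A A)"
  by (rule tensor_map_hom[OF coinv.comm_group_axioms A.comm_group_axioms A.comm_group_axioms
        A.comm_group_axioms f_bar_hom]) (simp add: hom_def)

lemma cochain_hom: "cochain \<in> hom (free_Abelian_group (tuples (mcb_carrier X) n)) (tensor A A)"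
  unfolding cochain_def
  by (rule hom_compose[OF gamma_hom hom_compose[OF psi_lambda_hom tensor_map_f_bar_hom]])

lemma weight_closed [simp]: "xs \<in> tuples (mcb_carrier X) n \<Longrightarrow> weight xs \<in> carrier A"
  unfolding weight_def
  by (rule hom_free_Abelian_group_closed[OF fab_extend_f_hom A.is_group
        keys_psi_chain[OF map_snd_tuples successive_diffs_tuples]])

lemma cochain_frag_of:
  assumes "xs \<in> tuples (mcb_carrier X) n"
  shows "cochain (frag_of xs) = pure_tensor A A (weight xs) (lam (snd (hd xs)))"
proof -
  note t = map_snd_tuples[OF assms] successive_diffs_tuples[OF assms]
  have "psi_lambda G M act \<phi> A lam n (gamma M n (frag_of xs)) =
      pure_tensor (gp_coinv G M act n) A
        (psi G M act \<phi> n (map snd xs) (successive_diffs M n xs)) (lam (hd (map snd xs)))"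
    unfolding psi_lambda_def gamma_frag_of
    by (subst coinv_A.tensor.fab_extend_frag_of) (simp_all add: t psi_closed lam_hd_closed)
  then have "cochain (frag_of xs) = pure_tensor A A
       (f_bar (psi G M act \<phi> n (map snd xs) (successive_diffs M n xs))) (lam (hd (map snd xs)))"
    unfolding cochain_def comp_def
    by (simp add: tensor_map_pure_tensor[OF coinv.comm_group_axioms A.comm_group_axioms
          A.comm_group_axioms A.comm_group_axioms f_bar_hom] hom_def t psi_closed lam_hd_closed)
  moreover have "xs \<noteq> []" using assms pos by (auto simp: tuples_def)
  ultimately show ?thesis
    using t by (simp add: psi_eq_class f_bar_gp_class keys_psi_chain weight_def hd_map)
qed

text \<open>Two neighbours in one fiber have equal module components, so one of the arguments of \<open>f\<close>
  vanishes. This is what makes the cochain insensitive to the shuffle relations.\<close>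

lemma weight_same_fiber:
  assumes xs: "xs \<in> tuples (mcb_carrier X) n" and i: "Suc i < n"
    and eq: "fst (xs ! i) = fst (xs ! Suc i)"
  shows "weight xs = \<one>\<^bsub>A\<^esub>"
proof -
  let ?gs = "map snd xs" and ?ms = "successive_diffs M n xs"
  let ?F = "free_Abelian_group (tuples (carrier M) n)"
  note t = map_snd_tuples[OF xs] successive_diffs_tuples[OF xs]
  have len: "length xs = n" "set xs \<subseteq> carrier M \<times> carrier G"
    using xs by (auto simp: tuples_def)
  then have "xs ! Suc i \<in> carrier M \<times> carrier G"
    using i by (metis nth_mem subsetD)
  then have "?ms ! i = \<zero>\<^bsub>M\<^esub>"
    using i eq by (auto simp: successive_diffs_def a_minus_def act.M.r_neg)
  then have zero: "psi_terms ?gs ?ms ks ! i = \<zero>\<^bsub>M\<^esub>" for ks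
    using i psi_elem_closed[OF t(1)] by (simp add: psi_terms_def)
  have f1: "f (psi_terms ?gs ?ms ks) = \<one>\<^bsub>A\<^esub>" for ks
    using psi_terms_tuples[OF t, of ks] i zero[of ks]
    by (intro f_zero[of _ i]) (auto simp: tuples_def)
  interpret group_hom ?F A "fab_extend A f"
    using fab_extend_f_hom A.is_group by (simp add: group_hom_def group_hom_axioms_def)
  have cmul: "fab_extend A f (frag_cmul k c) = \<one>\<^bsub>A\<^esub>"
    if "Poly_Mapping.keys c \<subseteq> tuples (carrier M) n" "fab_extend A f c = \<one>\<^bsub>A\<^esub>" for k c
    using hom_int_pow[of c k] that by simp
  have "fab_extend A f (\<Sum>ks \<in> K. frag_cmul (s ks) (frag_of (psi_terms ?gs ?ms ks))) = \<one>\<^bsub>A\<^esub>"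
    for K s
  proof (induction K rule: infinite_finite_induct)
    case (insert ks K)
    have "frag_cmul (s ks) (frag_of (psi_terms ?gs ?ms ks)) \<in> carrier ?F" for ks
      using psi_terms_tuples[OF t, of ks] keys_cmul[of "s ks" "frag_of (psi_terms ?gs ?ms ks)"] by auto
    moreover from this have "(\<Sum>ks \<in> K. frag_cmul (s ks) (frag_of (psi_terms ?gs ?ms ks))) \<in> carrier ?F"
      by (intro sum_closed_free_Abelian_group)
    ultimately show ?case
      using insert psi_terms_tuples[OF t, of ks] f1[of ks]
      by (simp add: hom_free_Abelian_group_add[OF fab_extend_f_hom A.is_group] cmul)
  qed (use hom_one in simp_all)
  then show ?thesis by (simp add: weight_def psi_chain_eq)
qed

lemma Phi_P_eq: "Phi_P G M act \<phi> A lam n f = cochain \<circ> proj n"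
  by (simp add: Phi_P_def cochain_def f_bar_def comp_assoc)

lemma proj_hom: "proj n \<in> hom (mcb_P X n) (free_Abelian_group (tuples (mcb_carrier X) n))"
  unfolding mcb_P_def proj_def
proof (rule frag_extend_hom)
  fix xss assume xss: "xss \<in> mcb_symbols X n"
  have "hd xs \<in> mcb_carrier X" if "xs \<in> set xss" for xs
    using xss that X.fiberwise_subset_carrier[of xs] by (auto simp: X.mcb_symbols_iff dest: hd_in_set)
  then have "length xss = n \<Longrightarrow> map hd xss \<in> tuples (mcb_carrier X) n"
    unfolding tuples_def by (simp add: image_subset_iff)
  then show "Poly_Mapping.keys (if length xss = n then frag_of (map hd xss) else 0)
      \<subseteq> tuples (mcb_carrier X) n"
    by simp
qed

lemma Phi_P_hom: "Phi_P G M act \<phi> A lam n f \<in> hom (mcb_P X n) (tensor A A)"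
  unfolding Phi_P_eq by (rule hom_compose[OF proj_hom cochain_hom])

text \<open>The shuffle is a sum of symbols with fewer than \<open>n\<close> blocks, which the projection kills. The
  unshuffled symbol survives the projection only if all its blocks are singletons, and then
  \<open>weight_same_fiber\<close> applies to the two blocks that were to be shuffled.\<close>

lemma Phi_P_D_gens:
  assumes "r \<in> mcb_D_gens X n"
  shows "Phi_P G M act \<phi> A lam n f r = \<one>\<^bsub>tensor A A\<^esub>"
proof -
  obtain us a b vs i where r: "r = frag_of (us @ [a, b] @ vs) -
      frag_extend (\<lambda>c. frag_of (us @ [c] @ vs)) (mcb_shuffle (mcb_fiber X i) a b)"
    and sym: "us @ [a, b] @ vs \<in> mcb_symbols X n"
    and i: "i \<in> carrier M" and ab: "set a \<union> set b \<subseteq> {i} \<times> carrier G"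
    using assms by (auto simp: mcb_D_gens_def)
  let ?xss = "us @ [a, b] @ vs"
  have blocks: "length ?xss \<le> n"
  proof -
    have "length yss \<le> sum_list (map length yss)" if "\<forall>ys \<in> set yss. ys \<noteq> []" for yss :: "('m \<times> 'g) list list"
      using that by (induction yss) (auto simp: neq_Nil_conv)
    from this[of ?xss] show ?thesis using sym unfolding X.mcb_symbols_iff by blast
  qed
  have proj_r: "proj n r = proj n (frag_of ?xss)"
    unfolding r using blocks proj_shuffle[of us vs n]
    by (simp add: proj_def frag_extend_diff)
  show ?thesis
  proof (cases "length ?xss = n")
    case True
    let ?xs = "map hd ?xss"
    have nonempty: "a \<noteq> []" "b \<noteq> []" using sym by (auto simp: X.mcb_symbols_iff)
    have xs: "?xs \<in> tuples (mcb_carrier X) n"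
      using hom_in_carrier[OF proj_hom, of "frag_of ?xss"] sym True
      by (simp add: mcb_P_def proj_frag_of)
    have "fst (hd a) = fst (hd b)"
      using ab nonempty by (cases a; cases b) auto
    then have "weight ?xs = \<one>\<^bsub>A\<^esub>"
      using True by (intro weight_same_fiber[OF xs, of "length us"]) (auto simp: nth_append)
    moreover have "lam (snd (hd ?xs)) \<in> carrier A"
      using snd_hd_closed[OF xs] by (rule lam.hom_closed)
    ultimately show ?thesis
      unfolding Phi_P_eq comp_def proj_r using True xs
      by (simp only: proj_frag_of simp_thms if_True cochain_frag_of A_A.pure_tensor_one_left)
  next
    case False
    then show ?thesis
      unfolding Phi_P_eq comp_def proj_r
      using hom_free_Abelian_group_zero[OF cochain_hom A_A.tensor.is_group]
      by (simp only: proj_frag_of if_False)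
  qed
qed

lemma Phi_class:
  assumes "c \<in> carrier (mcb_P X n)"
  shows "Phi G M act \<phi> A lam n f (mcb_class X n c) = Phi_P G M act \<phi> A lam n f c"
  unfolding Phi_def mcb_class_def
  by (rule induced_fab_class[OF X.mcb_D_gens_carrier A_A.tensor.is_group
        Phi_P_hom[unfolded mcb_P_def] Phi_P_D_gens])
     (use assms in \<open>simp_all add: mcb_P_def\<close>)

lemma Phi_hom: "Phi G M act \<phi> A lam n f \<in> hom (mcb_C X n) (tensor A A)"
  unfolding Phi_def mcb_C_def
  by (rule induced_hom[OF X.mcb_D_gens_carrier A_A.tensor.is_group
        Phi_P_hom[unfolded mcb_P_def] Phi_P_D_gens])

lemma Phi_singletons:
  assumes "xs \<in> tuples (mcb_carrier X) n"
  shows "Phi G M act \<phi> A lam n f (mcb_class X n (frag_of (singletons xs)))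
    = pure_tensor A A (weight xs) (lam (snd (hd xs)))"
proof -
  have "frag_of (singletons xs) \<in> carrier (mcb_P X n)"
    using assms by (auto simp: mcb_P_def X.mcb_symbols_iff tuples_def sum_list_triv comp_def)
  then show ?thesis
    using assms by (simp add: Phi_class Phi_P_eq cochain_frag_of) (simp add: tuples_def cochain_frag_of)
qed

text \<open>The boundary preserves or lowers the number of blocks, so symbols of total length \<open>n + 1\<close> with
  fewer than \<open>n\<close> blocks impose no condition. The two hypotheses are what the two remaining
  kinds of symbols demand.\<close>

lemma cocycleI:
  assumes birack: "\<And>xs. xs \<in> tuples (mcb_carrier X) (Suc n) \<Longrightarrow>
      cochain (\<Sum>i \<le> n. frag_cmul ((-1) ^ i) (frag_of (act_face X xs i) - frag_of (del_face xs i)))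
        = \<one>\<^bsub>tensor A A\<^esub>"
    and fiber: "\<And>us m g h vs. \<lbrakk>length us + length vs + 1 = n; set us \<subseteq> mcb_carrier X;
      set vs \<subseteq> mcb_carrier X; m \<in> carrier M; g \<in> carrier G; h \<in> carrier G\<rbrakk> \<Longrightarrow>
      cochain (frag_of (map (\<lambda>z. mcb_under X z (m, g)) us @ [(m \<cdot> \<phi> g, inv\<^bsub>G\<^esub> g \<otimes>\<^bsub>G\<^esub> h)]
          @ map (\<lambda>z. mcb_over X z (m, g)) vs)
        - frag_of (us @ [(m, h)] @ vs) + frag_of (us @ [(m, g)] @ vs)) = \<one>\<^bsub>tensor A A\<^esub>"
  shows "mcb_cocycle X n (tensor A A) (Phi G M act \<phi> A lam n f)"
proof -
  let ?\<Phi> = "Phi_P G M act \<phi> A lam n f"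
  have boundary: "?\<Phi> (mcb_boundary X (frag_of xss)) = \<one>\<^bsub>tensor A A\<^esub>" if "xss \<in> mcb_symbols X (Suc n)" for xss
    using that
  proof (cases rule: X.mcb_symbols_Suc_cases)
    case short
    then show ?thesis
      by (simp add: Phi_P_eq proj_boundary_short hom_free_Abelian_group_zero[OF cochain_hom A_A.tensor.is_group])
  next
    case (singletons xs)
    then show ?thesis
      using birack[of xs] by (simp add: Phi_P_eq tuples_def proj_boundary_singletons)
  next
    case (pair us x y vs)
    obtain m g h where xy: "x = (m, g)" "y = (m, h)" "m \<in> carrier M" "g \<in> carrier G" "h \<in> carrier G"
      using pair(5) by (auto simp: X.fiberwise_def)
    define c where "c = frag_of (map (\<lambda>z. mcb_under X z (m, g)) us @ [(m \<cdot> \<phi> g, inv\<^bsub>G\<^esub> g \<otimes>\<^bsub>G\<^esub> h)]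
          @ map (\<lambda>z. mcb_over X z (m, g)) vs)
        - frag_of (us @ [(m, h)] @ vs) + frag_of (us @ [(m, g)] @ vs)"
    have c: "proj n (mcb_boundary X (frag_of xss)) = frag_cmul ((-1) ^ length us) c"
      unfolding pair(1) proj_boundary_pair[OF pair(2)] c_def
      using xy by (simp add: group_of_eq fiber_inv over_eq)
    have c1: "cochain c = \<one>\<^bsub>tensor A A\<^esub>"
      unfolding c_def by (rule fiber[OF pair(2-4) xy(3-5)])
    have "Poly_Mapping.keys c \<subseteq> tuples (mcb_carrier X) n"
    proof -
      have "proj n (mcb_boundary X (frag_of xss)) \<in> carrier (free_Abelian_group (tuples (mcb_carrier X) n))"
        using that by (intro hom_in_carrier[OF proj_hom] hom_in_carrier[OF X.mcb_boundary_hom])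
          (simp add: mcb_P_def)
      moreover have "c = frag_cmul ((-1) ^ length us) (frag_cmul ((-1) ^ length us) c)"
        by (simp flip: power_mult_distrib)
      ultimately show ?thesis
        unfolding c using keys_cmul[of "(-1) ^ length us" "frag_cmul ((-1) ^ length us) c"] by auto
    qed
    with c1 have "cochain (frag_cmul ((-1) ^ length us) c) = \<one>\<^bsub>tensor A A\<^esub>"
      by (cases "even (length us)")
         (simp_all add: hom_free_Abelian_group_minus[OF cochain_hom A_A.tensor.is_group])
    then show ?thesis by (simp add: Phi_P_eq c)
  qed
  have comp: "?\<Phi> \<circ> mcb_boundary X \<in> hom (mcb_P X (Suc n)) (tensor A A)"
    by (rule hom_compose[OF X.mcb_boundary_hom Phi_P_hom])
  have "?\<Phi> (mcb_boundary X c) = \<one>\<^bsub>tensor A A\<^esub>" if "c \<in> carrier (mcb_P X (Suc n))" for c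
    using hom_free_Abelian_group_eqI[OF comp[unfolded mcb_P_def] _ A_A.tensor.is_group, of "\<lambda>_. \<one>\<^bsub>tensor A A\<^esub>" c]
      boundary that by (simp add: mcb_P_def hom_def)
  then show ?thesis
    using Phi_hom hom_in_carrier[OF X.mcb_boundary_hom]
    by (simp add: mcb_cocycle_def Phi_class)
qed

end

section \<open>Differences of faces\<close>

context multilinear_invariant
begin

lemma cochain_diff:
  assumes "xs \<in> tuples (mcb_carrier X) n" "ys \<in> tuples (mcb_carrier X) n"
    and "lam (snd (hd xs)) = lam (snd (hd ys))"
  shows "cochain (frag_of xs - frag_of ys)
    = pure_tensor A A (weight xs \<otimes>\<^bsub>A\<^esub> inv\<^bsub>A\<^esub> weight ys) (lam (snd (hd ys)))"
  using assms snd_hd_closed[OF assms(2)]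
  by (simp add: hom_free_Abelian_group_diff[OF cochain_hom A_A.tensor.is_group]
      cochain_frag_of A_A.pure_tensor_mult_left A_A.pure_tensor_inv_left)

lemma keys_diff_tuples:
  assumes "xs \<in> tuples (mcb_carrier X) n" "ys \<in> tuples (mcb_carrier X) n"
  shows "Poly_Mapping.keys (frag_of xs - frag_of ys) \<subseteq> tuples (mcb_carrier X) n"
  using assms keys_diff[of "frag_of xs" "frag_of ys"] by auto

text \<open>The relation coming from a two-element block at the first position: only \<open>\<lambda>\<close> sees the
  group component there, and \<open>\<lambda>\<close> is additive.\<close>

lemma cochain_fiber_first:
  assumes t: "(p, inv\<^bsub>G\<^esub> g \<otimes>\<^bsub>G\<^esub> h) # us \<in> tuples (mcb_carrier X) n"
    "(m, h) # vs \<in> tuples (mcb_carrier X) n" "(m, g) # vs \<in> tuples (mcb_carrier X) n"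
    and w: "weight ((p, inv\<^bsub>G\<^esub> g \<otimes>\<^bsub>G\<^esub> h) # us) = weight ((m, g) # vs)"
    "weight ((m, h) # vs) = weight ((m, g) # vs)"
  shows "cochain (frag_of ((p, inv\<^bsub>G\<^esub> g \<otimes>\<^bsub>G\<^esub> h) # us) - frag_of ((m, h) # vs) + frag_of ((m, g) # vs))
    = \<one>\<^bsub>tensor A A\<^esub>"
proof -
  have gh: "g \<in> carrier G" "h \<in> carrier G" using t by (auto simp: tuples_def)
  let ?w = "weight ((m, g) # vs)"
  let ?p = "pure_tensor A A ?w"
  have w_closed: "?w \<in> carrier A" using t by simp
  have "cochain (frag_of ((p, inv\<^bsub>G\<^esub> g \<otimes>\<^bsub>G\<^esub> h) # us) - frag_of ((m, h) # vs) + frag_of ((m, g) # vs))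
      = ?p (inv\<^bsub>A\<^esub> lam g \<otimes>\<^bsub>A\<^esub> lam h) \<otimes>\<^bsub>tensor A A\<^esub> inv\<^bsub>tensor A A\<^esub> ?p (lam h) \<otimes>\<^bsub>tensor A A\<^esub> ?p (lam g)"
    using t w gh keys_diff_tuples[OF t(1,2)]
    by (simp add: hom_free_Abelian_group_add[OF cochain_hom A_A.tensor.is_group]
        hom_free_Abelian_group_diff[OF cochain_hom A_A.tensor.is_group] cochain_frag_of)
  also have "\<dots> = ?p ((inv\<^bsub>A\<^esub> lam g \<otimes>\<^bsub>A\<^esub> lam h) \<otimes>\<^bsub>A\<^esub> inv\<^bsub>A\<^esub> lam h \<otimes>\<^bsub>A\<^esub> lam g)"
    using w_closed gh by (simp add: A_A.pure_tensor_mult_right A_A.pure_tensor_inv_right)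
  also have "(inv\<^bsub>A\<^esub> lam g \<otimes>\<^bsub>A\<^esub> lam h) \<otimes>\<^bsub>A\<^esub> inv\<^bsub>A\<^esub> lam h \<otimes>\<^bsub>A\<^esub> lam g = \<one>\<^bsub>A\<^esub>"
    using gh by (simp add: A.m_assoc)
  also have "?p \<one>\<^bsub>A\<^esub> = \<one>\<^bsub>tensor A A\<^esub>"
    using hom_one[OF A_A.pure_tensor_right_hom[OF w_closed] A.is_group A_A.tensor.is_group] .
  finally show ?thesis .
qed

text \<open>In a later position the group component seen by \<open>\<lambda>\<close> is common to the three terms, up to
  conjugation, and the relation is one between weights.\<close>

lemma cochain_fiber_later:
  assumes t: "xs \<in> tuples (mcb_carrier X) n" "ys \<in> tuples (mcb_carrier X) n" "zs \<in> tuples (mcb_carrier X) n"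
    and l: "lam (snd (hd xs)) = lam (snd (hd zs))" "lam (snd (hd ys)) = lam (snd (hd zs))"
    and w: "weight ys = weight xs \<otimes>\<^bsub>A\<^esub> weight zs"
  shows "cochain (frag_of xs - frag_of ys + frag_of zs) = \<one>\<^bsub>tensor A A\<^esub>"
proof -
  let ?p = "\<lambda>a. pure_tensor A A a (lam (snd (hd zs)))"
  have l_closed: "lam (snd (hd zs)) \<in> carrier A" using snd_hd_closed[OF t(3)] by simp
  have "cochain (frag_of xs - frag_of ys + frag_of zs)
      = ?p (weight xs) \<otimes>\<^bsub>tensor A A\<^esub> inv\<^bsub>tensor A A\<^esub> ?p (weight ys) \<otimes>\<^bsub>tensor A A\<^esub> ?p (weight zs)"
    using t l keys_diff_tuples[OF t(1,2)]
    by (simp add: hom_free_Abelian_group_add[OF cochain_hom A_A.tensor.is_group]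
        hom_free_Abelian_group_diff[OF cochain_hom A_A.tensor.is_group] cochain_frag_of)
  also have "\<dots> = ?p (weight xs \<otimes>\<^bsub>A\<^esub> inv\<^bsub>A\<^esub> weight ys \<otimes>\<^bsub>A\<^esub> weight zs)"
    using t l_closed by (simp add: A_A.pure_tensor_mult_left A_A.pure_tensor_inv_left)
  also have "weight xs \<otimes>\<^bsub>A\<^esub> inv\<^bsub>A\<^esub> weight ys \<otimes>\<^bsub>A\<^esub> weight zs = \<one>\<^bsub>A\<^esub>"
    unfolding w using t by (simp add: A.inv_mult flip: A.m_assoc)
  finally show ?thesis using l_closed by simp
qed

text \<open>At the first position every other entry is hit by the over-operation, which leaves the group
  components alone. So it suffices that weights do not change under that operation.\<close>

lemma cochain_first_face:
  assumes xs: "xs \<in> tuples (mcb_carrier X) (Suc n)"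
    and over: "\<And>ys a. ys \<in> tuples (mcb_carrier X) n \<Longrightarrow> a \<in> mcb_carrier X \<Longrightarrow>
      weight (map (\<lambda>y. mcb_over X y a) ys) = weight ys"
  shows "cochain (frag_of (act_face X xs 0) - frag_of (del_face xs 0)) = \<one>\<^bsub>tensor A A\<^esub>"
proof -
  obtain a ys where ays: "xs = a # ys" "a \<in> mcb_carrier X" "ys \<in> tuples (mcb_carrier X) n"
    using xs by (cases xs) (auto simp: tuples_def)
  have "map (\<lambda>y. mcb_over X y a) ys \<in> tuples (mcb_carrier X) n"
    using ays by (auto simp: tuples_def over_eq)
  moreover have "snd (hd (map (\<lambda>y. mcb_over X y a) ys)) = snd (hd ys)"
    using ays pos by (cases ys) (auto simp: tuples_def over_eq)
  ultimately show ?thesis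
    using ays over[OF ays(3,2)] snd_hd_closed[OF ays(3)]
    by (simp add: act_face_def del_face_def cochain_diff)
qed

lemma del_face_tuples: "xs \<in> tuples (mcb_carrier X) (Suc n) \<Longrightarrow> i \<le> n \<Longrightarrow> del_face xs i \<in> tuples (mcb_carrier X) n"
  by (auto simp: tuples_def del_face_def dest: in_set_takeD in_set_dropD)

lemma act_face_tuples:
  assumes xs: "xs \<in> tuples (mcb_carrier X) (Suc n)" and i: "i \<le> n"
  shows "act_face X xs i \<in> tuples (mcb_carrier X) n"
proof -
  have a: "xs ! i \<in> carrier M \<times> carrier G"
    using xs i by (auto simp: tuples_def intro!: subsetD[OF _ nth_mem])
  then have "mcb_under X y (xs ! i) \<in> mcb_carrier X" "mcb_over X y (xs ! i) \<in> mcb_carrier X"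
    if "y \<in> set xs" for y
    using xs that by (cases y; cases "xs ! i"; force simp: tuples_def under_eq over_eq)+
  then show ?thesis
    using xs i unfolding tuples_def act_face_def
    by (auto dest!: in_set_takeD in_set_dropD simp del: carrier_eq)
qed

text \<open>After the first position, the first entry survives in both faces, conjugated in the acted one;
  \<open>\<lambda>\<close> takes the same value on both and can be pulled out.\<close>

lemma cochain_later_face:
  assumes xs: "xs \<in> tuples (mcb_carrier X) (Suc n)" and i: "0 < i" "i \<le> n"
  shows "cochain (frag_of (act_face X xs i) - frag_of (del_face xs i))
    = pure_tensor A A (weight (act_face X xs i) \<otimes>\<^bsub>A\<^esub> inv\<^bsub>A\<^esub> weight (del_face xs i)) (lam (snd (hd xs)))"
proof -
  obtain m g ys where ys: "xs = (m, g) # ys" "m \<in> carrier M" "g \<in> carrier G"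
    using xs by (cases xs) (auto simp: tuples_def)
  obtain p h where a: "xs ! i = (p, h)" "p \<in> carrier M" "h \<in> carrier G"
    using xs i subsetD[OF _ nth_mem, of xs "carrier M \<times> carrier G" i] by (auto simp: tuples_def)
  obtain j where j: "i = Suc j" using i by (cases i) auto
  have "hd (del_face xs i) = (m, g)"
    by (simp add: del_face_def ys j)
  moreover have "snd (hd (act_face X xs i)) = inv\<^bsub>G\<^esub> h \<otimes>\<^bsub>G\<^esub> g \<otimes>\<^bsub>G\<^esub> h"
    using a by (simp add: act_face_def ys(1) j under_eq)
  ultimately show ?thesis
    using cochain_diff[OF act_face_tuples[OF xs i(2)] del_face_tuples[OF xs i(2)]]
      lam_conj[OF ys(3) a(3)] ys(1) by simp
qed

end

section \<open>Calculus of the central twist\<close>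

context alexander_data
begin

text \<open>The twist \<open>c\<^sub>g = \<phi>(g) g\<inverse>\<close> compares two translations. In the face that acts by \<open>g\<close>, the module
  components after its position are translated by \<open>\<phi>(g)\<close>, but the differences of those before its
  position by \<open>g\<close>. All weights are expressed by twists.\<close>

definition twist :: "'g \<Rightarrow> 'g" where
  "twist g = \<phi> g \<otimes>\<^bsub>G\<^esub> inv\<^bsub>G\<^esub> g"

lemma twist_closed [simp]: "g \<in> carrier G \<Longrightarrow> twist g \<in> carrier G"
  by (simp add: twist_def)

lemma twist_mult: "g \<in> carrier G \<Longrightarrow> twist g \<otimes>\<^bsub>G\<^esub> g = \<phi> g"
  by (simp add: twist_def G.m_assoc)

lemma inv_twist_phi: "g \<in> carrier G \<Longrightarrow> inv\<^bsub>G\<^esub> twist g \<otimes>\<^bsub>G\<^esub> \<phi> g = g"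
  using twist_mult[of g] by (simp flip: G.m_assoc add: G.inv_solve_left')

lemma inv_twist: "g \<in> carrier G \<Longrightarrow> inv\<^bsub>G\<^esub> twist g = inv\<^bsub>G\<^esub> \<phi> g \<otimes>\<^bsub>G\<^esub> g"
  using phi_central[of "inv\<^bsub>G\<^esub> g" g] by (simp add: twist_def G.inv_mult_group)

lemma twist_phi: "g \<in> carrier G \<Longrightarrow> h \<in> carrier G \<Longrightarrow> \<phi> h \<otimes>\<^bsub>G\<^esub> twist g = twist g \<otimes>\<^bsub>G\<^esub> \<phi> h"
  by (rule phi_central) simp_all

lemma inv_twist_central: "g \<in> carrier G \<Longrightarrow> h \<in> carrier G \<Longrightarrow>
    \<phi> h \<otimes>\<^bsub>G\<^esub> inv\<^bsub>G\<^esub> twist g = inv\<^bsub>G\<^esub> twist g \<otimes>\<^bsub>G\<^esub> \<phi> h"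
  by (rule phi_central) simp_all

text \<open>Equivalently, the twist of a conjugate is the conjugate of the twist. In this form it moves
  a translation by \<open>h\<close> past a twist.\<close>

lemma twist_conj:
  assumes "g \<in> carrier G" "h \<in> carrier G"
  shows "h \<otimes>\<^bsub>G\<^esub> twist (inv\<^bsub>G\<^esub> h \<otimes>\<^bsub>G\<^esub> g \<otimes>\<^bsub>G\<^esub> h) = twist g \<otimes>\<^bsub>G\<^esub> h"
proof -
  have "h \<otimes>\<^bsub>G\<^esub> twist (inv\<^bsub>G\<^esub> h \<otimes>\<^bsub>G\<^esub> g \<otimes>\<^bsub>G\<^esub> h)
      = (h \<otimes>\<^bsub>G\<^esub> \<phi> g) \<otimes>\<^bsub>G\<^esub> (inv\<^bsub>G\<^esub> h \<otimes>\<^bsub>G\<^esub> (inv\<^bsub>G\<^esub> g \<otimes>\<^bsub>G\<^esub> h))"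
    unfolding twist_def phi_conj[OF assms] using assms by (simp add: G.inv_mult_group G.m_assoc)
  also have "\<dots> = (\<phi> g \<otimes>\<^bsub>G\<^esub> h) \<otimes>\<^bsub>G\<^esub> (inv\<^bsub>G\<^esub> h \<otimes>\<^bsub>G\<^esub> (inv\<^bsub>G\<^esub> g \<otimes>\<^bsub>G\<^esub> h))"
    using assms by (simp add: phi_central[of g h])
  also have "\<dots> = \<phi> g \<otimes>\<^bsub>G\<^esub> (h \<otimes>\<^bsub>G\<^esub> inv\<^bsub>G\<^esub> h) \<otimes>\<^bsub>G\<^esub> inv\<^bsub>G\<^esub> g \<otimes>\<^bsub>G\<^esub> h"
    using assms by (simp only: G.m_assoc G.m_closed G.inv_closed phi_closed)
  finally show ?thesis using assms by (simp add: twist_def)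
qed

lemma inv_twist_conj:
  assumes "g \<in> carrier G" "h \<in> carrier G"
  shows "h \<otimes>\<^bsub>G\<^esub> inv\<^bsub>G\<^esub> twist (inv\<^bsub>G\<^esub> h \<otimes>\<^bsub>G\<^esub> g \<otimes>\<^bsub>G\<^esub> h) = inv\<^bsub>G\<^esub> twist g \<otimes>\<^bsub>G\<^esub> h"
proof -
  let ?t = "twist (inv\<^bsub>G\<^esub> h \<otimes>\<^bsub>G\<^esub> g \<otimes>\<^bsub>G\<^esub> h)"
  have t: "?t \<in> carrier G" using assms by simp
  have "h \<otimes>\<^bsub>G\<^esub> inv\<^bsub>G\<^esub> ?t = inv\<^bsub>G\<^esub> twist g \<otimes>\<^bsub>G\<^esub> (twist g \<otimes>\<^bsub>G\<^esub> h) \<otimes>\<^bsub>G\<^esub> inv\<^bsub>G\<^esub> ?t"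
    using assms t by (simp flip: G.m_assoc)
  also have "\<dots> = inv\<^bsub>G\<^esub> twist g \<otimes>\<^bsub>G\<^esub> h"
    unfolding twist_conj[OF assms, symmetric] using assms t by (simp add: G.m_assoc)
  finally show ?thesis .
qed

text \<open>The twist reverses the order of a product: \<open>c\<^sub>k c\<^sub>g = c\<^sub>g\<^sub>k\<close>, used here with \<open>k = g\<inverse>h\<close>. The central elements
  \<open>\<phi>(g)\<close> and \<open>\<phi>(k)\<close> can be collected in front, and \<open>k\<inverse>g\<inverse> = (g k)\<inverse>\<close>.\<close>

lemma twist_left_divide:
  assumes "g \<in> carrier G" "h \<in> carrier G"
  shows "twist (inv\<^bsub>G\<^esub> g \<otimes>\<^bsub>G\<^esub> h) \<otimes>\<^bsub>G\<^esub> twist g = twist h"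
proof -
  let ?p = "\<phi> g" and ?q = "\<phi> h"
  have "twist (inv\<^bsub>G\<^esub> g \<otimes>\<^bsub>G\<^esub> h) \<otimes>\<^bsub>G\<^esub> twist g
      = inv\<^bsub>G\<^esub> ?p \<otimes>\<^bsub>G\<^esub> (?q \<otimes>\<^bsub>G\<^esub> inv\<^bsub>G\<^esub> h \<otimes>\<^bsub>G\<^esub> (g \<otimes>\<^bsub>G\<^esub> ?p) \<otimes>\<^bsub>G\<^esub> inv\<^bsub>G\<^esub> g)"
    using assms by (simp add: twist_def G.inv_mult_group G.m_assoc)
  also have "\<dots> = inv\<^bsub>G\<^esub> ?p \<otimes>\<^bsub>G\<^esub> (?q \<otimes>\<^bsub>G\<^esub> inv\<^bsub>G\<^esub> h \<otimes>\<^bsub>G\<^esub> (?p \<otimes>\<^bsub>G\<^esub> g) \<otimes>\<^bsub>G\<^esub> inv\<^bsub>G\<^esub> g)"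
    using assms by (simp add: phi_central[of g g])
  also have "\<dots> = inv\<^bsub>G\<^esub> ?p \<otimes>\<^bsub>G\<^esub> (?q \<otimes>\<^bsub>G\<^esub> inv\<^bsub>G\<^esub> h \<otimes>\<^bsub>G\<^esub> ?p)"
    using assms by (simp add: G.m_assoc)
  also have "\<dots> = inv\<^bsub>G\<^esub> ?p \<otimes>\<^bsub>G\<^esub> (?p \<otimes>\<^bsub>G\<^esub> (?q \<otimes>\<^bsub>G\<^esub> inv\<^bsub>G\<^esub> h))"
    using assms by (simp add: phi_central[of g "?q \<otimes>\<^bsub>G\<^esub> inv\<^bsub>G\<^esub> h"])
  also have "\<dots> = twist h"
    using assms by (simp add: twist_def flip: G.m_assoc)
  finally show ?thesis .
qed

text \<open>The elements \<open>x(1 - c\<^sub>g)\<close> and \<open>x(1 - c\<^sub>g\<inverse>)\<close>, which occur as first and last arguments of \<open>f\<close> in the weights.\<close>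

definition defect :: "'m \<Rightarrow> 'g \<Rightarrow> 'm" where
  "defect x g = x \<ominus>\<^bsub>M\<^esub> x \<cdot> twist g"

definition codefect :: "'m \<Rightarrow> 'g \<Rightarrow> 'm" where
  "codefect x g = x \<ominus>\<^bsub>M\<^esub> x \<cdot> inv\<^bsub>G\<^esub> twist g"

lemma defect_closed [simp]: "x \<in> carrier M \<Longrightarrow> g \<in> carrier G \<Longrightarrow> defect x g \<in> carrier M"
  by (simp add: defect_def)

lemma codefect_closed [simp]: "x \<in> carrier M \<Longrightarrow> g \<in> carrier G \<Longrightarrow> codefect x g \<in> carrier M"
  by (simp add: codefect_def)

lemma defect_add:
  "\<lbrakk>x \<in> carrier M; y \<in> carrier M; g \<in> carrier G\<rbrakk> \<Longrightarrow>
    defect (x \<oplus>\<^bsub>M\<^esub> y) g = defect x g \<oplus>\<^bsub>M\<^esub> defect y g"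
  by (simp add: defect_def act.M.add_diff_add)

lemma codefect_add:
  "\<lbrakk>x \<in> carrier M; y \<in> carrier M; g \<in> carrier G\<rbrakk> \<Longrightarrow>
    codefect (x \<oplus>\<^bsub>M\<^esub> y) g = codefect x g \<oplus>\<^bsub>M\<^esub> codefect y g"
  by (simp add: codefect_def act.M.add_diff_add)

lemma defect_diff:
  "\<lbrakk>x \<in> carrier M; y \<in> carrier M; g \<in> carrier G\<rbrakk> \<Longrightarrow>
    defect (x \<ominus>\<^bsub>M\<^esub> y) g = defect x g \<ominus>\<^bsub>M\<^esub> defect y g"
  using defect_add[of "x \<ominus>\<^bsub>M\<^esub> y" y g]
  by (simp add: act.M.diff_add_cancel) (simp add: a_minus_def act.M.a_assoc act.M.r_neg)

lemma codefect_diff: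
  "\<lbrakk>x \<in> carrier M; y \<in> carrier M; g \<in> carrier G\<rbrakk> \<Longrightarrow>
    codefect (x \<ominus>\<^bsub>M\<^esub> y) g = codefect x g \<ominus>\<^bsub>M\<^esub> codefect y g"
  using codefect_add[of "x \<ominus>\<^bsub>M\<^esub> y" y g]
  by (simp add: act.M.diff_add_cancel) (simp add: a_minus_def act.M.a_assoc act.M.r_neg)

lemma translate_twist:
  "x \<in> carrier M \<Longrightarrow> g \<in> carrier G \<Longrightarrow> x \<cdot> twist g = x \<ominus>\<^bsub>M\<^esub> defect x g"
  by (simp add: defect_def a_minus_def act.M.minus_add act.M.r_neg2)

lemma translate_inv_twist:
  "x \<in> carrier M \<Longrightarrow> g \<in> carrier G \<Longrightarrow> x \<cdot> inv\<^bsub>G\<^esub> twist g = x \<ominus>\<^bsub>M\<^esub> codefect x g"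
  by (simp add: codefect_def a_minus_def act.M.minus_add act.M.r_neg2)

lemma defect_conj:
  "\<lbrakk>x \<in> carrier M; g \<in> carrier G; h \<in> carrier G\<rbrakk> \<Longrightarrow>
    defect (x \<cdot> h) (inv\<^bsub>G\<^esub> h \<otimes>\<^bsub>G\<^esub> g \<otimes>\<^bsub>G\<^esub> h) = defect x g \<cdot> h"
  by (simp add: defect_def translate_diff twist_conj del: phi_mult)

lemma codefect_conj:
  "\<lbrakk>x \<in> carrier M; g \<in> carrier G; h \<in> carrier G\<rbrakk> \<Longrightarrow>
    codefect (x \<cdot> h) (inv\<^bsub>G\<^esub> h \<otimes>\<^bsub>G\<^esub> g \<otimes>\<^bsub>G\<^esub> h) = codefect x g \<cdot> h"
  by (simp add: codefect_def translate_diff inv_twist_conj)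

lemma defect_phi:
  "\<lbrakk>x \<in> carrier M; g \<in> carrier G; h \<in> carrier G\<rbrakk> \<Longrightarrow> defect (x \<cdot> \<phi> h) g = defect x g \<cdot> \<phi> h"
  by (simp add: defect_def translate_diff twist_phi)

lemma codefect_phi:
  "\<lbrakk>x \<in> carrier M; g \<in> carrier G; h \<in> carrier G\<rbrakk> \<Longrightarrow> codefect (x \<cdot> \<phi> h) g = codefect x g \<cdot> \<phi> h"
  by (simp add: codefect_def translate_diff inv_twist_central)

text \<open>This is \<open>(1 - c\<^sub>k) c\<^sub>g = (1 - c\<^sub>h) - (1 - c\<^sub>g)\<close> for \<open>k = g\<inverse>h\<close>, and the next lemma is its counterpart for
  inverse twists. They are the cocycle relations of a two-element block.\<close>

lemma defect_left_divide:
  assumes "x \<in> carrier M" "g \<in> carrier G" "h \<in> carrier G"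
  shows "defect x (inv\<^bsub>G\<^esub> g \<otimes>\<^bsub>G\<^esub> h) \<cdot> twist g = defect x h \<ominus>\<^bsub>M\<^esub> defect x g"
proof -
  have "defect x (inv\<^bsub>G\<^esub> g \<otimes>\<^bsub>G\<^esub> h) \<cdot> twist g = x \<cdot> twist g \<ominus>\<^bsub>M\<^esub> x \<cdot> twist h"
    using assms by (simp add: defect_def translate_diff twist_left_divide)
  also have "\<dots> = defect x h \<ominus>\<^bsub>M\<^esub> defect x g"
    using assms by (simp add: defect_def a_minus_def act.M.minus_add act.M.a_ac act.M.r_neg2)
  finally show ?thesis .
qed

lemma codefect_left_divide:
  assumes "x \<in> carrier M" "g \<in> carrier G" "h \<in> carrier G"
  shows "codefect (x \<cdot> inv\<^bsub>G\<^esub> twist g) (inv\<^bsub>G\<^esub> g \<otimes>\<^bsub>G\<^esub> h) = codefect x h \<ominus>\<^bsub>M\<^esub> codefect x g"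
proof -
  have "inv\<^bsub>G\<^esub> twist g \<otimes>\<^bsub>G\<^esub> inv\<^bsub>G\<^esub> twist (inv\<^bsub>G\<^esub> g \<otimes>\<^bsub>G\<^esub> h) = inv\<^bsub>G\<^esub> twist h"
    using assms by (simp add: twist_left_divide flip: G.inv_mult_group)
  then have "codefect (x \<cdot> inv\<^bsub>G\<^esub> twist g) (inv\<^bsub>G\<^esub> g \<otimes>\<^bsub>G\<^esub> h)
      = x \<cdot> inv\<^bsub>G\<^esub> twist g \<ominus>\<^bsub>M\<^esub> x \<cdot> inv\<^bsub>G\<^esub> twist h"
    using assms by (simp add: codefect_def)
  also have "\<dots> = codefect x h \<ominus>\<^bsub>M\<^esub> codefect x g"
    using assms by (simp add: codefect_def a_minus_def act.M.minus_add act.M.a_ac act.M.r_neg2)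
  finally show ?thesis .
qed

text \<open>The four lemmas below are all that the weights need to know about the under-operation: each
  rewrites a module component, or a difference of neighbouring components, of an acted face as
  the translate by one element of something made of the original components and twists.\<close>

abbreviation under_component :: "'m \<Rightarrow> 'm \<Rightarrow> 'g \<Rightarrow> 'm" where
  "under_component m n h \<equiv> m \<cdot> h \<oplus>\<^bsub>M\<^esub> (n \<cdot> \<phi> h \<ominus>\<^bsub>M\<^esub> n \<cdot> h)"

lemma under_component_eq:
  assumes "m \<in> carrier M" "n \<in> carrier M" "h \<in> carrier G"
  shows "under_component m n h = ((m \<ominus>\<^bsub>M\<^esub> n) \<oplus>\<^bsub>M\<^esub> n \<cdot> twist h) \<cdot> h"
  using assms by (simp add: translate_diff twist_mult) (simp add: a_minus_def act.M.a_ac)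

lemma under_component_diff:
  assumes "m \<in> carrier M" "p \<in> carrier M" "n \<in> carrier M" "h \<in> carrier G"
  shows "under_component m n h \<ominus>\<^bsub>M\<^esub> under_component p n h = (m \<ominus>\<^bsub>M\<^esub> p) \<cdot> h"
  using assms by (simp add: act.M.add_diff_add act.M.diff_self translate_diff)

lemma under_component_diff_over:
  assumes "m \<in> carrier M" "p \<in> carrier M" "n \<in> carrier M" "h \<in> carrier G"
  shows "under_component m n h \<ominus>\<^bsub>M\<^esub> p \<cdot> \<phi> h = ((m \<ominus>\<^bsub>M\<^esub> n) \<cdot> inv\<^bsub>G\<^esub> twist h \<oplus>\<^bsub>M\<^esub> (n \<ominus>\<^bsub>M\<^esub> p)) \<cdot> \<phi> h"
  using assms by (simp add: translate_diff inv_twist_phi) (simp add: a_minus_def act.M.a_ac)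

lemma under_component_diff_over_self:
  assumes "m \<in> carrier M" "n \<in> carrier M" "h \<in> carrier G"
  shows "under_component m n h \<ominus>\<^bsub>M\<^esub> n \<cdot> \<phi> h = (m \<ominus>\<^bsub>M\<^esub> n) \<cdot> inv\<^bsub>G\<^esub> twist h \<cdot> \<phi> h"
  using under_component_diff_over[of m n n h] assms by (simp add: act.M.diff_self)

end

section \<open>Bilinear maps and 2-cocycles\<close>

locale bilinear_invariant = multilinear_invariant G M act A \<phi> lam 2 f
  for G :: "('g, 'u) monoid_scheme"
    and M :: "('m, 'v) ring_scheme"
    and act :: "'m \<Rightarrow> ('g \<Rightarrow>\<^sub>0 int) \<Rightarrow> 'm"
    and A :: "('a, 'w) monoid_scheme"
    and \<phi> :: "'g \<Rightarrow> 'g"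
    and lam :: "'g \<Rightarrow> 'a"
    and f :: "'m list \<Rightarrow> 'a"
begin

abbreviation B :: "'m \<Rightarrow> 'm \<Rightarrow> 'a" where "B x y \<equiv> f [x, y]"

lemma B_left_hom: "y \<in> carrier M \<Longrightarrow> group_hom (add_monoid M) A (\<lambda>x. B x y)"
  using act.M.a_group A.is_group f_add[of "[_, y]" 0]
  by (auto simp: group_hom_def group_hom_axioms_def intro!: homI)

lemma B_right_hom: "x \<in> carrier M \<Longrightarrow> group_hom (add_monoid M) A (B x)"
  using act.M.a_group A.is_group f_add[of "[x, _]" 1]
  by (auto simp: group_hom_def group_hom_axioms_def intro!: homI)

lemma B_add_left: "\<lbrakk>x \<in> carrier M; x' \<in> carrier M; y \<in> carrier M\<rbrakk> \<Longrightarrow> B (x \<oplus>\<^bsub>M\<^esub> x') y = B x y \<otimes>\<^bsub>A\<^esub> B x' y"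
  using group_hom.hom_mult[OF B_left_hom, of y x x'] by simp

lemma B_add_right: "\<lbrakk>x \<in> carrier M; y \<in> carrier M; y' \<in> carrier M\<rbrakk> \<Longrightarrow> B x (y \<oplus>\<^bsub>M\<^esub> y') = B x y \<otimes>\<^bsub>A\<^esub> B x y'"
  using group_hom.hom_mult[OF B_right_hom, of x y y'] by simp

lemma B_diff_right:
  assumes "x \<in> carrier M" "y \<in> carrier M" "y' \<in> carrier M"
  shows "B x (y \<ominus>\<^bsub>M\<^esub> y') = B x y \<otimes>\<^bsub>A\<^esub> inv\<^bsub>A\<^esub> B x y'"
  using group_hom.hom_inv[OF B_right_hom[OF assms(1)], of y'] assms
  by (simp add: a_minus_def a_inv_def[symmetric] B_add_right)

lemma B_translate: "\<lbrakk>x \<in> carrier M; y \<in> carrier M; g \<in> carrier G\<rbrakk> \<Longrightarrow> B (x \<cdot> g) (y \<cdot> g) = B x y"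
  using f_translate[of "[x, y]" g] by simp

text \<open>Invariance lets a translation change sides. With \<open>g\<close> a twist, this converts \<open>x c\<^sub>g\<inverse>\<close> in the first
  argument into \<open>y c\<^sub>g\<close> in the second.\<close>

lemma B_translate_left:
  "\<lbrakk>x \<in> carrier M; y \<in> carrier M; g \<in> carrier G\<rbrakk> \<Longrightarrow> B (x \<cdot> inv\<^bsub>G\<^esub> g) y = B x (y \<cdot> g)"
  using B_translate[of "x \<cdot> inv\<^bsub>G\<^esub> g" y g] by simp

text \<open>The sum that defines \<open>\<psi>\<^sub>2\<close> has the two terms \<open>f(x, y)\<close> and \<open>-f(x g\<^sub>2, y \<phi>(g\<^sub>2))\<close>, and translating the
  second by \<open>g\<^sub>2\<inverse>\<close> makes the first arguments agree.\<close>

lemma weight_2: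
  assumes "m1 \<in> carrier M" "m2 \<in> carrier M" "g1 \<in> carrier G" "g2 \<in> carrier G"
  shows "weight [(m1, g1), (m2, g2)] = B (m1 \<ominus>\<^bsub>M\<^esub> m2) (defect m2 g2)"
proof -
  let ?x = "m1 \<ominus>\<^bsub>M\<^esub> m2"
  have t: "psi_terms [g1, g2] [?x, m2] [0, 0] = [?x, m2]"
    "psi_terms [g1, g2] [?x, m2] [0, 1] = [?x \<cdot> g2, m2 \<cdot> \<phi> g2]"
    using assms by (simp_all add: psi_terms_def psi_elem_def group_listprod_def upt_2)
  have "weight [(m1, g1), (m2, g2)] = fab_extend A f (frag_of [?x, m2] - frag_of [?x \<cdot> g2, m2 \<cdot> \<phi> g2])"
    unfolding weight_def psi_chain_eq leading_zero_bits_2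
    by (simp add: successive_diffs_def upt_2 t t(2)[unfolded One_nat_def])
  also have "\<dots> = B ?x m2 \<otimes>\<^bsub>A\<^esub> inv\<^bsub>A\<^esub> B (?x \<cdot> g2) (m2 \<cdot> \<phi> g2)"
    using assms by (subst hom_free_Abelian_group_diff[OF fab_extend_f_hom A.is_group]) (simp_all add: tuples_2_iff)
  also have "B (?x \<cdot> g2) (m2 \<cdot> \<phi> g2) = B ?x (m2 \<cdot> twist g2)"
    using assms B_translate[of ?x "m2 \<cdot> twist g2" g2] by (simp add: twist_mult)
  finally show ?thesis using assms by (simp add: defect_def B_diff_right)
qed

lemma weight_over_2:
  assumes "ys \<in> tuples (mcb_carrier X) 2" "a \<in> mcb_carrier X"
  shows "weight (map (\<lambda>y. mcb_over X y a) ys) = weight ys"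
  using assms
  by (auto simp: tuples_2_iff over_eq weight_2 defect_phi B_translate simp flip: translate_diff)

text \<open>In the acted face the first difference is \<open>(x c\<^sub>2\<inverse> + y) \<phi>(g\<^sub>2)\<close>, in the deleted face it is \<open>x + y\<close>, where
  \<open>x\<close> and \<open>y\<close> are the successive differences. The contribution of \<open>y\<close> cancels, and \<open>c\<^sub>2\<inverse>\<close> is moved to the other argument.\<close>

lemma weight_second_face_2:
  assumes "m1 \<in> carrier M" "m2 \<in> carrier M" "m3 \<in> carrier M" "g1 \<in> carrier G" "g2 \<in> carrier G" "g3 \<in> carrier G"
  shows "weight (act_face X [(m1, g1), (m2, g2), (m3, g3)] 1)
      \<otimes>\<^bsub>A\<^esub> inv\<^bsub>A\<^esub> weight (del_face [(m1, g1), (m2, g2), (m3, g3)] 1)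
    = inv\<^bsub>A\<^esub> B (m1 \<ominus>\<^bsub>M\<^esub> m2) (defect (defect m3 g3) g2)"
proof -
  define x where "x = m1 \<ominus>\<^bsub>M\<^esub> m2"
  define y where "y = m2 \<ominus>\<^bsub>M\<^esub> m3"
  define w where "w = defect m3 g3"
  have c: "x \<in> carrier M" "y \<in> carrier M" "w \<in> carrier M"
    using assms by (simp_all add: x_def y_def w_def)
  have "weight (act_face X [(m1, g1), (m2, g2), (m3, g3)] 1)
      = B ((x \<cdot> inv\<^bsub>G\<^esub> twist g2 \<oplus>\<^bsub>M\<^esub> y) \<cdot> \<phi> g2) (w \<cdot> \<phi> g2)"
    using assms
    by (simp add: act_face_def under_eq over_eq weight_2 under_component_diff_over defect_phi
        x_def y_def w_def del: translate_add translate_translate)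
  also have "\<dots> = B x (w \<cdot> twist g2) \<otimes>\<^bsub>A\<^esub> B y w"
    using c assms by (subst B_translate) (simp_all add: B_add_left B_translate_left)
  finally have act: "weight (act_face X [(m1, g1), (m2, g2), (m3, g3)] 1)
      = B x w \<otimes>\<^bsub>A\<^esub> inv\<^bsub>A\<^esub> B x (defect w g2) \<otimes>\<^bsub>A\<^esub> B y w"
    using c assms by (simp add: translate_twist B_diff_right)
  have "weight (del_face [(m1, g1), (m2, g2), (m3, g3)] 1) = B (x \<oplus>\<^bsub>M\<^esub> y) w"
    using assms by (simp add: del_face_def weight_2 w_def x_def y_def act.M.diff_add_diff)
  also have "\<dots> = B x w \<otimes>\<^bsub>A\<^esub> B y w"
    using c by (simp add: B_add_left)
  finally show ?thesis
    unfolding act using c assms(5)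
    by (simp add: A.cancel_common x_def[symmetric] w_def[symmetric])
qed

text \<open>Here the first argument is only translated by \<open>g\<^sub>3\<close>, while \<open>m\<^sub>2 = y + m\<^sub>3\<close> in the second argument
  becomes \<open>(y + m\<^sub>3 c\<^sub>3) g\<^sub>3\<close>. The contribution of \<open>y\<close> cancels.\<close>

lemma weight_third_face_2:
  assumes "m1 \<in> carrier M" "m2 \<in> carrier M" "m3 \<in> carrier M" "g1 \<in> carrier G" "g2 \<in> carrier G" "g3 \<in> carrier G"
  shows "weight (act_face X [(m1, g1), (m2, g2), (m3, g3)] 2)
      \<otimes>\<^bsub>A\<^esub> inv\<^bsub>A\<^esub> weight (del_face [(m1, g1), (m2, g2), (m3, g3)] 2)
    = inv\<^bsub>A\<^esub> B (m1 \<ominus>\<^bsub>M\<^esub> m2) (defect (defect m3 g3) g2)"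
proof -
  define x where "x = m1 \<ominus>\<^bsub>M\<^esub> m2"
  define y where "y = m2 \<ominus>\<^bsub>M\<^esub> m3"
  have c: "x \<in> carrier M" "y \<in> carrier M"
    using assms by (simp_all add: x_def y_def)
  have "weight (act_face X [(m1, g1), (m2, g2), (m3, g3)] 2)
      = B (x \<cdot> g3) (defect (under_component m2 m3 g3) (inv\<^bsub>G\<^esub> g3 \<otimes>\<^bsub>G\<^esub> g2 \<otimes>\<^bsub>G\<^esub> g3))"
    using assms
    by (simp add: act_face_def under_eq weight_2 under_component_diff x_def)
  also have "under_component m2 m3 g3 = (y \<oplus>\<^bsub>M\<^esub> m3 \<cdot> twist g3) \<cdot> g3"
    unfolding y_def by (rule under_component_eq[OF assms(2,3,6)])
  also have "B (x \<cdot> g3) (defect \<dots> (inv\<^bsub>G\<^esub> g3 \<otimes>\<^bsub>G\<^esub> g2 \<otimes>\<^bsub>G\<^esub> g3))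
      = B x (defect (y \<oplus>\<^bsub>M\<^esub> m3 \<cdot> twist g3) g2)"
    using c assms by (simp add: defect_conj B_translate del: translate_add translate_translate)
  finally have act: "weight (act_face X [(m1, g1), (m2, g2), (m3, g3)] 2)
      = B x (defect y g2) \<otimes>\<^bsub>A\<^esub> (B x (defect m3 g2) \<otimes>\<^bsub>A\<^esub> inv\<^bsub>A\<^esub> B x (defect (defect m3 g3) g2))"
    using c assms by (simp add: defect_add defect_diff translate_twist B_add_right B_diff_right)
  have "weight (del_face [(m1, g1), (m2, g2), (m3, g3)] 2) = B x (defect (y \<oplus>\<^bsub>M\<^esub> m3) g2)"
    using assms by (simp add: del_face_def weight_2 x_def y_def act.M.diff_add_cancel)
  also have "\<dots> = B x (defect y g2) \<otimes>\<^bsub>A\<^esub> B x (defect m3 g2)"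
    using c assms by (simp add: defect_add B_add_right)
  finally show ?thesis
    unfolding act using c assms
    by (simp add: A.cancel_common_left x_def[symmetric])
qed

lemma birack_relation_2:
  assumes xs: "xs \<in> tuples (mcb_carrier X) (Suc 2)"
  shows "cochain (\<Sum>i \<le> 2. frag_cmul ((-1) ^ i) (frag_of (act_face X xs i) - frag_of (del_face xs i)))
    = \<one>\<^bsub>tensor A A\<^esub>"
proof -
  obtain m1 g1 m2 g2 m3 g3 where xs_eq: "xs = [(m1, g1), (m2, g2), (m3, g3)]"
    and c: "m1 \<in> carrier M" "m2 \<in> carrier M" "m3 \<in> carrier M" "g1 \<in> carrier G" "g2 \<in> carrier G" "g3 \<in> carrier G"
    using xs by (auto simp: tuples_3_iff)
  define d where "d i = frag_of (act_face X xs i) - frag_of (del_face xs i)" for i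
  have keys: "Poly_Mapping.keys (d i) \<subseteq> tuples (mcb_carrier X) 2" if "i \<le> 2" for i
    unfolding d_def by (rule keys_diff_tuples[OF act_face_tuples[OF xs that] del_face_tuples[OF xs that]])
  let ?p = "pure_tensor A A (inv\<^bsub>A\<^esub> B (m1 \<ominus>\<^bsub>M\<^esub> m2) (defect (defect m3 g3) g2)) (lam g1)"
  have d0: "cochain (d 0) = \<one>\<^bsub>tensor A A\<^esub>"
    unfolding d_def using cochain_first_face[OF xs] weight_over_2 by blast
  have d1: "cochain (d 1) = ?p"
    unfolding d_def using cochain_later_face[OF xs, of 1] weight_second_face_2[OF c] by (simp add: xs_eq)
  have d2: "cochain (d 2) = ?p"
    unfolding d_def using cochain_later_face[OF xs, of 2] weight_third_face_2[OF c] by (simp add: xs_eq)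
  have "(\<Sum>i \<le> 2. frag_cmul ((-1) ^ i) (d i)) = d 0 - d 1 + d 2"
    by (simp add: numeral_2_eq_2)
  moreover have "cochain (d 0 - d 1 + d 2) = cochain (d 0) \<otimes>\<^bsub>tensor A A\<^esub> inv\<^bsub>tensor A A\<^esub> cochain (d 1)
      \<otimes>\<^bsub>tensor A A\<^esub> cochain (d 2)"
    using keys[of 0] keys[of 1] keys[of 2] subset_trans[OF keys_diff[of "d 0" "d 1"]]
    by (simp add: hom_free_Abelian_group_add[OF cochain_hom A_A.tensor.is_group]
        hom_free_Abelian_group_diff[OF cochain_hom A_A.tensor.is_group])
  moreover have "?p \<in> carrier (tensor A A)" using c by simp
  ultimately show ?thesis
    by (simp add: d0 d1[unfolded One_nat_def] d2 flip: d_def)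
qed

lemma fiber_relation_2:
  assumes len: "length us + length vs + 1 = 2" and us: "set us \<subseteq> mcb_carrier X" "set vs \<subseteq> mcb_carrier X"
    and c: "m \<in> carrier M" "g \<in> carrier G" "h \<in> carrier G"
  shows "cochain (frag_of (map (\<lambda>z. mcb_under X z (m, g)) us @ [(m \<cdot> \<phi> g, inv\<^bsub>G\<^esub> g \<otimes>\<^bsub>G\<^esub> h)]
          @ map (\<lambda>z. mcb_over X z (m, g)) vs)
        - frag_of (us @ [(m, h)] @ vs) + frag_of (us @ [(m, g)] @ vs)) = \<one>\<^bsub>tensor A A\<^esub>"
proof -
  consider p k where "us = []" "vs = [(p, k)]" "p \<in> carrier M" "k \<in> carrier G"
    | p k where "us = [(p, k)]" "vs = []" "p \<in> carrier M" "k \<in> carrier G"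
    using len us by (cases us; cases vs) auto
  then show ?thesis
  proof cases
    case 1
    have "weight [(m \<cdot> \<phi> g, inv\<^bsub>G\<^esub> g \<otimes>\<^bsub>G\<^esub> h), (p \<cdot> \<phi> g, k)] = weight [(m, g), (p, k)]"
      "weight [(m, h), (p, k)] = weight [(m, g), (p, k)]"
      using c 1 by (simp_all add: weight_2 defect_phi B_translate flip: translate_diff)
    then show ?thesis
      using c 1 cochain_fiber_first[of "m \<cdot> \<phi> g" g h "[(p \<cdot> \<phi> g, k)]" m "[(p, k)]"]
      by (simp add: over_eq tuples_2_iff)
  next
    case 2
    let ?e = "defect m (inv\<^bsub>G\<^esub> g \<otimes>\<^bsub>G\<^esub> h)"
    let ?xs = "[(under_component p m g, inv\<^bsub>G\<^esub> g \<otimes>\<^bsub>G\<^esub> k \<otimes>\<^bsub>G\<^esub> g), (m \<cdot> \<phi> g, inv\<^bsub>G\<^esub> g \<otimes>\<^bsub>G\<^esub> h)]"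
    have "weight ?xs = B ((p \<ominus>\<^bsub>M\<^esub> m) \<cdot> inv\<^bsub>G\<^esub> twist g \<cdot> \<phi> g) (?e \<cdot> \<phi> g)"
      using c 2 by (simp add: weight_2 under_component_diff_over_self defect_phi del: translate_translate)
    also have "\<dots> = B (p \<ominus>\<^bsub>M\<^esub> m) (?e \<cdot> twist g)"
      using c 2 by (simp add: B_translate B_translate_left del: translate_translate)
    also have "\<dots> = weight [(p, k), (m, h)] \<otimes>\<^bsub>A\<^esub> inv\<^bsub>A\<^esub> weight [(p, k), (m, g)]"
      using c 2 by (simp add: defect_left_divide weight_2 B_diff_right)
    finally have "weight [(p, k), (m, h)] = weight ?xs \<otimes>\<^bsub>A\<^esub> weight [(p, k), (m, g)]"
      using c 2 by (simp add: tuples_2_iff A.m_assoc)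
    then show ?thesis
      using c 2 cochain_fiber_later[of ?xs "[(p, k), (m, h)]" "[(p, k), (m, g)]"]
      by (simp add: under_eq tuples_2_iff lam_conj del: lam.hom_mult lam.hom_inv)
  qed
qed

lemma cocycle_2: "mcb_cocycle X 2 (tensor A A) (Phi G M act \<phi> A lam 2 f)"
  by (rule cocycleI[OF birack_relation_2 fiber_relation_2])

end

section \<open>Trilinear maps and 3-cocycles\<close>

locale trilinear_invariant = multilinear_invariant G M act A \<phi> lam 3 f
  for G :: "('g, 'u) monoid_scheme"
    and M :: "('m, 'v) ring_scheme"
    and act :: "'m \<Rightarrow> ('g \<Rightarrow>\<^sub>0 int) \<Rightarrow> 'm"
    and A :: "('a, 'w) monoid_scheme"
    and \<phi> :: "'g \<Rightarrow> 'g"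
    and lam :: "'g \<Rightarrow> 'a"
    and f :: "'m list \<Rightarrow> 'a"
begin

abbreviation T :: "'m \<Rightarrow> 'm \<Rightarrow> 'm \<Rightarrow> 'a" where "T x y z \<equiv> f [x, y, z]"

lemma T_left_hom: "\<lbrakk>y \<in> carrier M; z \<in> carrier M\<rbrakk> \<Longrightarrow> group_hom (add_monoid M) A (\<lambda>x. T x y z)"
  using act.M.a_group A.is_group f_add[of "[_, y, z]" 0]
  by (auto simp: group_hom_def group_hom_axioms_def intro!: homI)

lemma T_middle_hom: "\<lbrakk>x \<in> carrier M; z \<in> carrier M\<rbrakk> \<Longrightarrow> group_hom (add_monoid M) A (\<lambda>y. T x y z)"
  using act.M.a_group A.is_group f_add[of "[x, _, z]" 1]
  by (auto simp: group_hom_def group_hom_axioms_def intro!: homI)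

lemma T_right_hom: "\<lbrakk>x \<in> carrier M; y \<in> carrier M\<rbrakk> \<Longrightarrow> group_hom (add_monoid M) A (T x y)"
  using act.M.a_group A.is_group f_add[of "[x, y, _]" 2]
  by (auto simp: group_hom_def group_hom_axioms_def intro!: homI)

lemma T_add_left:
  "\<lbrakk>x \<in> carrier M; x' \<in> carrier M; y \<in> carrier M; z \<in> carrier M\<rbrakk> \<Longrightarrow> T (x \<oplus>\<^bsub>M\<^esub> x') y z = T x y z \<otimes>\<^bsub>A\<^esub> T x' y z"
  using group_hom.hom_mult[OF T_left_hom, of y z x x'] by simp

lemma T_add_middle:
  "\<lbrakk>x \<in> carrier M; y \<in> carrier M; y' \<in> carrier M; z \<in> carrier M\<rbrakk> \<Longrightarrow> T x (y \<oplus>\<^bsub>M\<^esub> y') z = T x y z \<otimes>\<^bsub>A\<^esub> T x y' z"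
  using group_hom.hom_mult[OF T_middle_hom, of x z y y'] by simp

lemma T_add_right:
  "\<lbrakk>x \<in> carrier M; y \<in> carrier M; z \<in> carrier M; z' \<in> carrier M\<rbrakk> \<Longrightarrow> T x y (z \<oplus>\<^bsub>M\<^esub> z') = T x y z \<otimes>\<^bsub>A\<^esub> T x y z'"
  using group_hom.hom_mult[OF T_right_hom, of x y z z'] by simp

lemma T_diff_left:
  assumes "x \<in> carrier M" "x' \<in> carrier M" "y \<in> carrier M" "z \<in> carrier M"
  shows "T (x \<ominus>\<^bsub>M\<^esub> x') y z = T x y z \<otimes>\<^bsub>A\<^esub> inv\<^bsub>A\<^esub> T x' y z"
  using group_hom.hom_inv[OF T_left_hom[OF assms(3,4)], of x'] assms
  by (simp add: a_minus_def a_inv_def[symmetric] T_add_left)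

lemma T_diff_right:
  assumes "x \<in> carrier M" "y \<in> carrier M" "z \<in> carrier M" "z' \<in> carrier M"
  shows "T x y (z \<ominus>\<^bsub>M\<^esub> z') = T x y z \<otimes>\<^bsub>A\<^esub> inv\<^bsub>A\<^esub> T x y z'"
  using group_hom.hom_inv[OF T_right_hom[OF assms(1,2)], of z'] assms
  by (simp add: a_minus_def a_inv_def[symmetric] T_add_right)

lemma T_translate:
  "\<lbrakk>x \<in> carrier M; y \<in> carrier M; z \<in> carrier M; g \<in> carrier G\<rbrakk> \<Longrightarrow> T (x \<cdot> g) (y \<cdot> g) (z \<cdot> g) = T x y z"
  using f_translate[of "[x, y, z]" g] by simp

lemma T_translate_left_middle:
  "\<lbrakk>x \<in> carrier M; y \<in> carrier M; z \<in> carrier M; g \<in> carrier G\<rbrakk> \<Longrightarrow> T (x \<cdot> inv\<^bsub>G\<^esub> g) (y \<cdot> inv\<^bsub>G\<^esub> g) z = T x y (z \<cdot> g)"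
  using T_translate[of "x \<cdot> inv\<^bsub>G\<^esub> g" "y \<cdot> inv\<^bsub>G\<^esub> g" z g] by simp

text \<open>Of the four terms that define \<open>\<psi>\<^sub>3\<close>, those with \<open>k\<^sub>2 = 1\<close> are translated by \<open>\<phi>(g\<^sub>2)\<inverse>\<close> and those with
  \<open>k\<^sub>3 = 1\<close> by \<open>g\<^sub>3\<inverse>\<close>. Then all middle arguments are \<open>m\<^sub>2 - m\<^sub>3\<close>, the first argument has acquired
  \<open>c\<^sub>2\<inverse>\<close> if \<open>k\<^sub>2 = 1\<close> and the last argument \<open>c\<^sub>3\<close> if \<open>k\<^sub>3 = 1\<close>, so the alternating sum factors.\<close>

lemma weight_3:
  assumes "m1 \<in> carrier M" "m2 \<in> carrier M" "m3 \<in> carrier M" "g1 \<in> carrier G" "g2 \<in> carrier G" "g3 \<in> carrier G"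
  shows "weight [(m1, g1), (m2, g2), (m3, g3)] = T (codefect (m1 \<ominus>\<^bsub>M\<^esub> m2) g2) (m2 \<ominus>\<^bsub>M\<^esub> m3) (defect m3 g3)"
proof -
  define x where "x = m1 \<ominus>\<^bsub>M\<^esub> m2"
  define y where "y = m2 \<ominus>\<^bsub>M\<^esub> m3"
  have c: "x \<in> carrier M" "y \<in> carrier M" using assms by (simp_all add: x_def y_def)
  let ?gs = "[g1, g2, g3]" and ?ms = "[x, y, m3]"
  let ?b = "[x \<cdot> g3, y \<cdot> g3, m3 \<cdot> \<phi> g3]" and ?c = "[x \<cdot> g2, y \<cdot> \<phi> g2, m3 \<cdot> \<phi> g2]"
  let ?d = "[x \<cdot> (g2 \<otimes>\<^bsub>G\<^esub> g3), y \<cdot> (\<phi> g2 \<otimes>\<^bsub>G\<^esub> g3), m3 \<cdot> (\<phi> g2 \<otimes>\<^bsub>G\<^esub> \<phi> g3)]"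
  have t: "psi_terms ?gs ?ms [0, 0, 0] = ?ms" "psi_terms ?gs ?ms [0, 0, Suc 0] = ?b"
    "psi_terms ?gs ?ms [0, Suc 0, 0] = ?c" "psi_terms ?gs ?ms [0, Suc 0, Suc 0] = ?d"
    using assms c by (simp_all add: psi_terms_def psi_elem_def group_listprod_def upt_2 upt_3)
  have tuples: "?ms \<in> tuples (carrier M) 3" "?b \<in> tuples (carrier M) 3" "?c \<in> tuples (carrier M) 3" "?d \<in> tuples (carrier M) 3"
    using assms c by (simp_all add: tuples_3_iff)
  have "weight [(m1, g1), (m2, g2), (m3, g3)]
      = fab_extend A f ((frag_of ?ms - frag_of ?b) - (frag_of ?c - frag_of ?d))"
    unfolding weight_def psi_chain_eq leading_zero_bits_3
    by (simp add: successive_diffs_def upt_3 t algebra_simps flip: x_def y_def)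
  also have "\<dots> = (f ?ms \<otimes>\<^bsub>A\<^esub> inv\<^bsub>A\<^esub> f ?b) \<otimes>\<^bsub>A\<^esub> inv\<^bsub>A\<^esub> (f ?c \<otimes>\<^bsub>A\<^esub> inv\<^bsub>A\<^esub> f ?d)"
  proof -
    have "Poly_Mapping.keys (frag_of p - frag_of q) \<subseteq> tuples (carrier M) 3"
      if "p \<in> tuples (carrier M) 3" "q \<in> tuples (carrier M) 3" for p q
      using that keys_diff[of "frag_of p" "frag_of q"] by auto
    moreover have "f p \<in> carrier A" if "p \<in> tuples (carrier M) 3" for p
      using f_funcset that by blast
    ultimately show ?thesis
      using tuples by (simp add: hom_free_Abelian_group_diff[OF fab_extend_f_hom A.is_group] del: f_closed)
  qed
  also have "f ?b = T x y (m3 \<cdot> twist g3)"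
    using assms c T_translate[of x y "m3 \<cdot> twist g3" g3] by (simp add: twist_mult)
  also have "f ?c = T (x \<cdot> inv\<^bsub>G\<^esub> twist g2) y m3"
    using assms c T_translate[of "x \<cdot> inv\<^bsub>G\<^esub> twist g2" y m3 "\<phi> g2"] by (simp add: inv_twist_phi)
  also have "f ?d = T (x \<cdot> inv\<^bsub>G\<^esub> twist g2) y (m3 \<cdot> twist g3)"
  proof -
    have "inv\<^bsub>G\<^esub> twist g2 \<otimes>\<^bsub>G\<^esub> (\<phi> g2 \<otimes>\<^bsub>G\<^esub> g3) = g2 \<otimes>\<^bsub>G\<^esub> g3"
      using assms by (simp add: inv_twist_phi flip: G.m_assoc)
    moreover have "twist g3 \<otimes>\<^bsub>G\<^esub> (\<phi> g2 \<otimes>\<^bsub>G\<^esub> g3) = \<phi> g2 \<otimes>\<^bsub>G\<^esub> \<phi> g3"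
      using assms by (simp add: twist_mult G.m_assoc flip: G.m_assoc[of "twist g3"] twist_phi)
    ultimately show ?thesis
      using assms c T_translate[of "x \<cdot> inv\<^bsub>G\<^esub> twist g2" y "m3 \<cdot> twist g3" "\<phi> g2 \<otimes>\<^bsub>G\<^esub> g3"] by simp
  qed
  finally show ?thesis
    using assms c
    by (simp add: codefect_def T_diff_left flip: x_def y_def) (simp add: defect_def T_diff_right)
qed

lemma weight_over_3:
  assumes "ys \<in> tuples (mcb_carrier X) 3" "a \<in> mcb_carrier X"
  shows "weight (map (\<lambda>y. mcb_over X y a) ys) = weight ys"
  using assms
  by (auto simp: tuples_3_iff over_eq weight_3 defect_phi codefect_phi T_translate simp flip: translate_diff)

text \<open>The first difference \<open>x\<close> becomes \<open>x c\<^sub>2\<inverse>\<close> before it is added to the second one; everything else is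
  translated by \<open>\<phi>(g\<^sub>2)\<close>.\<close>

lemma weight_second_face_3:
  assumes "m1 \<in> carrier M" "m2 \<in> carrier M" "m3 \<in> carrier M" "m4 \<in> carrier M" "g1 \<in> carrier G" "g2 \<in> carrier G" "g3 \<in> carrier G" "g4 \<in> carrier G"
  shows "weight (act_face X [(m1, g1), (m2, g2), (m3, g3), (m4, g4)] 1) \<otimes>\<^bsub>A\<^esub> inv\<^bsub>A\<^esub> weight (del_face [(m1, g1), (m2, g2), (m3, g3), (m4, g4)] 1)
    = inv\<^bsub>A\<^esub> T (codefect (codefect (m1 \<ominus>\<^bsub>M\<^esub> m2) g2) g3) (m3 \<ominus>\<^bsub>M\<^esub> m4) (defect m4 g4)"
proof -
  define x where "x = m1 \<ominus>\<^bsub>M\<^esub> m2"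
  define y where "y = m2 \<ominus>\<^bsub>M\<^esub> m3"
  define z where "z = m3 \<ominus>\<^bsub>M\<^esub> m4"
  define w where "w = defect m4 g4"
  have c: "x \<in> carrier M" "y \<in> carrier M" "z \<in> carrier M" "w \<in> carrier M"
    using assms by (simp_all add: x_def y_def z_def w_def)
  have "weight (act_face X [(m1, g1), (m2, g2), (m3, g3), (m4, g4)] 1)
      = T (codefect (x \<cdot> inv\<^bsub>G\<^esub> twist g2 \<oplus>\<^bsub>M\<^esub> y) g3 \<cdot> \<phi> g2) (z \<cdot> \<phi> g2) (w \<cdot> \<phi> g2)"
    using assms
    by (simp add: act_face_def under_eq over_eq weight_3 under_component_diff_over defect_phi codefect_phi
        x_def y_def z_def w_def del: translate_add translate_translate flip: translate_diff)
  also have "\<dots> = T (codefect (x \<cdot> inv\<^bsub>G\<^esub> twist g2 \<oplus>\<^bsub>M\<^esub> y) g3) z w"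
    using c assms by (simp add: T_translate del: translate_add translate_translate)
  finally have act: "weight (act_face X [(m1, g1), (m2, g2), (m3, g3), (m4, g4)] 1)
      = T (codefect x g3) z w \<otimes>\<^bsub>A\<^esub> inv\<^bsub>A\<^esub> T (codefect (codefect x g2) g3) z w \<otimes>\<^bsub>A\<^esub> T (codefect y g3) z w"
    using c assms
    by (simp add: translate_inv_twist codefect_add codefect_diff T_add_left T_diff_left)
  have "weight (del_face [(m1, g1), (m2, g2), (m3, g3), (m4, g4)] 1) = T (codefect (x \<oplus>\<^bsub>M\<^esub> y) g3) z w"
    using assms by (simp add: del_face_def weight_3 w_def x_def y_def z_def act.M.diff_add_diff)
  also have "\<dots> = T (codefect x g3) z w \<otimes>\<^bsub>A\<^esub> T (codefect y g3) z w"
    using c assms by (simp add: codefect_add T_add_left)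
  finally show ?thesis
    unfolding act using c assms
    by (simp add: A.cancel_common x_def[symmetric] z_def[symmetric] w_def[symmetric])
qed

text \<open>The first argument and the middle difference \<open>y\<close> both acquire \<open>c\<^sub>3\<inverse>\<close>, while the difference \<open>z\<close> that
  is added to \<open>y\<close> does not. In the summand with \<open>y\<close> the two factors \<open>c\<^sub>3\<inverse>\<close> turn into \<open>c\<^sub>3\<close> in the last
  argument; in the summand with \<open>z\<close> the factor stays in the first argument. This is why the
  difference of weights has two terms here, one for each neighbouring position.\<close>

lemma weight_third_face_3:
  assumes "m1 \<in> carrier M" "m2 \<in> carrier M" "m3 \<in> carrier M" "m4 \<in> carrier M" "g1 \<in> carrier G" "g2 \<in> carrier G" "g3 \<in> carrier G" "g4 \<in> carrier G"
  shows "weight (act_face X [(m1, g1), (m2, g2), (m3, g3), (m4, g4)] 2) \<otimes>\<^bsub>A\<^esub> inv\<^bsub>A\<^esub> weight (del_face [(m1, g1), (m2, g2), (m3, g3), (m4, g4)] 2)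
    = inv\<^bsub>A\<^esub> T (codefect (m1 \<ominus>\<^bsub>M\<^esub> m2) g2) (m2 \<ominus>\<^bsub>M\<^esub> m3) (defect (defect m4 g4) g3)
      \<otimes>\<^bsub>A\<^esub> inv\<^bsub>A\<^esub> T (codefect (codefect (m1 \<ominus>\<^bsub>M\<^esub> m2) g2) g3) (m3 \<ominus>\<^bsub>M\<^esub> m4) (defect m4 g4)"
proof -
  define x where "x = codefect (m1 \<ominus>\<^bsub>M\<^esub> m2) g2"
  define y where "y = m2 \<ominus>\<^bsub>M\<^esub> m3"
  define z where "z = m3 \<ominus>\<^bsub>M\<^esub> m4"
  define w where "w = defect m4 g4"
  let ?t = "inv\<^bsub>G\<^esub> twist g3"
  have c: "x \<in> carrier M" "y \<in> carrier M" "z \<in> carrier M" "w \<in> carrier M"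
    using assms by (simp_all add: x_def y_def z_def w_def)
  have "weight (act_face X [(m1, g1), (m2, g2), (m3, g3), (m4, g4)] 2) = T (x \<cdot> g3) ((y \<cdot> ?t \<oplus>\<^bsub>M\<^esub> z) \<cdot> \<phi> g3) (w \<cdot> \<phi> g3)"
    using assms
    by (simp add: act_face_def under_eq over_eq weight_3 under_component_diff under_component_diff_over
        codefect_conj defect_phi x_def y_def z_def w_def del: translate_add translate_translate)
  also have "x \<cdot> g3 = x \<cdot> ?t \<cdot> \<phi> g3"
    using c assms by (simp add: inv_twist_phi)
  also have "T \<dots> ((y \<cdot> ?t \<oplus>\<^bsub>M\<^esub> z) \<cdot> \<phi> g3) (w \<cdot> \<phi> g3) = T (x \<cdot> ?t) (y \<cdot> ?t \<oplus>\<^bsub>M\<^esub> z) w"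
    using c assms by (simp add: T_translate del: translate_add translate_translate)
  also have "\<dots> = T x y (w \<cdot> twist g3) \<otimes>\<^bsub>A\<^esub> T (x \<cdot> ?t) z w"
    using c assms by (simp add: T_add_middle T_translate_left_middle)
  finally have act: "weight (act_face X [(m1, g1), (m2, g2), (m3, g3), (m4, g4)] 2)
      = (T x y w \<otimes>\<^bsub>A\<^esub> inv\<^bsub>A\<^esub> T x y (defect w g3)) \<otimes>\<^bsub>A\<^esub> (T x z w \<otimes>\<^bsub>A\<^esub> inv\<^bsub>A\<^esub> T (codefect x g3) z w)"
    using c assms by (simp add: translate_twist translate_inv_twist T_diff_left T_diff_right)
  have "weight (del_face [(m1, g1), (m2, g2), (m3, g3), (m4, g4)] 2) = T x (y \<oplus>\<^bsub>M\<^esub> z) w"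
    using assms by (simp add: del_face_def weight_3 w_def x_def y_def z_def act.M.diff_add_diff)
  also have "\<dots> = T x y w \<otimes>\<^bsub>A\<^esub> T x z w"
    using c by (simp add: T_add_middle)
  finally show ?thesis
    unfolding act using c assms
    by (simp add: A.cancel_pair x_def[symmetric] y_def[symmetric] z_def[symmetric] w_def[symmetric])
qed

text \<open>The first two arguments are only translated by \<open>g\<^sub>4\<close>, and the last one changes as in degree 2.\<close>

lemma weight_fourth_face_3:
  assumes "m1 \<in> carrier M" "m2 \<in> carrier M" "m3 \<in> carrier M" "m4 \<in> carrier M" "g1 \<in> carrier G" "g2 \<in> carrier G" "g3 \<in> carrier G" "g4 \<in> carrier G"
  shows "weight (act_face X [(m1, g1), (m2, g2), (m3, g3), (m4, g4)] 3) \<otimes>\<^bsub>A\<^esub> inv\<^bsub>A\<^esub> weight (del_face [(m1, g1), (m2, g2), (m3, g3), (m4, g4)] 3)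
    = inv\<^bsub>A\<^esub> T (codefect (m1 \<ominus>\<^bsub>M\<^esub> m2) g2) (m2 \<ominus>\<^bsub>M\<^esub> m3) (defect (defect m4 g4) g3)"
proof -
  define x where "x = codefect (m1 \<ominus>\<^bsub>M\<^esub> m2) g2"
  define y where "y = m2 \<ominus>\<^bsub>M\<^esub> m3"
  define z where "z = m3 \<ominus>\<^bsub>M\<^esub> m4"
  let ?g = "inv\<^bsub>G\<^esub> g4 \<otimes>\<^bsub>G\<^esub> g3 \<otimes>\<^bsub>G\<^esub> g4"
  have c: "x \<in> carrier M" "y \<in> carrier M" "z \<in> carrier M"
    using assms by (simp_all add: x_def y_def z_def)
  have "weight (act_face X [(m1, g1), (m2, g2), (m3, g3), (m4, g4)] 3) = T (x \<cdot> g4) (y \<cdot> g4) (defect (under_component m3 m4 g4) ?g)"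
    using assms
    by (simp add: act_face_def under_eq weight_3 under_component_diff codefect_conj x_def y_def
        del: translate_translate)
  also have "under_component m3 m4 g4 = (z \<oplus>\<^bsub>M\<^esub> m4 \<cdot> twist g4) \<cdot> g4"
    unfolding z_def by (rule under_component_eq[OF assms(3,4,8)])
  also have "T (x \<cdot> g4) (y \<cdot> g4) (defect \<dots> ?g) = T x y (defect (z \<oplus>\<^bsub>M\<^esub> m4 \<cdot> twist g4) g3)"
    using c assms by (simp add: defect_conj T_translate del: translate_add translate_translate)
  finally have act: "weight (act_face X [(m1, g1), (m2, g2), (m3, g3), (m4, g4)] 3)
      = T x y (defect z g3) \<otimes>\<^bsub>A\<^esub> (T x y (defect m4 g3) \<otimes>\<^bsub>A\<^esub> inv\<^bsub>A\<^esub> T x y (defect (defect m4 g4) g3))"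
    using c assms by (simp add: defect_add defect_diff translate_twist T_add_right T_diff_right)
  have "weight (del_face [(m1, g1), (m2, g2), (m3, g3), (m4, g4)] 3) = T x y (defect (z \<oplus>\<^bsub>M\<^esub> m4) g3)"
    using assms by (simp add: del_face_def weight_3 x_def y_def z_def act.M.diff_add_cancel)
  also have "\<dots> = T x y (defect z g3) \<otimes>\<^bsub>A\<^esub> T x y (defect m4 g3)"
    using c assms by (simp add: defect_add T_add_right)
  finally show ?thesis
    unfolding act using c assms
    by (simp add: A.cancel_common_left x_def[symmetric] y_def[symmetric])
qed

lemma birack_relation_3:
  assumes xs: "xs \<in> tuples (mcb_carrier X) (Suc 3)"
  shows "cochain (\<Sum>i \<le> 3. frag_cmul ((-1) ^ i) (frag_of (act_face X xs i) - frag_of (del_face xs i)))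
    = \<one>\<^bsub>tensor A A\<^esub>"
proof -
  obtain m1 g1 m2 g2 m3 g3 m4 g4 where xs_eq: "xs = [(m1, g1), (m2, g2), (m3, g3), (m4, g4)]"
    and c: "m1 \<in> carrier M" "m2 \<in> carrier M" "m3 \<in> carrier M" "m4 \<in> carrier M" "g1 \<in> carrier G" "g2 \<in> carrier G" "g3 \<in> carrier G" "g4 \<in> carrier G"
    using xs by (auto simp: tuples_4_iff)
  define d where "d i = frag_of (act_face X xs i) - frag_of (del_face xs i)" for i
  have keys: "Poly_Mapping.keys (d i) \<subseteq> tuples (mcb_carrier X) 3" if "i \<le> 3" for i
    unfolding d_def by (rule keys_diff_tuples[OF act_face_tuples[OF xs that] del_face_tuples[OF xs that]])
  define P where "P = T (codefect (m1 \<ominus>\<^bsub>M\<^esub> m2) g2) (m2 \<ominus>\<^bsub>M\<^esub> m3) (defect (defect m4 g4) g3)"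
  define Q where "Q = T (codefect (codefect (m1 \<ominus>\<^bsub>M\<^esub> m2) g2) g3) (m3 \<ominus>\<^bsub>M\<^esub> m4) (defect m4 g4)"
  have PQ: "P \<in> carrier A" "Q \<in> carrier A" using c by (simp_all add: P_def Q_def)
  let ?p = "\<lambda>a. pure_tensor A A a (lam g1)"
  have d0: "cochain (d 0) = \<one>\<^bsub>tensor A A\<^esub>"
    unfolding d_def using cochain_first_face[OF xs] weight_over_3 by blast
  have d1: "cochain (d 1) = ?p (inv\<^bsub>A\<^esub> Q)"
    unfolding d_def using cochain_later_face[OF xs, of 1] weight_second_face_3[OF c] by (simp add: xs_eq Q_def)
  have d2: "cochain (d 2) = ?p (inv\<^bsub>A\<^esub> P \<otimes>\<^bsub>A\<^esub> inv\<^bsub>A\<^esub> Q)"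
    unfolding d_def using cochain_later_face[OF xs, of 2] weight_third_face_3[OF c] by (simp add: xs_eq P_def Q_def)
  have d3: "cochain (d 3) = ?p (inv\<^bsub>A\<^esub> P)"
    unfolding d_def using cochain_later_face[OF xs, of 3] weight_fourth_face_3[OF c] by (simp add: xs_eq P_def)
  have "(\<Sum>i \<le> 3. frag_cmul ((-1) ^ i) (d i)) = (d 0 - d 1) + (d 2 - d 3)"
    by (simp add: numeral_3_eq_3 numeral_2_eq_2)
  moreover have "cochain ((d 0 - d 1) + (d 2 - d 3)) = cochain (d 0) \<otimes>\<^bsub>tensor A A\<^esub> inv\<^bsub>tensor A A\<^esub> cochain (d 1)
      \<otimes>\<^bsub>tensor A A\<^esub> (cochain (d 2) \<otimes>\<^bsub>tensor A A\<^esub> inv\<^bsub>tensor A A\<^esub> cochain (d 3))"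
    using keys[of 0] keys[of 1] keys[of 2] keys[of 3] subset_trans[OF keys_diff[of "d 0" "d 1"]]
      subset_trans[OF keys_diff[of "d 2" "d 3"]]
    by (simp add: hom_free_Abelian_group_add[OF cochain_hom A_A.tensor.is_group]
        hom_free_Abelian_group_diff[OF cochain_hom A_A.tensor.is_group])
  moreover have "\<dots> = \<one>\<^bsub>tensor A A\<^esub>"
  proof -
    have "?p (inv\<^bsub>A\<^esub> P \<otimes>\<^bsub>A\<^esub> inv\<^bsub>A\<^esub> Q) = ?p (inv\<^bsub>A\<^esub> Q) \<otimes>\<^bsub>tensor A A\<^esub> ?p (inv\<^bsub>A\<^esub> P)"
      using PQ c by (simp add: A_A.pure_tensor_mult_left A.m_comm[of "inv\<^bsub>A\<^esub> P"])
    then show ?thesis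
      unfolding d0 d1 d2 d3 using PQ c by (simp add: A_A.tensor.m_assoc)
  qed
  ultimately show ?thesis by (simp flip: d_def)
qed

lemma fiber_relation_3:
  assumes len: "length us + length vs + 1 = 3" and us: "set us \<subseteq> mcb_carrier X" "set vs \<subseteq> mcb_carrier X"
    and c: "m \<in> carrier M" "g \<in> carrier G" "h \<in> carrier G"
  shows "cochain (frag_of (map (\<lambda>z. mcb_under X z (m, g)) us @ [(m \<cdot> \<phi> g, inv\<^bsub>G\<^esub> g \<otimes>\<^bsub>G\<^esub> h)]
          @ map (\<lambda>z. mcb_over X z (m, g)) vs)
        - frag_of (us @ [(m, h)] @ vs) + frag_of (us @ [(m, g)] @ vs)) = \<one>\<^bsub>tensor A A\<^esub>"
proof -
  consider p k q l where "us = []" "vs = [(p, k), (q, l)]" "p \<in> carrier M" "k \<in> carrier G" "q \<in> carrier M" "l \<in> carrier G"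
    | p k q l where "us = [(p, k)]" "vs = [(q, l)]" "p \<in> carrier M" "k \<in> carrier G" "q \<in> carrier M" "l \<in> carrier G"
    | p k q l where "us = [(p, k), (q, l)]" "vs = []" "p \<in> carrier M" "k \<in> carrier G" "q \<in> carrier M" "l \<in> carrier G"
  proof -
    have us': "us \<in> tuples (mcb_carrier X) (length us)" "vs \<in> tuples (mcb_carrier X) (length vs)"
      using us by (auto simp: tuples_def)
    consider "length us = 0" "length vs = 2" | "length us = 1" "length vs = 1" | "length us = 2" "length vs = 0"
      using len by linarith
    then show thesis
      using that us us' by cases (auto simp: tuples_2_iff length_Suc_conv)
  qed
  then show ?thesis
  proof cases
    case 1
    have "weight [(m \<cdot> \<phi> g, inv\<^bsub>G\<^esub> g \<otimes>\<^bsub>G\<^esub> h), (p \<cdot> \<phi> g, k), (q \<cdot> \<phi> g, l)] = weight [(m, g), (p, k), (q, l)]"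
      "weight [(m, h), (p, k), (q, l)] = weight [(m, g), (p, k), (q, l)]"
      using c 1 by (simp_all add: weight_3 defect_phi codefect_phi T_translate flip: translate_diff)
    then show ?thesis
      using c 1 cochain_fiber_first[of "m \<cdot> \<phi> g" g h "[(p \<cdot> \<phi> g, k), (q \<cdot> \<phi> g, l)]" m "[(p, k), (q, l)]"]
      by (simp add: over_eq tuples_3_iff)
  next
    case 2
    let ?xs = "[(under_component p m g, inv\<^bsub>G\<^esub> g \<otimes>\<^bsub>G\<^esub> k \<otimes>\<^bsub>G\<^esub> g), (m \<cdot> \<phi> g, inv\<^bsub>G\<^esub> g \<otimes>\<^bsub>G\<^esub> h), (q \<cdot> \<phi> g, l)]"
    let ?w = "defect q l"
    have "weight ?xs = T (codefect ((p \<ominus>\<^bsub>M\<^esub> m) \<cdot> inv\<^bsub>G\<^esub> twist g) (inv\<^bsub>G\<^esub> g \<otimes>\<^bsub>G\<^esub> h) \<cdot> \<phi> g) ((m \<ominus>\<^bsub>M\<^esub> q) \<cdot> \<phi> g) (?w \<cdot> \<phi> g)"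
      using c 2
      by (simp add: weight_3 under_component_diff_over_self defect_phi codefect_phi
          del: translate_translate flip: translate_diff)
    also have "\<dots> = T (codefect (p \<ominus>\<^bsub>M\<^esub> m) h \<ominus>\<^bsub>M\<^esub> codefect (p \<ominus>\<^bsub>M\<^esub> m) g) (m \<ominus>\<^bsub>M\<^esub> q) ?w"
      using c 2 by (simp add: T_translate codefect_left_divide del: translate_translate)
    also have "\<dots> = weight [(p, k), (m, h), (q, l)] \<otimes>\<^bsub>A\<^esub> inv\<^bsub>A\<^esub> weight [(p, k), (m, g), (q, l)]"
      using c 2 by (simp add: weight_3 T_diff_left)
    finally have "weight [(p, k), (m, h), (q, l)] = weight ?xs \<otimes>\<^bsub>A\<^esub> weight [(p, k), (m, g), (q, l)]"
      using c 2 by (simp add: tuples_3_iff A.m_assoc)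
    then show ?thesis
      using c 2 cochain_fiber_later[of ?xs "[(p, k), (m, h), (q, l)]" "[(p, k), (m, g), (q, l)]"]
      by (simp add: under_eq over_eq tuples_3_iff lam_conj del: lam.hom_mult lam.hom_inv)
  next
    case 3
    let ?e = "defect m (inv\<^bsub>G\<^esub> g \<otimes>\<^bsub>G\<^esub> h)" and ?x = "codefect (p \<ominus>\<^bsub>M\<^esub> q) l" and ?t = "inv\<^bsub>G\<^esub> twist g"
    let ?xs = "[(under_component p m g, inv\<^bsub>G\<^esub> g \<otimes>\<^bsub>G\<^esub> k \<otimes>\<^bsub>G\<^esub> g), (under_component q m g, inv\<^bsub>G\<^esub> g \<otimes>\<^bsub>G\<^esub> l \<otimes>\<^bsub>G\<^esub> g),
      (m \<cdot> \<phi> g, inv\<^bsub>G\<^esub> g \<otimes>\<^bsub>G\<^esub> h)]"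
    have "weight ?xs = T (?x \<cdot> g) ((q \<ominus>\<^bsub>M\<^esub> m) \<cdot> ?t \<cdot> \<phi> g) (?e \<cdot> \<phi> g)"
      using c 3
      by (simp add: weight_3 under_component_diff under_component_diff_over_self codefect_conj defect_phi
          del: translate_translate)
    also have "?x \<cdot> g = ?x \<cdot> ?t \<cdot> \<phi> g"
      using c 3 by (simp add: inv_twist_phi)
    also have "T \<dots> ((q \<ominus>\<^bsub>M\<^esub> m) \<cdot> ?t \<cdot> \<phi> g) (?e \<cdot> \<phi> g) = T ?x (q \<ominus>\<^bsub>M\<^esub> m) (?e \<cdot> twist g)"
      using c 3 by (simp add: T_translate T_translate_left_middle del: translate_translate)
    also have "\<dots> = weight [(p, k), (q, l), (m, h)] \<otimes>\<^bsub>A\<^esub> inv\<^bsub>A\<^esub> weight [(p, k), (q, l), (m, g)]"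
      using c 3 by (simp add: defect_left_divide weight_3 T_diff_right)
    finally have "weight [(p, k), (q, l), (m, h)] = weight ?xs \<otimes>\<^bsub>A\<^esub> weight [(p, k), (q, l), (m, g)]"
      using c 3 by (simp add: tuples_3_iff A.m_assoc)
    then show ?thesis
      using c 3 cochain_fiber_later[of ?xs "[(p, k), (q, l), (m, h)]" "[(p, k), (q, l), (m, g)]"]
      by (simp add: under_eq tuples_3_iff lam_conj del: lam.hom_mult lam.hom_inv)
  qed
qed

lemma cocycle_3: "mcb_cocycle X 3 (tensor A A) (Phi G M act \<phi> A lam 3 f)"
  by (rule cocycleI[OF birack_relation_3 fiber_relation_3])

end

section \<open>The Alexander cocycles in degrees 2 and 3\<close>

theorem theorem5p8:
  fixes G :: "('g, 'u) monoid_scheme"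
    and M :: "('m, 'v) ring_scheme"
    and act :: "'m \<Rightarrow> ('g \<Rightarrow>\<^sub>0 int) \<Rightarrow> 'm"
    and \<phi> :: "'g \<Rightarrow> 'g"
    and A :: "('a, 'w) monoid_scheme"
    and lam :: "'g \<Rightarrow> 'a"
  assumes "group G"
    and "right_module (group_ring G) M act"
    and "\<phi> \<in> hom G (G\<lparr>carrier := group_center G\<rparr>)"
    and "comm_group A"
    and "lam \<in> hom G A"
  shows
    "(\<forall>f. multilinear M A 2 f \<and> G_invariant G M act 2 f \<longrightarrow>
        mcb_cocycle (alexander_mcb G M act \<phi>) 2 (tensor A A) (Phi G M act \<phi> A lam 2 f) \<and>
        (\<forall>c \<in> carrier (mcb_P (alexander_mcb G M act \<phi>) 2).
           Phi G M act \<phi> A lam 2 f (mcb_class (alexander_mcb G M act \<phi>) 2 c)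
             = Phi_P G M act \<phi> A lam 2 f c) \<and>
        (\<forall>m1 \<in> carrier M. \<forall>m2 \<in> carrier M. \<forall>g1 \<in> carrier G. \<forall>g2 \<in> carrier G.
           Phi G M act \<phi> A lam 2 f
               (mcb_class (alexander_mcb G M act \<phi>) 2 (frag_of [[(m1, g1)], [(m2, g2)]]))
             = pure_tensor A A
                 (f [m1 \<ominus>\<^bsub>M\<^esub> m2,
                     act m2 (frag_of \<one>\<^bsub>G\<^esub> - frag_of (\<phi> g2 \<otimes>\<^bsub>G\<^esub> inv\<^bsub>G\<^esub> g2))])
                 (lam g1)))
     \<and>
     (\<forall>f. multilinear M A 3 f \<and> G_invariant G M act 3 f \<longrightarrow>
        mcb_cocycle (alexander_mcb G M act \<phi>) 3 (tensor A A) (Phi G M act \<phi> A lam 3 f) \<and>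
        (\<forall>c \<in> carrier (mcb_P (alexander_mcb G M act \<phi>) 3).
           Phi G M act \<phi> A lam 3 f (mcb_class (alexander_mcb G M act \<phi>) 3 c)
             = Phi_P G M act \<phi> A lam 3 f c) \<and>
        (\<forall>m1 \<in> carrier M. \<forall>m2 \<in> carrier M. \<forall>m3 \<in> carrier M.
         \<forall>g1 \<in> carrier G. \<forall>g2 \<in> carrier G. \<forall>g3 \<in> carrier G.
           Phi G M act \<phi> A lam 3 f
               (mcb_class (alexander_mcb G M act \<phi>) 3
                  (frag_of [[(m1, g1)], [(m2, g2)], [(m3, g3)]]))
             = pure_tensor A A
                 (f [act (m1 \<ominus>\<^bsub>M\<^esub> m2) (frag_of \<one>\<^bsub>G\<^esub> - frag_of (inv\<^bsub>G\<^esub> (\<phi> g2) \<otimes>\<^bsub>G\<^esub> g2)),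
                     m2 \<ominus>\<^bsub>M\<^esub> m3,
                     act m3 (frag_of \<one>\<^bsub>G\<^esub> - frag_of (\<phi> g3 \<otimes>\<^bsub>G\<^esub> inv\<^bsub>G\<^esub> g3))])
                 (lam g1)))"
proof -
  interpret alexander_data G M act A \<phi> lam
    using assms by (simp add: alexander_data_def alexander_data_axioms_def)
  have two: "bilinear_invariant G M act A \<phi> lam f"
    if "multilinear M A 2 f" "G_invariant G M act 2 f" for f
    using alexander_data_axioms that
    by (simp add: bilinear_invariant_def multilinear_invariant_def multilinear_invariant_axioms_def)
  have three: "trilinear_invariant G M act A \<phi> lam f"
    if "multilinear M A 3 f" "G_invariant G M act 3 f" for f
    using alexander_data_axioms that
    by (simp add: trilinear_invariant_def multilinear_invariant_def multilinear_invariant_axioms_def)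
  have defect: "act m (frag_of \<one>\<^bsub>G\<^esub> - frag_of (\<phi> g \<otimes>\<^bsub>G\<^esub> inv\<^bsub>G\<^esub> g)) = defect m g"
    and codefect: "act m (frag_of \<one>\<^bsub>G\<^esub> - frag_of (inv\<^bsub>G\<^esub> (\<phi> g) \<otimes>\<^bsub>G\<^esub> g)) = codefect m g"
    if "m \<in> carrier M" "g \<in> carrier G" for m g
    using that by (simp_all add: act_diff_frag_of defect_def codefect_def inv_twist twist_def[symmetric])
  show ?thesis
  proof (intro conjI allI impI ballI; elim conjE)
    fix f assume "multilinear M A 2 f" "G_invariant G M act 2 f"
    then interpret f: bilinear_invariant G M act A \<phi> lam f by (rule two)
    show "mcb_cocycle X 2 (tensor A A) (Phi G M act \<phi> A lam 2 f)"
      by (rule f.cocycle_2)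
    show "Phi G M act \<phi> A lam 2 f (mcb_class X 2 c) = Phi_P G M act \<phi> A lam 2 f c"
      if "c \<in> carrier (mcb_P X 2)" for c
      using that by (rule f.Phi_class)
    show "Phi G M act \<phi> A lam 2 f (mcb_class X 2 (frag_of [[(m1, g1)], [(m2, g2)]]))
      = pure_tensor A A (f [m1 \<ominus>\<^bsub>M\<^esub> m2,
          act m2 (frag_of \<one>\<^bsub>G\<^esub> - frag_of (\<phi> g2 \<otimes>\<^bsub>G\<^esub> inv\<^bsub>G\<^esub> g2))]) (lam g1)"
      if "m1 \<in> carrier M" "m2 \<in> carrier M" "g1 \<in> carrier G" "g2 \<in> carrier G" for m1 m2 g1 g2
      using that f.Phi_singletons[of "[(m1, g1), (m2, g2)]"]
      by (simp add: tuples_2_iff f.weight_2 defect)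
  next
    fix f assume "multilinear M A 3 f" "G_invariant G M act 3 f"
    then interpret f: trilinear_invariant G M act A \<phi> lam f by (rule three)
    show "mcb_cocycle X 3 (tensor A A) (Phi G M act \<phi> A lam 3 f)"
      by (rule f.cocycle_3)
    show "Phi G M act \<phi> A lam 3 f (mcb_class X 3 c) = Phi_P G M act \<phi> A lam 3 f c"
      if "c \<in> carrier (mcb_P X 3)" for c
      using that by (rule f.Phi_class)
    show "Phi G M act \<phi> A lam 3 f (mcb_class X 3 (frag_of [[(m1, g1)], [(m2, g2)], [(m3, g3)]]))
      = pure_tensor A A (f [act (m1 \<ominus>\<^bsub>M\<^esub> m2) (frag_of \<one>\<^bsub>G\<^esub> - frag_of (inv\<^bsub>G\<^esub> (\<phi> g2) \<otimes>\<^bsub>G\<^esub> g2)),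
          m2 \<ominus>\<^bsub>M\<^esub> m3,
          act m3 (frag_of \<one>\<^bsub>G\<^esub> - frag_of (\<phi> g3 \<otimes>\<^bsub>G\<^esub> inv\<^bsub>G\<^esub> g3))]) (lam g1)"
      if "m1 \<in> carrier M" "m2 \<in> carrier M" "m3 \<in> carrier M"
        "g1 \<in> carrier G" "g2 \<in> carrier G" "g3 \<in> carrier G" for m1 m2 m3 g1 g2 g3
      using that f.Phi_singletons[of "[(m1, g1), (m2, g2), (m3, g3)]"]
      by (simp add: tuples_3_iff f.weight_3 defect codefect)
  qed
qed

end
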